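(* Let $k\ge 1$ be an integer, let $\beta_0,\dots,\beta_{k-1}\in\mathbf{R}$ with $\beta_0\neq 0$, let $\lambda\in\{1,-1\}$ and let $\tau>0$ be arbitrary. Let $\{R^n,u^n\}$ be a solution of the time-stepping scheme $$ i\,\frac{R^{n+1}-R^n}{\tau} = -\Delta R^{n+1/2}+\frac{\lambda}{2}\bigl(|R^n|^2+|R^{n+1}|^2\bigr)R^{n+1/2},\qquad R^{n+1/2}:=\frac{R^{n+1}+R^n}{2}, $$ $$ u^{n+1}=\beta_0^{-1}\Bigl(R^{n+1}-\sum_{j=1}^{k-1}\beta_j u^{n+1-j}\Bigr) $$ (the sum being empty if $k=1$) for all $n\ge 0$ in the range of the computation, under homogeneous Dirichlet or periodic boundary conditions on $\mathcal{D}$. Define $$ \mathcal{M}^n:=\|R^n\|_{L^2(\mathcal{D})}^2,\qquad \mathcal{H}^n:=\frac12\|\nabla R^n\|_{L^2(\mathcal{D})}^2+\frac{\lambda}{4}\|R^n\|_{L^4(\mathcal{D})}^4 . $$ Then $\mathcal{M}^n=\mathcal{M}^0$ and $\mathcal{H}^n=\mathcal{H}^0$ for all $n\ge 1$.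
   Context: $\mathcal{D}\subset\mathbf{R}^d$ ($d=1,2,3$) is a bounded domain and all functions are complex valued on $\mathcal{D}$; $i=\sqrt{-1}$. In the homogeneous Dirichlet case $R^n\in H^2(\mathcal{D})\cap H^1_0(\mathcal{D})$; in the periodic case $\mathcal{D}$ is a box and $R^n$ is a periodic function of class $H^2$. The scheme approximates the cubic nonlinear Schrödinger equation $iu_t=-\Delta u+\lambda|u|^2u$. The two sequences are related by $R^n=\sum_{j=0}^{k-1}\beta_j u^{n-j}$; the starting values of $u$ are given (indexed so that $R^0$ is the first value of the sequence $R^n$ defined by them). *)

theory Defs
  imports "HOL-Analysis.Analysis"
begin

primrec times_continuously_differentiable :: "nat \<Rightarrow> ('a::euclidean_space \<Rightarrow> complex) \<Rightarrow> bool" where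
  "times_continuously_differentiable 0 f \<longleftrightarrow> continuous_on UNIV f"
| "times_continuously_differentiable (Suc m) f \<longleftrightarrow>
     (\<forall>x. f differentiable (at x)) \<and>
     (\<forall>b\<in>Basis. times_continuously_differentiable m (\<lambda>x. frechet_derivative f (at x) b))"

definition test_functions :: "'a::euclidean_space set \<Rightarrow> ('a \<Rightarrow> complex) set" where
  "test_functions D = {\<phi>. (\<forall>m. times_continuously_differentiable m \<phi>) \<and>
     compact (closure {x. \<phi> x \<noteq> 0}) \<and> closure {x. \<phi> x \<noteq> 0} \<subseteq> D}"

text \<open>Elements of Lebesgue and Sobolev spaces on \<open>D\<close> are represented by functions on the whole
  type; only their values almost everywhere on \<open>D\<close> matter.\<close>

definition L2_space :: "'a::euclidean_space set \<Rightarrow> ('a \<Rightarrow> complex) set" where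
  "L2_space D = {f. f \<in> borel_measurable (lebesgue_on D) \<and>
     integrable (lebesgue_on D) (\<lambda>x. (cmod (f x))\<^sup>2)}"

text \<open>Meant for finite \<open>p\<close>. The Bochner integral is \<open>0\<close> on non-integrable functions; the \<open>L\<^sup>2\<close> and
  \<open>L\<^sup>4\<close> norms below are only taken of functions for which they are finite, by the Sobolev
  embedding in dimension at most 3 in the latter case.\<close>

definition Lp_norm :: "'a::euclidean_space set \<Rightarrow> real \<Rightarrow> ('a \<Rightarrow> 'b::real_normed_vector) \<Rightarrow> real" where
  "Lp_norm D p f = (LINT x|lebesgue_on D. norm (f x) powr p) powr (1 / p)"

definition locally_integrable :: "'a::euclidean_space set \<Rightarrow> ('a \<Rightarrow> complex) \<Rightarrow> bool" where
  "locally_integrable D f \<longleftrightarrow> (\<forall>K. compact K \<and> K \<subseteq> D \<longrightarrow> f absolutely_integrable_on K)"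

definition has_weak_pderiv ::
  "'a::euclidean_space set \<Rightarrow> 'a \<Rightarrow> ('a \<Rightarrow> complex) \<Rightarrow> ('a \<Rightarrow> complex) \<Rightarrow> bool" where
  "has_weak_pderiv D b f g \<longleftrightarrow> locally_integrable D f \<and> locally_integrable D g \<and>
     (\<forall>\<phi>\<in>test_functions D.
        (LINT x|lebesgue_on D. f x * frechet_derivative \<phi> (at x) b)
        = - (LINT x|lebesgue_on D. g x * \<phi> x))"

text \<open>On an open set the weak derivative is unique up to null sets, so the choice below is
  immaterial for everything stated almost everywhere or in terms of integrals.\<close>

definition weak_pderiv :: "'a::euclidean_space set \<Rightarrow> 'a \<Rightarrow> ('a \<Rightarrow> complex) \<Rightarrow> 'a \<Rightarrow> complex" where
  "weak_pderiv D b f = (SOME g. has_weak_pderiv D b f g)"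

definition gradient_norm :: "'a::euclidean_space set \<Rightarrow> ('a \<Rightarrow> complex) \<Rightarrow> 'a \<Rightarrow> real" where
  "gradient_norm D f x = sqrt (\<Sum>b\<in>Basis. (cmod (weak_pderiv D b f x))\<^sup>2)"

definition laplacian :: "'a::euclidean_space set \<Rightarrow> ('a \<Rightarrow> complex) \<Rightarrow> 'a \<Rightarrow> complex" where
  "laplacian D f x = (\<Sum>b\<in>Basis. weak_pderiv D b (weak_pderiv D b f) x)"

definition H1_space :: "'a::euclidean_space set \<Rightarrow> ('a \<Rightarrow> complex) set" where
  "H1_space D = {f \<in> L2_space D. \<forall>b\<in>Basis. \<exists>g\<in>L2_space D. has_weak_pderiv D b f g}"

definition H2_space :: "'a::euclidean_space set \<Rightarrow> ('a \<Rightarrow> complex) set" where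
  "H2_space D = {f \<in> L2_space D. \<forall>b\<in>Basis. \<exists>g\<in>H1_space D. has_weak_pderiv D b f g}"

definition H1_norm :: "'a::euclidean_space set \<Rightarrow> ('a \<Rightarrow> complex) \<Rightarrow> real" where
  "H1_norm D f = sqrt ((Lp_norm D 2 f)\<^sup>2 + (Lp_norm D 2 (gradient_norm D f))\<^sup>2)"

definition H10_space :: "'a::euclidean_space set \<Rightarrow> ('a \<Rightarrow> complex) set" where
  "H10_space D = {f \<in> H1_space D. \<exists>\<phi>. (\<forall>m::nat. \<phi> m \<in> test_functions D) \<and>
     (\<lambda>m. H1_norm D (\<lambda>x. f x - \<phi> m x)) \<longlonglongrightarrow> 0}"

text \<open>A periodic function of class \<open>H\<^sup>2\<close> must be so across the faces of the box, which is why
  the regularity is required on all bounded open sets and not only on the box itself.\<close>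

definition periodic_H2_space :: "'a::euclidean_space \<Rightarrow> 'a \<Rightarrow> ('a \<Rightarrow> complex) set" where
  "periodic_H2_space p q = {f.
     (\<forall>b\<in>Basis. \<forall>x. f (x + ((q - p) \<bullet> b) *\<^sub>R b) = f x) \<and>
     (\<forall>U. open U \<and> bounded U \<longrightarrow> f \<in> H2_space U)}"

definition mass :: "'a::euclidean_space set \<Rightarrow> ('a \<Rightarrow> complex) \<Rightarrow> real" where
  "mass D f = (Lp_norm D 2 f)\<^sup>2"

definition hamiltonian :: "'a::euclidean_space set \<Rightarrow> real \<Rightarrow> ('a \<Rightarrow> complex) \<Rightarrow> real" where
  "hamiltonian D lam f = 1/2 * (Lp_norm D 2 (gradient_norm D f))\<^sup>2 + lam/4 * (Lp_norm D 4 f) ^ 4"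

definition R_step ::
  "'a::euclidean_space set \<Rightarrow> real \<Rightarrow> real \<Rightarrow> ('a \<Rightarrow> complex) \<Rightarrow> ('a \<Rightarrow> complex) \<Rightarrow> bool" where
  "R_step D lam \<tau> R R' \<longleftrightarrow>
     (let Rmid = (\<lambda>x. (R' x + R x) / 2)
      in AE x in lebesgue_on D.
           \<i> * ((R' x - R x) / of_real \<tau>) =
           - laplacian D Rmid x
           + of_real (lam / 2 * ((cmod (R x))\<^sup>2 + (cmod (R' x))\<^sup>2)) * Rmid x)"

end

theory Submission
  imports Defs
begin

text \<open>
  Let \<open>W\<close> be the nonlinear term of the scheme and write \<open>R\<close>, \<open>R'\<close> for two consecutive iterates. Mass
  is conserved because testing the equation with the conjugate of \<open>R' + R\<close> and taking imaginary
  parts leaves only the time difference: \<open>Re ((R' - R) cnj (R' + R))\<close> is the difference of the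
  squared moduli, while both \<open>W cnj (R' + R)\<close> and the integrated Laplacian are real. The
  Hamiltonian is conserved because testing with the conjugate of \<open>R' - R\<close> and taking real parts
  removes the time difference, and \<open>W\<close> has been chosen such that \<open>Re (W cnj (R' - R))\<close> is \<open>lam / 4\<close>
  times the difference of the fourth powers. This is \<open>one_step_conservation\<close>. The product of \<open>W\<close>
  with an iterate is integrable since \<open>W\<close> is square-integrable: the equation itself expresses it
  through a Laplacian and a time difference.

  Two analytic facts remain for each of the two boundary conditions.

  The first is the integration by parts that moves the Laplacian onto the factor it is tested
  with. For Dirichlet conditions it is the definition of the weak derivative, extended from test
  functions by density (\<open>Dirichlet_integration_by_parts\<close>). For periodic conditions
  (\<open>periodic_integration_by_parts\<close>) neither factor is smooth, and mollification is avoided as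
  follows. The integral over the box of \<open>(f g) (x + s b) - (f g) x\<close> vanishes by periodicity.
  A function with weak derivative \<open>f'\<close> along \<open>v\<close> satisfies
  \<open>f (x + v) - f x = \<integral> f' (x + t v) dt\<close> over the unit interval for almost every \<open>x\<close>
  (\<open>weak_pderiv_difference\<close>), so after division by \<open>s\<close> the vanishing integral differs from the
  integral of \<open>f' g + f g'\<close> by at most a constant times \<open>s\<close>.

  The second is that the iterates belong to \<open>L\<^sup>4\<close>, without which the integral of the difference of
  the fourth powers could not be split; this is where the dimension enters. The difference formula
  shows that shifts of an \<open>H\<^sup>1\<close> function of the whole space are Lipschitz continuous in \<open>L\<^sup>2\<close>. Hence
  its averages over cubes of side \<open>4\<^sup>-\<^sup>k\<close> deviate from it by at most a multiple of \<open>4\<^sup>-\<^sup>k\<close> in \<open>L\<^sup>2\<close>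
  and, in dimension at most three, are pointwise bounded by a multiple of \<open>2\<^sup>k\<close>
  (\<open>cube_average_growth\<close>). Where the function exceeds a suitable multiple of \<open>2\<^sup>k\<close> it is therefore dominated
  by that deviation, and summing over \<open>k\<close> gives the integrability of the fourth power
  (\<open>L4_of_Lipschitz_shifts\<close>). A Dirichlet iterate becomes an \<open>H\<^sup>1\<close> function of the whole space when
  extended by zero, a periodic one when multiplied by a cutoff.

  Everything rests on the uniqueness of weak derivatives, that is on the fundamental lemma of the
  calculus of variations (\<open>fundamental_lemma\<close>), since the gradient and the Laplacian are formed
  from weak derivatives selected by choice.
\<close>

section \<open>Smooth functions and their directional derivatives\<close>

abbreviation ddir :: "'a::euclidean_space \<Rightarrow> ('a \<Rightarrow> complex) \<Rightarrow> 'a \<Rightarrow> complex" where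
  "ddir b f \<equiv> (\<lambda>x. frechet_derivative f (at x) b)"

lemma ddir_eqI:
  assumes "\<And>x. (f has_derivative f' x) (at x)"
  shows "ddir b f = (\<lambda>x. f' x b)"
  using frechet_derivative_at[OF assms] by auto

text \<open>The recursive definition demands continuity only of the derivatives of the highest order; that of
  the lower ones follows from differentiability.\<close>

lemma tcd_Suc_imp:
  "times_continuously_differentiable (Suc m) f \<Longrightarrow> times_continuously_differentiable m f"
proof (induction m arbitrary: f)
  case 0
  then have "\<forall>x. f differentiable at x" by simp
  then show ?case
    by (simp add: continuous_at_imp_continuous_on differentiable_imp_continuous_within)
next
  case (Suc m)
  then show ?case by (metis times_continuously_differentiable.simps(2))
qed

lemma ddir_direction:
  assumes "\<phi> differentiable at x"
  shows "ddir v \<phi> x = (\<Sum>i\<in>Basis. of_real (v \<bullet> i) * ddir i \<phi> x)" "ddir (- v) \<phi> x = - ddir v \<phi> x"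
proof -
  have lin: "linear (frechet_derivative \<phi> (at x))"
    using assms by (rule linear_frechet_derivative)
  have "frechet_derivative \<phi> (at x) v = frechet_derivative \<phi> (at x) (\<Sum>i\<in>Basis. (v \<bullet> i) *\<^sub>R i)"
    by (simp add: euclidean_representation)
  also have "\<dots> = (\<Sum>i\<in>Basis. of_real (v \<bullet> i) * ddir i \<phi> x)"
    by (simp add: linear_sum[OF lin] linear_scale[OF lin] scaleR_conv_of_real)
  finally show "ddir v \<phi> x = (\<Sum>i\<in>Basis. of_real (v \<bullet> i) * ddir i \<phi> x)" .
  show "ddir (- v) \<phi> x = - ddir v \<phi> x" using linear_neg[OF lin] .
qed

lemma continuous_ddir:
  assumes "times_continuously_differentiable (Suc 0) f"
  shows "continuous_on UNIV (ddir v f)"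
proof -
  have "ddir v f = (\<lambda>x. \<Sum>i\<in>Basis. of_real (v \<bullet> i) * ddir i f x)"
    using assms by (intro ext ddir_direction) auto
  moreover have "continuous_on UNIV (ddir i f)" if "i \<in> Basis" for i
    using assms that by simp
  then have "continuous_on UNIV (\<lambda>x. \<Sum>i\<in>Basis. of_real (v \<bullet> i) * ddir i f x)"
    by (intro continuous_intros)
  ultimately show ?thesis by metis
qed

lemma tcd_const: "times_continuously_differentiable m (\<lambda>x. c)"
  by (induction m arbitrary: c) auto

lemma tcd_add:
  "times_continuously_differentiable m f \<Longrightarrow> times_continuously_differentiable m g \<Longrightarrow>
   times_continuously_differentiable m (\<lambda>x. f x + g x)"
proof (induction m arbitrary: f g)
  case 0
  then show ?case by (auto intro: continuous_intros)
next
  case (Suc m)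
  then have df: "f differentiable at x" "g differentiable at x" for x by auto
  have "ddir b (\<lambda>x. f x + g x) = (\<lambda>x. ddir b f x + ddir b g x)" for b
    by (rule ddir_eqI) (intro has_derivative_add df[unfolded frechet_derivative_works])
  then show ?case using Suc df by (auto intro: differentiable_add)
qed

lemma tcd_linear:
  assumes L: "bounded_linear (L :: complex \<Rightarrow> complex)"
  shows "times_continuously_differentiable m f \<Longrightarrow> times_continuously_differentiable m (\<lambda>x. L (f x))"
proof (induction m arbitrary: f)
  case 0
  then show ?case using L by (auto intro: bounded_linear.continuous_on)
next
  case (Suc m)
  then have df: "f differentiable at x" for x by auto
  have D: "((\<lambda>x. L (f x)) has_derivative (\<lambda>h. L (frechet_derivative f (at x) h))) (at x)" for x
    by (rule bounded_linear.has_derivative[OF L]) (use df frechet_derivative_works in blast)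
  have "ddir b (\<lambda>x. L (f x)) = (\<lambda>x. L (ddir b f x))" for b
    by (rule ddir_eqI[OF D])
  then show ?case using Suc D by (auto simp: differentiable_def)
qed

lemma ddir_mult:
  assumes "\<And>x. f differentiable at x" "\<And>x. g differentiable at x"
  shows "ddir b (\<lambda>x. f x * g x) = (\<lambda>x. f x * ddir b g x + ddir b f x * g x)"
  by (rule ddir_eqI) (intro has_derivative_mult assms[unfolded frechet_derivative_works])

lemma tcd_mult:
  "times_continuously_differentiable m f \<Longrightarrow> times_continuously_differentiable m g \<Longrightarrow>
   times_continuously_differentiable m (\<lambda>x. f x * g x)"
proof (induction m arbitrary: f g)
  case 0
  then show ?case by (auto intro: continuous_intros)
next
  case (Suc m)
  then have df: "f differentiable at x" "g differentiable at x" for x by auto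
  have *: "times_continuously_differentiable m f" "times_continuously_differentiable m g"
    using Suc.prems tcd_Suc_imp by blast+
  show ?case using Suc df *
    by (auto intro!: differentiable_mult tcd_add Suc.IH simp: ddir_mult[OF df])
qed

lemma tcd_prod:
  "finite I \<Longrightarrow> (\<And>i. i \<in> I \<Longrightarrow> times_continuously_differentiable m (f i)) \<Longrightarrow>
   times_continuously_differentiable m (\<lambda>x. \<Prod>i\<in>I. f i x)"
  by (induction I rule: finite_induct) (auto intro: tcd_const tcd_mult)

lemma ddir_shift:
  assumes "\<And>x. f differentiable at x"
  shows "ddir b (\<lambda>x. f (x + v)) = (\<lambda>x. ddir b f (x + v))"
proof (rule ddir_eqI)
  fix x
  have "(f has_derivative frechet_derivative f (at (x + v))) (at (x + v))"
    using assms frechet_derivative_works by blast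
  then show "((\<lambda>x. f (x + v)) has_derivative frechet_derivative f (at (x + v))) (at x)"
    by (rule has_derivative_compose[rotated]) (auto intro!: derivative_eq_intros)
qed

lemma tcd_shift:
  "times_continuously_differentiable m f \<Longrightarrow> times_continuously_differentiable m (\<lambda>x. f (x + v))"
proof (induction m arbitrary: f)
  case 0
  then show ?case
    by (auto intro!: continuous_on_compose2[of UNIV f] continuous_intros)
next
  case (Suc m)
  then have df: "f differentiable at x" for x by auto
  have "f differentiable at (x + v)" for x using df by auto
  then have "(\<lambda>x. f (x + v)) differentiable at x" for x
    by (rule differentiable_compose) auto
  then show ?case using Suc by (auto simp: ddir_shift[OF df])
qed

section \<open>Compactly supported smooth functions\<close>

text \<open>The family is closed under differentiation up to linear combinations, which is why the powers of
  \<open>t\<close> are carried along. The parameter \<open>c\<close> is sent to \<open>0\<close> to approximate indicator functions.\<close>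

definition flat_exp :: "real \<Rightarrow> nat \<Rightarrow> real \<Rightarrow> real" where
  "flat_exp c n t = (if t > 0 then exp (- c / t) / t ^ n else 0)"

lemma power_div_fact_le_exp:
  fixes x :: real assumes "x \<ge> 0" shows "x ^ n / fact n \<le> exp x"
proof -
  have "(\<Sum>i\<in>{n}. x ^ i /\<^sub>R fact i) \<le> (\<Sum>i. x ^ i /\<^sub>R fact i)"
    using assms by (intro sum_le_suminf summable_exp_generic) (auto)
  then show ?thesis by (simp add: exp_def divide_inverse mult.commute)
qed

text \<open>The exponential beats every power: one term of its series yields the bound by \<open>t\<^sup>2\<close> from which
  the derivative at \<open>0\<close> can be read off.\<close>

lemma flat_exp_le:
  assumes "c > 0"
  shows "\<bar>flat_exp c n t\<bar> \<le> fact (n + 2) / c ^ (n + 2) * t\<^sup>2"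
proof (cases "t > 0")
  case True
  have "(c / t) ^ (n + 2) / fact (n + 2) \<le> exp (c / t)"
    using assms True by (intro power_div_fact_le_exp) auto
  then have "exp (- c / t) \<le> inverse ((c / t) ^ (n + 2) / fact (n + 2))"
    using assms True by (subst minus_divide_left[symmetric], subst exp_minus, intro le_imp_inverse_le) auto
  also have "\<dots> = fact (n + 2) / c ^ (n + 2) * t\<^sup>2 * t ^ n"
    using assms True by (simp add: field_simps power_add power2_eq_square del: fact_Suc)
  finally show ?thesis using True by (simp add: flat_exp_def field_simps)
qed (use assms in \<open>simp add: flat_exp_def\<close>)

lemma flat_exp_deriv:
  assumes c: "c > 0"
  shows "(flat_exp c n has_real_derivative c * flat_exp c (n + 2) t - n * flat_exp c (n + 1) t) (at t)"
proof -
  consider "t > 0" | "t < 0" | "t = 0" by linarith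
  then show ?thesis
  proof cases
    case 1
    have "((\<lambda>t. exp (- c / t) / t ^ n) has_real_derivative c * flat_exp c (n + 2) t - n * flat_exp c (n + 1) t) (at t)"
      using 1 unfolding flat_exp_def
      apply (auto intro!: derivative_eq_intros)
      apply (cases n)
       apply (auto simp: field_simps power_add power2_eq_square)
      done
    then show ?thesis
      by (rule has_field_derivative_transform_within_open[of _ _ _ "{0<..}"])
         (use 1 in \<open>auto simp: flat_exp_def\<close>)
  next
    case 2
    have "((\<lambda>t. 0) has_real_derivative c * flat_exp c (n + 2) t - n * flat_exp c (n + 1) t) (at t)"
      using 2 by (simp add: flat_exp_def)
    then show ?thesis
      by (rule has_field_derivative_transform_within_open[of _ _ _ "{..<0}"])
         (use 2 in \<open>auto simp: flat_exp_def\<close>)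
  next
    case 3
    define M where "M = fact (n + 2) / c ^ (n + 2)"
    have le: "\<bar>flat_exp c n h / h\<bar> \<le> M * \<bar>h\<bar>" if "h \<noteq> 0" for h
      using flat_exp_le[OF c, of n h, folded M_def] that
      by (simp add: abs_divide divide_le_eq power2_eq_square mult.assoc flip: abs_mult)
    have "((\<lambda>h. flat_exp c n h / h) \<longlongrightarrow> 0) (at 0)"
    proof (rule Lim_null_comparison)
      show "\<forall>\<^sub>F h in at 0. norm (flat_exp c n h / h) \<le> M * \<bar>h\<bar>"
        using le by (auto simp: eventually_at_filter)
      show "((\<lambda>h. M * \<bar>h\<bar>) \<longlongrightarrow> 0) (at 0)"
        by (auto intro!: tendsto_eq_intros)
    qed
    then show ?thesis
      using 3 by (simp add: has_field_derivative_iff flat_exp_def)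
  qed
qed

lemma tcd_flat_exp:
  fixes a :: "'a::euclidean_space"
  assumes c: "c > 0"
  shows "times_continuously_differentiable m (\<lambda>x. complex_of_real (flat_exp c n (x \<bullet> a + k)))"
proof (induction m arbitrary: n)
  case 0
  have "continuous_on UNIV (flat_exp c n)"
    by (intro continuous_at_imp_continuous_on ballI DERIV_isCont[OF flat_exp_deriv[OF c]])
  then show ?case
    by (auto intro!: continuous_on_of_real continuous_on_compose2[of UNIV "flat_exp c n"]
        continuous_on_add continuous_on_inner continuous_on_id continuous_on_const)
next
  case (Suc m)
  have D: "((\<lambda>x. complex_of_real (flat_exp c n (x \<bullet> a + k))) has_derivative
      (\<lambda>h. of_real ((c * flat_exp c (n + 2) (x \<bullet> a + k) - n * flat_exp c (n + 1) (x \<bullet> a + k)) * (h \<bullet> a)))) (at x)"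
    for x
  proof (intro has_derivative_of_real)
    have "(flat_exp c n has_derivative (*) (c * flat_exp c (n + 2) (x \<bullet> a + k) - n * flat_exp c (n + 1) (x \<bullet> a + k)))
        (at (x \<bullet> a + k))"
      using flat_exp_deriv[OF c] by (simp add: has_field_derivative_def)
    then show "((\<lambda>x. flat_exp c n (x \<bullet> a + k)) has_derivative
        (\<lambda>h. (c * flat_exp c (n + 2) (x \<bullet> a + k) - n * flat_exp c (n + 1) (x \<bullet> a + k)) * (h \<bullet> a))) (at x)"
      by (rule has_derivative_compose[rotated]) (auto intro!: derivative_eq_intros)
  qed
  have eq: "ddir b (\<lambda>x. complex_of_real (flat_exp c n (x \<bullet> a + k))) =
     (\<lambda>x. of_real (c * (b \<bullet> a)) * of_real (flat_exp c (n + 2) (x \<bullet> a + k)) +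
        of_real (- n * (b \<bullet> a)) * of_real (flat_exp c (n + 1) (x \<bullet> a + k)))" for b
    unfolding ddir_eqI[OF D] by (auto simp: algebra_simps)
  show ?case
    unfolding times_continuously_differentiable.simps eq
    by (intro conjI allI ballI tcd_add tcd_mult tcd_const Suc) (use D in \<open>unfold differentiable_def, blast\<close>)
qed

lemma test_functions_D:
  assumes "\<phi> \<in> test_functions D"
  shows "times_continuously_differentiable m \<phi>" "compact (closure {x. \<phi> x \<noteq> 0})"
    "closure {x. \<phi> x \<noteq> 0} \<subseteq> D" "\<phi> differentiable at x" "continuous_on UNIV \<phi>"
    "continuous_on UNIV (ddir b \<phi>)"
proof -
  show *: "times_continuously_differentiable m \<phi>" "compact (closure {x. \<phi> x \<noteq> 0})"
    "closure {x. \<phi> x \<noteq> 0} \<subseteq> D" for m using assms by (auto simp: test_functions_def)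
  show "\<phi> differentiable at x" for x using *(1)[of 1] by simp
  show "continuous_on UNIV \<phi>" using *(1)[of 0] by simp
  show "continuous_on UNIV (ddir b \<phi>)" using *(1) by (rule continuous_ddir)
qed

lemma test_functionsI:
  assumes "\<And>m. times_continuously_differentiable m \<phi>" "compact K" "K \<subseteq> D" "\<And>x. x \<notin> K \<Longrightarrow> \<phi> x = 0"
  shows "\<phi> \<in> test_functions D"
proof -
  have "closure {x. \<phi> x \<noteq> 0} \<subseteq> K"
    using assms by (intro closure_minimal) (auto intro: compact_imp_closed)
  moreover from this have "compact (closure {x. \<phi> x \<noteq> 0})"
    using assms(2) by (meson closed_closure compact_closure bounded_subset compact_imp_bounded closure_subset order_trans)
  ultimately show ?thesis using assms by (auto simp: test_functions_def)
qed

text \<open>Derivatives vanish off the support as well, since there the function is locally zero.\<close>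

lemma test_functions_supp:
  assumes "\<phi> \<in> test_functions D"
  obtains K where "compact K" "K \<subseteq> D" "\<And>x. x \<notin> K \<Longrightarrow> \<phi> x = 0" "\<And>b x. x \<notin> K \<Longrightarrow> ddir b \<phi> x = 0"
proof
  let ?K = "closure {x. \<phi> x \<noteq> 0}"
  show "compact ?K" "?K \<subseteq> D" using test_functions_D[OF assms] by auto
  show "\<phi> x = 0" if "x \<notin> ?K" for x using that closure_subset[of "{x. \<phi> x \<noteq> 0}"] by auto
  show "ddir b \<phi> x = 0" if "x \<notin> ?K" for x b
  proof -
    have "frechet_derivative (\<lambda>x. 0) (at x) = frechet_derivative \<phi> (at x)"
      by (rule frechet_derivative_transform_within_open[of _ _ "- ?K"])
         (use that closure_subset[of "{x. \<phi> x \<noteq> 0}"] in auto)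
    then show ?thesis by (metis frechet_derivative_const)
  qed
qed

lemma test_functions_mono: "D \<subseteq> E \<Longrightarrow> \<phi> \<in> test_functions D \<Longrightarrow> \<phi> \<in> test_functions E"
  by (auto simp: test_functions_def)

lemma test_functions_mult:
  assumes "\<phi> \<in> test_functions D" "\<And>m. times_continuously_differentiable m \<psi>"
  shows "(\<lambda>x. \<psi> x * \<phi> x) \<in> test_functions D"
proof -
  obtain K where "compact K" "K \<subseteq> D" "\<And>x. x \<notin> K \<Longrightarrow> \<phi> x = 0"
    using test_functions_supp[OF assms(1)] by metis
  then show ?thesis
    by (intro test_functionsI[of _ K] tcd_mult assms(2) test_functions_D[OF assms(1)]) auto
qed

lemma test_functions_shift:
  assumes "\<phi> \<in> test_functions UNIV"
  shows "(\<lambda>x. \<phi> (x + v)) \<in> test_functions UNIV"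
proof -
  obtain K where K: "compact K" "\<And>x. x \<notin> K \<Longrightarrow> \<phi> x = 0"
    using test_functions_supp[OF assms(1)] by metis
  show ?thesis
  proof (rule test_functionsI[of _ "(\<lambda>x. x - v) ` K"])
    show "compact ((\<lambda>x. x - v) ` K)"
      using K by (intro compact_continuous_image continuous_intros)
    fix x assume "x \<notin> (\<lambda>x. x - v) ` K"
    then have "x + v \<notin> K" by force
    then show "\<phi> (x + v) = 0" by (rule K)
  qed (use assms in \<open>auto intro: tcd_shift test_functions_D\<close>)
qed

lemma test_functions_cnj:
  assumes "\<phi> \<in> test_functions D"
  shows "(\<lambda>x. cnj (\<phi> x)) \<in> test_functions D" "ddir b (\<lambda>x. cnj (\<phi> x)) = (\<lambda>x. cnj (ddir b \<phi> x))"
proof -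
  obtain K where K: "compact K" "K \<subseteq> D" "\<And>x. x \<notin> K \<Longrightarrow> \<phi> x = 0"
    using test_functions_supp[OF assms(1)] by metis
  show "(\<lambda>x. cnj (\<phi> x)) \<in> test_functions D"
    by (rule test_functionsI[of _ K])
       (use K assms in \<open>auto intro: tcd_linear[OF bounded_linear_cnj] test_functions_D\<close>)
  have D: "((\<lambda>x. cnj (\<phi> x)) has_derivative (\<lambda>h. cnj (frechet_derivative \<phi> (at x) h))) (at x)" for x
    by (rule bounded_linear.has_derivative[OF bounded_linear_cnj])
       (use test_functions_D(4)[OF assms] frechet_derivative_works in blast)
  show "ddir b (\<lambda>x. cnj (\<phi> x)) = (\<lambda>x. cnj (ddir b \<phi> x))"
    by (rule ddir_eqI[OF D])
qed

text \<open>The summand \<open>- (p \<bullet> b)\<close> and the inner product with \<open>- b\<close> bring both factors into the form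
  \<open>x \<bullet> a + k\<close> of \<open>tcd_flat_exp\<close>.\<close>

definition bump :: "real \<Rightarrow> 'a::euclidean_space \<Rightarrow> 'a \<Rightarrow> 'a \<Rightarrow> complex" where
  "bump c p q x = (\<Prod>b\<in>Basis. of_real (flat_exp c 0 (x \<bullet> b + - (p \<bullet> b))) * of_real (flat_exp c 0 (x \<bullet> (- b) + q \<bullet> b)))"

lemma tcd_bump: "c > 0 \<Longrightarrow> times_continuously_differentiable m (bump c p q)"
  unfolding bump_def[abs_def] by (intro tcd_prod tcd_mult tcd_flat_exp) auto

lemma bump_outside: "x \<notin> box p q \<Longrightarrow> bump c p q x = 0"
  unfolding bump_def by (auto simp: mem_box flat_exp_def intro!: bexI)

lemma bump_pos: "x \<in> box p q \<Longrightarrow> bump c p q x \<noteq> 0"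
  unfolding bump_def by (auto simp: mem_box flat_exp_def)

lemma bump_test:
  assumes "c > 0" "cbox p q \<subseteq> D"
  shows "bump c p q \<in> test_functions D"
  using assms box_subset_cbox[of p q]
  by (intro test_functionsI[of _ "cbox p q"] tcd_bump bump_outside) auto

lemma norm_bump_le: "c > 0 \<Longrightarrow> norm (bump c p q x) \<le> 1"
  unfolding bump_def prod_norm[symmetric] by (rule prod_le_1) (auto simp: flat_exp_def norm_mult intro!: mult_le_one)

text \<open>Inside the box every factor tends to \<open>1\<close>, because \<open>exp (- c / t)\<close> does as \<open>c\<close> tends to \<open>0\<close>.\<close>

lemma bump_tendsto_indicator:
  "(\<lambda>n. bump (1 / Suc n) p q x) \<longlonglongrightarrow> indicator (box p q) x"
proof (cases "x \<in> box p q")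
  case True
  have E: "(\<lambda>n. flat_exp (1 / Suc n) 0 t) \<longlonglongrightarrow> 1" if "t > 0" for t
  proof -
    have "(\<lambda>n. exp (- (1 / Suc n) / t)) \<longlonglongrightarrow> exp (- 0 / t)"
      by (intro tendsto_intros LIMSEQ_inverse_real_of_nat[unfolded inverse_eq_divide]) (use that in auto)
    then show ?thesis using that by (simp add: flat_exp_def)
  qed
  have "(\<lambda>n. bump (1 / Suc n) p q x) \<longlonglongrightarrow> (\<Prod>b\<in>(Basis :: 'a set). of_real 1 * of_real 1)"
    unfolding bump_def by (intro tendsto_intros E) (use True in \<open>auto simp: mem_box\<close>)
  then show ?thesis using True by simp
qed (simp add: bump_outside)

section \<open>The fundamental lemma of the calculus of variations\<close>

lemma complex_borel_representative:
  fixes f :: "'a::euclidean_space \<Rightarrow> complex"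
  assumes "f \<in> borel_measurable lebesgue"
  obtains g where "g \<in> borel_measurable borel" "AE x in lebesgue. f x = g x"
proof -
  have "(\<lambda>x. Re (f x)) \<in> borel_measurable lebesgue" "(\<lambda>x. Im (f x)) \<in> borel_measurable lebesgue"
    using assms by auto
  then obtain r i where ri: "r \<in> borel_measurable lborel" "i \<in> borel_measurable lborel"
    "AE x in lborel. Re (f x) = r x" "AE x in lborel. Im (f x) = i x"
    by (metis completion_ex_borel_measurable_real)
  then have "AE x in lebesgue. f x = Complex (r x) (i x)"
    by (intro AE_completion) (auto simp: complex_eq_iff)
  moreover have "(\<lambda>x. Complex (r x) (i x)) \<in> borel_measurable borel"
    using ri by (simp add: borel_measurable_complex_iff)
  ultimately show ?thesis using that by blast
qed

lemma integral_lebesgue_on_supported: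
  fixes f :: "'a::euclidean_space \<Rightarrow> 'b::{banach, second_countable_topology}"
  assumes "D \<in> sets lebesgue" "\<And>x. x \<notin> D \<Longrightarrow> f x = 0"
  shows "integral\<^sup>L (lebesgue_on D) f = integral\<^sup>L lebesgue f"
    "integrable (lebesgue_on D) f \<longleftrightarrow> integrable lebesgue f"
proof -
  have eq: "(\<lambda>x. indicator D x *\<^sub>R f x) = f" using assms(2) by (auto simp: indicator_def)
  show "integral\<^sup>L (lebesgue_on D) f = integral\<^sup>L lebesgue f"
    using assms(1) by (subst integral_restrict_space) (auto simp: eq)
  show "integrable (lebesgue_on D) f \<longleftrightarrow> integrable lebesgue f"
    using assms(1) by (subst integrable_restrict_space) (auto simp: eq)
qed

lemma bounded_by_indicator:
  assumes "continuous_on UNIV h" "compact K" "\<And>x. x \<notin> K \<Longrightarrow> h x = (0::complex)"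
  obtains M where "\<And>x. norm (h x) \<le> M * indicator K x"
proof -
  have "compact (h ` K)" using assms by (intro compact_continuous_image) (auto intro: continuous_on_subset)
  then obtain M where M: "\<And>x. x \<in> K \<Longrightarrow> norm (h x) \<le> M"
    by (meson bounded_iff compact_imp_bounded imageI)
  have "norm (h x) \<le> M * indicator K x" for x
    using M[of x] assms(3)[of x] by (cases "x \<in> K") auto
  then show ?thesis by (rule that)
qed

lemma set_integrable_mult_continuous:
  fixes f :: "'a::euclidean_space \<Rightarrow> complex"
  assumes f: "set_integrable lebesgue K f" and K: "compact K" and h: "continuous_on UNIV h"
  shows "set_integrable lebesgue K (\<lambda>x. f x * h x)"
proof -
  have "compact (h ` K)" using h K by (intro compact_continuous_image) (auto intro: continuous_on_subset)
  then obtain M where M: "\<And>x. x \<in> K \<Longrightarrow> norm (h x) \<le> M"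
    by (meson bounded_iff compact_imp_bounded imageI)
  have hm: "h \<in> borel_measurable lebesgue"
    using h by (simp add: borel_measurable_continuous_onI measurable_completion)
  have eq: "(\<lambda>x. indicator K x *\<^sub>R (f x * h x)) = (\<lambda>x. (indicator K x *\<^sub>R f x) * h x)"
    by (auto simp: indicator_def)
  have le: "norm (indicat_real K x *\<^sub>R f x * h x) \<le> norm (M *\<^sub>R (indicator K x *\<^sub>R f x))" for x
  proof (cases "x \<in> K")
    case True
    then have "norm (h x) \<le> \<bar>M\<bar>" using M by fastforce
    then have "norm (f x) * norm (h x) \<le> norm (f x) * \<bar>M\<bar>" by (rule mult_left_mono) simp
    then show ?thesis using True by (simp add: norm_mult mult.commute)
  qed simp
  show ?thesis unfolding set_integrable_def eq
    using f unfolding set_integrable_def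
    by (intro Bochner_Integration.integrable_bound[OF integrable_scaleR_right[of M] _ AE_I2[OF le]]
        borel_measurable_times[OF borel_measurable_integrable] hm)
qed

lemma integrable_mult_supported:
  fixes f :: "'a::euclidean_space \<Rightarrow> complex"
  assumes f: "locally_integrable D f" and K: "compact K" "K \<subseteq> D" "\<And>x. x \<notin> K \<Longrightarrow> h x = 0"
    and h: "continuous_on UNIV h"
  shows "integrable lebesgue (\<lambda>x. f x * h x)"
proof -
  have "set_integrable lebesgue K (\<lambda>x. f x * h x)"
    using f K h by (intro set_integrable_mult_continuous) (auto simp: locally_integrable_def)
  moreover have "(\<lambda>x. indicator K x *\<^sub>R (f x * h x)) = (\<lambda>x. f x * h x)"
    using K(3) by (auto simp: indicator_def)
  ultimately show ?thesis by (simp add: set_integrable_def)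
qed

lemma integrable_mult_test:
  assumes f: "locally_integrable D f" and phi: "\<phi> \<in> test_functions D"
  shows "integrable lebesgue (\<lambda>x. f x * \<phi> x)" "integrable lebesgue (\<lambda>x. f x * ddir b \<phi> x)"
proof -
  obtain K where K: "compact K" "K \<subseteq> D" "\<And>x. x \<notin> K \<Longrightarrow> \<phi> x = 0" "\<And>b x. x \<notin> K \<Longrightarrow> ddir b \<phi> x = 0"
    using test_functions_supp[OF phi] by blast
  show "integrable lebesgue (\<lambda>x. f x * \<phi> x)"
    using K by (intro integrable_mult_supported[OF f K(1,2)] test_functions_D[OF phi])
  show "integrable lebesgue (\<lambda>x. f x * ddir b \<phi> x)"
    using K by (intro integrable_mult_supported[OF f K(1,2)] test_functions_D[OF phi])
qed

lemma integral_mult_test: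
  assumes "D \<in> sets lebesgue" and phi: "\<phi> \<in> test_functions D"
  shows "(LINT x|lebesgue_on D. f x * \<phi> x) = (LINT x|lebesgue. f x * \<phi> x)"
    "(LINT x|lebesgue_on D. f x * ddir b \<phi> x) = (LINT x|lebesgue. f x * ddir b \<phi> x)"
proof -
  obtain K where K: "compact K" "K \<subseteq> D" "\<And>x. x \<notin> K \<Longrightarrow> \<phi> x = 0" "\<And>b x. x \<notin> K \<Longrightarrow> ddir b \<phi> x = 0"
    using test_functions_supp[OF phi] by blast
  show "(LINT x|lebesgue_on D. f x * \<phi> x) = (LINT x|lebesgue. f x * \<phi> x)"
    by (rule integral_lebesgue_on_supported) (use assms K in auto)
  show "(LINT x|lebesgue_on D. f x * ddir b \<phi> x) = (LINT x|lebesgue. f x * ddir b \<phi> x)"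
    by (rule integral_lebesgue_on_supported) (use assms K in auto)
qed

text \<open>Boxes form an intersection-stable generator of the Borel sets, so the integral of \<open>h\<close> vanishes
  over every Borel set. The whole space has to be assumed separately: it is not a box.\<close>

lemma AE_zero_if_box_integrals_zero:
  fixes h :: "'a::euclidean_space \<Rightarrow> complex"
  assumes h: "integrable lborel h" and 0: "\<And>p q. (LINT x:box p q|lborel. h x) = 0" "integral\<^sup>L lborel h = 0"
  shows "AE x in lborel. h x = 0"
proof (rule sigma_finite_measure.density_zero[OF sigma_finite_lborel h])
  fix A :: "'a set" assume "A \<in> sets lborel"
  then have A: "A \<in> sigma_sets UNIV (range (\<lambda>(a, b). box a b))"
    by (simp add: borel_eq_box)
  have "Int_stable (range (\<lambda>(a, b::'a). box a b))"
    by (auto simp: Int_stable_def box_Int_box)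
  moreover have "range (\<lambda>(a, b::'a). box a b) \<subseteq> Pow UNIV" by simp
  moreover note A
  ultimately show "(LINT x:A|lborel. h x) = 0"
  proof (induction rule: sigma_sets_induct_disjoint)
    case (basic A) then show ?case using 0 by auto
  next
    case empty then show ?case by (simp add: set_lebesgue_integral_def)
  next
    case (compl A)
    then have A: "A \<in> sets borel" by (simp add: borel_eq_box)
    have "(LINT x:UNIV - A|lborel. h x) = integral\<^sup>L lborel (\<lambda>x. h x - indicator A x *\<^sub>R h x)"
      unfolding set_lebesgue_integral_def by (intro Bochner_Integration.integral_cong) (auto simp: indicator_def)
    also have "\<dots> = integral\<^sup>L lborel h - (LINT x:A|lborel. h x)"
      unfolding set_lebesgue_integral_def
      by (intro Bochner_Integration.integral_diff h integrable_mult_indicator) (use A in auto)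
    finally show ?case using compl 0 by simp
  next
    case (union A)
    then have A: "A i \<in> sets borel" for i by (auto simp: borel_eq_box)
    have "(LINT x:(\<Union>i. A i)|lborel. h x) = (\<Sum>i. (LINT x:A i|lborel. h x))"
    proof (rule lebesgue_integral_countable_add)
      show "A i \<in> sets lborel" for i using A by simp
      show "A i \<inter> A j = {}" if "i \<noteq> j" for i j using union that by (auto simp: disjoint_family_on_def)
      show "set_integrable lborel (\<Union> (range A)) h"
        unfolding set_integrable_def by (intro integrable_mult_indicator h) (use A in auto)
    qed
    then show ?case using union by simp
  qed
qed

text \<open>Bump functions converge boundedly to the indicator function of a box, so \<open>g\<close> integrates to zero
  over each box whose closure lies in \<open>D\<close>; countably many such boxes cover \<open>D\<close> up to a null set.\<close>

lemma fundamental_lemma: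
  fixes g :: "'a::euclidean_space \<Rightarrow> complex"
  assumes D: "open D" and g: "locally_integrable D g"
    and 0: "\<And>\<phi>. \<phi> \<in> test_functions D \<Longrightarrow> (LINT x|lebesgue. g x * \<phi> x) = 0"
  shows "AE x in lebesgue. x \<in> D \<longrightarrow> g x = 0"
proof -
  \<comment> \<open>Boundedness of the bump functions by the indicator of the closed box, which is
      compact in \<open>D\<close>, gives the integrable majorant.\<close>
  have boxes: "(LINT x:box p q|lebesgue. g x) = 0" if sub: "cbox p q \<subseteq> D" for p q
  proof -
    have gi: "set_integrable lebesgue (cbox p q) g"
      using g sub by (auto simp: locally_integrable_def)
    have "(\<lambda>n. LINT x|lebesgue. g x * bump (1 / Suc n) p q x) \<longlonglongrightarrow>
       (LINT x|lebesgue. g x * indicator (box p q) x)"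
    proof (rule integral_dominated_convergence)
      have conv: "(\<lambda>n. g x * bump (1 / Suc n) p q x) \<longlonglongrightarrow> g x * indicator (box p q) x" for x
        by (intro tendsto_intros bump_tendsto_indicator)
      then show "AE x in lebesgue. (\<lambda>n. g x * bump (1 / Suc n) p q x) \<longlonglongrightarrow> g x * indicator (box p q) x"
        by simp
      show m: "(\<lambda>x. g x * bump (1 / Suc n) p q x) \<in> borel_measurable lebesgue" for n
        by (intro borel_measurable_integrable integrable_mult_test[OF g] bump_test sub) auto
      show "(\<lambda>x. g x * indicator (box p q) x) \<in> borel_measurable lebesgue"
        by (rule borel_measurable_LIMSEQ_metric[OF m]) (rule conv)
      show "integrable lebesgue (\<lambda>x. norm (indicator (cbox p q) x *\<^sub>R g x))"
        using gi unfolding set_integrable_def by (rule integrable_norm)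
      show "AE x in lebesgue. norm (g x * bump (1 / Suc n) p q x) \<le> norm (indicator (cbox p q) x *\<^sub>R g x)" for n
      proof (rule AE_I2)
        fix x
        show "norm (g x * bump (1 / Suc n) p q x) \<le> norm (indicator (cbox p q) x *\<^sub>R g x)"
        proof (cases "x \<in> cbox p q")
          case True
          then show ?thesis using norm_bump_le[of "1 / Suc n" p q x]
            by (simp add: norm_mult mult_left_le)
        next
          case False
          then have "x \<notin> box p q" using box_subset_cbox by blast
          then show ?thesis by (simp add: bump_outside)
        qed
      qed
    qed
    moreover have "(LINT x|lebesgue. g x * bump (1 / Suc n) p q x) = 0" for n
      by (intro 0 bump_test sub) auto
    ultimately have "(LINT x|lebesgue. g x * indicator (box p q) x) = 0"
      by (simp add: LIMSEQ_const_iff)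
    then show ?thesis
      by (simp add: set_lebesgue_integral_def scaleR_conv_of_real mult.commute of_real_indicator)
  qed
  have local: "AE x in lebesgue. x \<in> box p q \<longrightarrow> g x = 0" if sub: "cbox p q \<subseteq> D" for p q
  proof -
    have "set_integrable lebesgue (cbox p q) g"
      using g sub by (auto simp: locally_integrable_def)
    then have gi: "set_integrable lebesgue (box p q) g"
      by (rule set_integrable_subset) (auto simp: box_subset_cbox)
    then have "(\<lambda>x. indicator (box p q) x *\<^sub>R g x) \<in> borel_measurable lebesgue"
      unfolding set_integrable_def by (rule borel_measurable_integrable)
    then obtain h where h: "h \<in> borel_measurable borel" "AE x in lebesgue. indicator (box p q) x *\<^sub>R g x = h x"
      by (rule complex_borel_representative)
    have hl: "integrable lebesgue h"
      using gi h by (subst integrable_cong_AE[of _ _ "\<lambda>x. indicator (box p q) x *\<^sub>R g x"])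
        (auto simp: set_integrable_def measurable_completion)
    \<comment> \<open>Only integrals over intersections of boxes are needed, and these are boxes
        again.\<close>
    have hA: "(LINT x:A|lborel. h x) = (LINT x:A \<inter> box p q|lebesgue. g x)" if "A \<in> sets borel" for A
    proof -
      have "(LINT x:A|lborel. h x) = (LINT x:A|lebesgue. h x)"
        unfolding set_lebesgue_integral_def using that h(1) by (intro integral_completion[symmetric]) auto
      also have "\<dots> = (LINT x:A \<inter> box p q|lebesgue. g x)"
        unfolding set_lebesgue_integral_def
      proof (rule integral_cong_AE)
        show "AE x in lebesgue. indicat_real A x *\<^sub>R h x = indicat_real (A \<inter> box p q) x *\<^sub>R g x"
          using h(2) by eventually_elim (auto simp: indicator_def)
        show "(\<lambda>x. indicat_real A x *\<^sub>R h x) \<in> borel_measurable lebesgue"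
          using that h(1) by (auto intro!: measurable_completion)
        have "set_integrable lebesgue (A \<inter> box p q) g"
          by (rule set_integrable_subset[OF gi]) (use that in auto)
        then show "(\<lambda>x. indicat_real (A \<inter> box p q) x *\<^sub>R g x) \<in> borel_measurable lebesgue"
          unfolding set_integrable_def by (rule borel_measurable_integrable)
      qed
      finally show ?thesis .
    qed
    have "AE x in lborel. h x = 0"
    proof (rule AE_zero_if_box_integrals_zero)
      show "integrable lborel h" using hl h(1) by (simp add: integrable_completion)
      show "(LINT x:box p' q'|lborel. h x) = 0" for p' q'
      proof (cases "box p' q' \<inter> box p q = {}")
        case False
        obtain r s where rs: "box p' q' \<inter> box p q = box r s" unfolding box_Int_box by blast
        have "closure (box r s) \<subseteq> closure (box p q)"
          unfolding rs[symmetric] by (intro closure_mono) blast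
        moreover have "closure (box r s) = cbox r s" "closure (box p q) = cbox p q"
          using False rs by (intro closure_box; auto)+
        ultimately have "cbox r s \<subseteq> cbox p q" by simp
        then show ?thesis using boxes[of r s] sub by (simp add: hA rs)
      next
        case True
        then show ?thesis by (subst hA) (simp_all add: set_lebesgue_integral_def)
      qed
      show "integral\<^sup>L lborel h = 0"
        using hA[of UNIV] boxes[OF sub] by (simp add: set_lebesgue_integral_def)
    qed
    then have "AE x in lebesgue. h x = 0" by (rule AE_completion)
    with h(2) show ?thesis by eventually_elim (auto simp: indicator_def)
  qed
  obtain \<D> where \<D>: "countable \<D>" "\<D> \<subseteq> Pow D" "\<And>X. X \<in> \<D> \<Longrightarrow> \<exists>a b. X = cbox a b" "\<Union>\<D> = D"
    using open_countable_Union_open_cbox[OF D] by blast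
  have "AE x in lebesgue. x \<in> X \<longrightarrow> g x = 0" if X: "X \<in> \<D>" for X
  proof -
    obtain a b where ab: "X = cbox a b" "cbox a b \<subseteq> D" using \<D>(2) \<D>(3)[OF X] X by auto
    have "cbox a b - box a b \<in> null_sets lebesgue"
      using negligible_frontier_interval[of a b] by (simp add: negligible_iff_null_sets)
    then have "AE x in lebesgue. x \<notin> cbox a b - box a b" by (rule AE_not_in)
    with local[OF ab(2)] show ?thesis by eventually_elim (auto simp: ab)
  qed
  then have "AE x in lebesgue. \<forall>X\<in>\<D>. x \<in> X \<longrightarrow> g x = 0"
    using \<D>(1) by (intro AE_ball_countable[THEN iffD2]) auto
  then show ?thesis using \<D>(4) by (auto elim!: eventually_mono)
qed

section \<open>Weak derivatives\<close>

text \<open>Both sides of the defining identity are integrals of functions supported in \<open>D\<close>, and computing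
  with them is easier over the whole space.\<close>

lemma has_weak_pderiv_iff:
  assumes D: "open D"
  shows "has_weak_pderiv D b f g \<longleftrightarrow> locally_integrable D f \<and> locally_integrable D g \<and>
    (\<forall>\<phi>\<in>test_functions D. (LINT x|lebesgue. f x * ddir b \<phi> x) = - (LINT x|lebesgue. g x * \<phi> x))"
proof -
  have "D \<in> sets lebesgue" using D by simp
  then show ?thesis unfolding has_weak_pderiv_def by (simp add: integral_mult_test cong: ball_cong)
qed

lemma has_weak_pderivD:
  assumes "open D" "has_weak_pderiv D b f g" "\<phi> \<in> test_functions D"
  shows "(LINT x|lebesgue. f x * ddir b \<phi> x) = - (LINT x|lebesgue. g x * \<phi> x)"
  using assms by (simp add: has_weak_pderiv_iff)

lemma locally_integrable_cong_AE:
  assumes f: "locally_integrable D f" and eq: "AE x in lebesgue. x \<in> D \<longrightarrow> f x = g x"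
  shows "locally_integrable D g"
  unfolding locally_integrable_def
proof (intro allI impI)
  fix K assume K: "compact K \<and> K \<subseteq> D"
  obtain N where N: "{x \<in> space lebesgue. \<not> (x \<in> D \<longrightarrow> f x = g x)} \<subseteq> N" "emeasure lebesgue N = 0" "N \<in> sets lebesgue"
    using eq by (rule AE_E)
  show "g absolutely_integrable_on K"
  proof (rule absolutely_integrable_spike)
    show "f absolutely_integrable_on K" using f K by (auto simp: locally_integrable_def)
    show "negligible N" using N by (simp add: negligible_iff_null_sets null_sets_def)
  qed (use K N(1) in auto)
qed

lemma locally_integrable_lincomb:
  assumes "locally_integrable D f" "locally_integrable D g"
  shows "locally_integrable D (\<lambda>x. c * f x + d * g x)"
  using assms unfolding locally_integrable_def
  by (auto intro!: set_integral_add set_integrable_mult_right)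

lemma locally_integrable_mult_continuous:
  assumes "locally_integrable D f" "continuous_on UNIV h"
  shows "locally_integrable D (\<lambda>x. f x * h x)"
  using assms unfolding locally_integrable_def by (auto intro: set_integrable_mult_continuous)

lemma locally_integrable_continuous:
  assumes "continuous_on UNIV (h :: 'a::euclidean_space \<Rightarrow> complex)"
  shows "locally_integrable D h"
  unfolding locally_integrable_def
proof (intro allI impI)
  fix K :: "'a set" assume K: "compact K \<and> K \<subseteq> D"
  then have "integrable lborel (\<lambda>x. indicator K x *\<^sub>R h x)"
    using assms by (intro borel_integrable_compact) (auto intro: continuous_on_subset)
  then show "h absolutely_integrable_on K"
    by (simp add: set_integrable_def integrable_completion)
qed

lemma locally_integrable_subset: "locally_integrable D f \<Longrightarrow> E \<subseteq> D \<Longrightarrow> locally_integrable E f"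
  by (auto simp: locally_integrable_def)

lemma has_weak_pderiv_subset:
  assumes "open D" "open E" "E \<subseteq> D" "has_weak_pderiv D b f g"
  shows "has_weak_pderiv E b f g"
  using assms by (auto simp: has_weak_pderiv_iff intro: locally_integrable_subset test_functions_mono)

lemma integral_mult_test_cong_AE:
  assumes "locally_integrable D f" "locally_integrable D g" "\<phi> \<in> test_functions D"
    and eq: "AE x in lebesgue. x \<in> D \<longrightarrow> f x = g x"
  shows "(LINT x|lebesgue. f x * \<phi> x) = (LINT x|lebesgue. g x * \<phi> x)"
    "(LINT x|lebesgue. f x * ddir b \<phi> x) = (LINT x|lebesgue. g x * ddir b \<phi> x)"
proof -
  obtain K where K: "compact K" "K \<subseteq> D" "\<And>x. x \<notin> K \<Longrightarrow> \<phi> x = 0" "\<And>b x. x \<notin> K \<Longrightarrow> ddir b \<phi> x = 0"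
    using test_functions_supp[OF assms(3)] by blast
  have "AE x in lebesgue. f x * \<phi> x = g x * \<phi> x"
    using eq by eventually_elim (use K in auto)
  then show "(LINT x|lebesgue. f x * \<phi> x) = (LINT x|lebesgue. g x * \<phi> x)"
    by (intro integral_cong_AE borel_measurable_integrable integrable_mult_test[OF _ assms(3)] assms(1,2))
  have "AE x in lebesgue. f x * ddir b \<phi> x = g x * ddir b \<phi> x"
    using eq by eventually_elim (use K in auto)
  then show "(LINT x|lebesgue. f x * ddir b \<phi> x) = (LINT x|lebesgue. g x * ddir b \<phi> x)"
    by (intro integral_cong_AE borel_measurable_integrable integrable_mult_test[OF _ assms(3)] assms(1,2))
qed

lemma has_weak_pderiv_cong_AE:
  assumes D: "open D" and w: "has_weak_pderiv D b f g"
    and f: "AE x in lebesgue. x \<in> D \<longrightarrow> f x = f' x" and g: "AE x in lebesgue. x \<in> D \<longrightarrow> g x = g' x"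
  shows "has_weak_pderiv D b f' g'"
proof -
  have l: "locally_integrable D f" "locally_integrable D g" using w by (auto simp: has_weak_pderiv_def)
  have l': "locally_integrable D f'" "locally_integrable D g'"
    using l f g locally_integrable_cong_AE by blast+
  show ?thesis
    unfolding has_weak_pderiv_iff[OF D]
  proof (intro conjI l' ballI)
    fix \<phi> assume phi: "\<phi> \<in> test_functions D"
    show "(LINT x|lebesgue. f' x * ddir b \<phi> x) = - (LINT x|lebesgue. g' x * \<phi> x)"
      unfolding integral_mult_test_cong_AE(2)[OF l(1) l'(1) phi f, symmetric]
        integral_mult_test_cong_AE(1)[OF l(2) l'(2) phi g, symmetric]
      by (rule has_weak_pderivD[OF D w phi])
  qed
qed

lemma weak_pderiv_unique:
  assumes D: "open D" and w: "has_weak_pderiv D b f g" "has_weak_pderiv D b f g'"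
  shows "AE x in lebesgue. x \<in> D \<longrightarrow> g x = g' x"
proof -
  have l: "locally_integrable D g" "locally_integrable D g'" using w by (auto simp: has_weak_pderiv_def)
  have "AE x in lebesgue. x \<in> D \<longrightarrow> 1 * g x + (-1) * g' x = 0"
  proof (rule fundamental_lemma[OF D locally_integrable_lincomb[OF l]])
    fix \<phi> assume phi: "\<phi> \<in> test_functions D"
    have "(LINT x|lebesgue. (1 * g x + (-1) * g' x) * \<phi> x) = (LINT x|lebesgue. g x * \<phi> x - g' x * \<phi> x)"
      by (simp add: algebra_simps)
    also have "\<dots> = (LINT x|lebesgue. g x * \<phi> x) - (LINT x|lebesgue. g' x * \<phi> x)"
      by (intro Bochner_Integration.integral_diff integrable_mult_test[OF _ phi] l)
    also have "\<dots> = 0" using w phi by (auto simp: has_weak_pderiv_iff[OF D])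
    finally show "(LINT x|lebesgue. (1 * g x + (-1) * g' x) * \<phi> x) = 0" .
  qed
  then show ?thesis by eventually_elim auto
qed

lemma has_weak_pderiv_lincomb:
  assumes D: "open D" and w: "has_weak_pderiv D b f g" "has_weak_pderiv D b f' g'"
  shows "has_weak_pderiv D b (\<lambda>x. c * f x + d * f' x) (\<lambda>x. c * g x + d * g' x)"
proof -
  have l: "locally_integrable D g" "locally_integrable D g'" "locally_integrable D f" "locally_integrable D f'"
    using w by (auto simp: has_weak_pderiv_def)
  have lin: "(LINT x|lebesgue. (c * u x + d * u' x) * h x) = c * (LINT x|lebesgue. u x * h x) + d * (LINT x|lebesgue. u' x * h x)"
    if "integrable lebesgue (\<lambda>x. u x * h x)" "integrable lebesgue (\<lambda>x. u' x * h x)" for u u' h :: "_ \<Rightarrow> complex"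
  proof -
    have "(LINT x|lebesgue. (c * u x + d * u' x) * h x) = (LINT x|lebesgue. c * (u x * h x) + d * (u' x * h x))"
      by (simp add: algebra_simps)
    also have "\<dots> = c * (LINT x|lebesgue. u x * h x) + d * (LINT x|lebesgue. u' x * h x)"
      using that by simp
    finally show ?thesis .
  qed
  show ?thesis unfolding has_weak_pderiv_iff[OF D]
  proof (intro conjI ballI locally_integrable_lincomb l)
    fix \<phi> assume phi: "\<phi> \<in> test_functions D"
    show "(LINT x|lebesgue. (c * f x + d * f' x) * ddir b \<phi> x) = - (LINT x|lebesgue. (c * g x + d * g' x) * \<phi> x)"
      using w phi l by (simp add: lin integrable_mult_test[OF _ phi] has_weak_pderiv_iff[OF D])
  qed
qed

lemma has_weak_pderiv_cnj:
  assumes D: "open D" and w: "has_weak_pderiv D b f g"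
  shows "has_weak_pderiv D b (\<lambda>x. cnj (f x)) (\<lambda>x. cnj (g x))"
proof -
  have l: "locally_integrable D (\<lambda>x. cnj (f x))" if "locally_integrable D f" for f
    using that unfolding locally_integrable_def set_integrable_def
    by (auto simp flip: complex_cnj_scaleR)
  show ?thesis unfolding has_weak_pderiv_iff[OF D]
  proof (intro conjI ballI l)
    fix \<phi> assume phi: "\<phi> \<in> test_functions D"
    have dc: "ddir b (\<lambda>x. cnj (\<phi> x)) x = cnj (ddir b \<phi> x)" for x
      by (rule fun_cong[OF test_functions_cnj(2)[OF phi]])
    have "(LINT x|lebesgue. f x * ddir b (\<lambda>x. cnj (\<phi> x)) x) = - (LINT x|lebesgue. g x * cnj (\<phi> x))"
      by (rule has_weak_pderivD[OF D w test_functions_cnj(1)[OF phi]])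
    then have "cnj (LINT x|lebesgue. f x * cnj (ddir b \<phi> x)) = - cnj (LINT x|lebesgue. g x * cnj (\<phi> x))"
      by (simp add: dc)
    moreover have "(LINT x|lebesgue. cnj (f x) * ddir b \<phi> x) = cnj (LINT x|lebesgue. f x * cnj (ddir b \<phi> x))"
      using Bochner_Integration.integral_cnj[of lebesgue "\<lambda>x. f x * cnj (ddir b \<phi> x)"] by simp
    moreover have "(LINT x|lebesgue. cnj (g x) * \<phi> x) = cnj (LINT x|lebesgue. g x * cnj (\<phi> x))"
      using Bochner_Integration.integral_cnj[of lebesgue "\<lambda>x. g x * cnj (\<phi> x)"] by simp
    ultimately show "(LINT x|lebesgue. cnj (f x) * ddir b \<phi> x) = - (LINT x|lebesgue. cnj (g x) * \<phi> x)"
      by simp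
  qed (use w in \<open>auto simp: has_weak_pderiv_def\<close>)
qed

text \<open>Classical directional derivatives of the test functions are linear in the direction; this passes
  to weak derivatives and makes shifts along arbitrary vectors accessible.\<close>

lemma has_weak_pderiv_direction:
  fixes G :: "'a::euclidean_space \<Rightarrow> 'a \<Rightarrow> complex"
  assumes D: "open D" and w: "\<And>b. b \<in> Basis \<Longrightarrow> has_weak_pderiv D b f (G b)"
  shows "has_weak_pderiv D v f (\<lambda>x. \<Sum>b\<in>Basis. of_real (v \<bullet> b) * G b x)"
  unfolding has_weak_pderiv_iff[OF D]
proof (intro conjI ballI)
  have l: "locally_integrable D f" "\<And>b. b \<in> Basis \<Longrightarrow> locally_integrable D (G b)"
    using w SOME_Basis by (auto simp: has_weak_pderiv_def)
  show "locally_integrable D f" by fact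
  show "locally_integrable D (\<lambda>x. \<Sum>b\<in>Basis. of_real (v \<bullet> b) * G b x)"
    using l(2) unfolding locally_integrable_def set_integrable_def
    by (auto simp: scaleR_sum_right mult_scaleR_right[symmetric] simp del: mult_scaleR_right
        intro!: Bochner_Integration.integrable_sum)
  fix \<phi> assume phi: "\<phi> \<in> test_functions D"
  have "(LINT x|lebesgue. f x * ddir v \<phi> x) = (LINT x|lebesgue. (\<Sum>b\<in>Basis. of_real (v \<bullet> b) * (f x * ddir b \<phi> x)))"
    by (subst ddir_direction[OF test_functions_D(4)[OF phi]]) (simp add: sum_distrib_left mult_ac)
  also have "\<dots> = (\<Sum>b\<in>Basis. of_real (v \<bullet> b) * (LINT x|lebesgue. f x * ddir b \<phi> x))"
    using l by (subst Bochner_Integration.integral_sum) (auto intro: integrable_mult_test[OF _ phi])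
  also have "\<dots> = (\<Sum>b\<in>Basis. of_real (v \<bullet> b) * - (LINT x|lebesgue. G b x * \<phi> x))"
    using w phi by (intro sum.cong) (auto simp: has_weak_pderiv_iff[OF D])
  also have "\<dots> = - (\<Sum>b\<in>Basis. (LINT x|lebesgue. of_real (v \<bullet> b) * (G b x * \<phi> x)))"
    by (simp add: sum_negf)
  also have "(\<Sum>b\<in>Basis. (LINT x|lebesgue. of_real (v \<bullet> b) * (G b x * \<phi> x))) =
      (LINT x|lebesgue. (\<Sum>b\<in>Basis. of_real (v \<bullet> b) * (G b x * \<phi> x)))"
    using l by (subst Bochner_Integration.integral_sum) (auto intro!: integrable_mult_test[OF _ phi])
  also have "\<dots> = (LINT x|lebesgue. (\<Sum>b\<in>Basis. of_real (v \<bullet> b) * G b x) * \<phi> x)"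
    by (simp add: sum_distrib_right mult.assoc)
  finally show "(LINT x|lebesgue. f x * ddir v \<phi> x) = - (LINT x|lebesgue. (\<Sum>b\<in>Basis. of_real (v \<bullet> b) * G b x) * \<phi> x)" .
qed

section \<open>Shifts and averages along segments\<close>

lemma lborel_shift:
  fixes v :: "'a::euclidean_space"
  assumes f [measurable]: "f \<in> borel_measurable borel"
  shows "integral\<^sup>L lborel (\<lambda>x. f (x + v)) = integral\<^sup>L lborel (f :: 'a \<Rightarrow> 'b::{banach, second_countable_topology})"
    "integrable lborel (\<lambda>x. f (x + v)) \<longleftrightarrow> integrable lborel f"
proof -
  have "integral\<^sup>L lborel f = integral\<^sup>L (distr lborel borel ((+) v)) f" by (simp add: lborel_distr_plus)
  also have "\<dots> = integral\<^sup>L lborel (\<lambda>x. f (v + x))" by (rule integral_distr) auto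
  finally show "integral\<^sup>L lborel (\<lambda>x. f (x + v)) = integral\<^sup>L lborel f" by (simp add: add.commute)
  have "integrable lborel f = integrable (distr lborel borel ((+) v)) f" by (simp add: lborel_distr_plus)
  also have "\<dots> = integrable lborel (\<lambda>x. f (v + x))" by (rule integrable_distr_eq) auto
  finally show "integrable lborel (\<lambda>x. f (x + v)) \<longleftrightarrow> integrable lborel f" by (simp add: add.commute)
qed

lemma nn_integral_lborel_shift:
  fixes v :: "'a::euclidean_space"
  assumes f [measurable]: "f \<in> borel_measurable borel"
  shows "(\<integral>\<^sup>+x. f (x + v) \<partial>lborel) = integral\<^sup>N lborel f"
proof -
  have "integral\<^sup>N lborel f = integral\<^sup>N (distr lborel borel ((+) v)) f" by (simp add: lborel_distr_plus)
  also have "\<dots> = (\<integral>\<^sup>+x. f (v + x) \<partial>lborel)" by (rule nn_integral_distr) auto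
  finally show ?thesis by (simp add: add.commute)
qed

lemma AE_lborel_shift:
  fixes v :: "'a::euclidean_space"
  assumes "AE x in lborel. P x"
  shows "AE x in lborel. P (x + v)"
proof -
  have "AE x in distr lborel borel ((+) v). P x" using assms unfolding lborel_distr_plus .
  then have "AE x in lborel. P (v + x)" by (rule AE_distrD[rotated]) simp
  then show ?thesis by (simp add: add.commute)
qed

lemma AE_lborel_iff_lebesgue:
  assumes "f \<in> borel_measurable borel" "g \<in> borel_measurable borel"
  shows "(AE x in lebesgue. f x = (g x :: complex)) \<longleftrightarrow> (AE x in lborel. f x = g x)"
  using assms by (auto simp: AE_completion_iff)

lemma locally_integrable_lborel:
  fixes g :: "'a::euclidean_space \<Rightarrow> complex"
  assumes g [measurable]: "g \<in> borel_measurable borel" and l: "locally_integrable UNIV g" and K: "compact K"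
  shows "integrable lborel (\<lambda>x. indicator K x *\<^sub>R g x)"
    "(\<integral>\<^sup>+x. indicator K x * ennreal (norm (g x)) \<partial>lborel) < \<infinity>"
proof -
  have [measurable]: "K \<in> sets borel" using K by (simp add: borel_compact)
  have "integrable lebesgue (\<lambda>x. indicator K x *\<^sub>R g x)"
    using l K by (auto simp: locally_integrable_def set_integrable_def)
  then show 1: "integrable lborel (\<lambda>x. indicator K x *\<^sub>R g x)"
    by (subst (asm) integrable_completion) auto
  have "(\<integral>\<^sup>+x. indicator K x * ennreal (norm (g x)) \<partial>lborel) = (\<integral>\<^sup>+x. norm (indicator K x *\<^sub>R g x) \<partial>lborel)"
    by (intro nn_integral_cong) (auto simp: indicator_def)
  also have "\<dots> < \<infinity>" using 1 by (simp add: integrable_iff_bounded)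
  finally show "(\<integral>\<^sup>+x. indicator K x * ennreal (norm (g x)) \<partial>lborel) < \<infinity>" .
qed

lemma compact_shift_segment:
  fixes K :: "'a::euclidean_space set"
  assumes "compact K"
  shows "compact ((\<lambda>(x, t). x - t *\<^sub>R v) ` (K \<times> {0..1}))"
proof (rule compact_continuous_image)
  show "continuous_on (K \<times> {0..1}) (\<lambda>(x, t). x - t *\<^sub>R v)"
    unfolding split_beta by (intro continuous_intros)
qed (use assms in \<open>auto intro: compact_Times\<close>)

abbreviation unit_integral :: "(real \<Rightarrow> 'b::{banach, second_countable_topology}) \<Rightarrow> 'b" where
  "unit_integral f \<equiv> (LINT t|lborel. indicator {0..1::real} t *\<^sub>R f t)"

text \<open>The integrability condition behind every exchange of \<open>x\<close> and \<open>t\<close> below: by Tonelli it suffices to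
  bound the integral over \<open>x\<close> uniformly in \<open>t\<close>.\<close>

lemma integrable_pair_segment:
  fixes u g :: "'a::euclidean_space \<Rightarrow> complex"
  assumes [measurable]: "u \<in> borel_measurable borel" "g \<in> borel_measurable borel"
    and bound: "\<And>t. t \<in> {0..1::real} \<Longrightarrow> (\<integral>\<^sup>+x. ennreal (norm (u x * g (x + t *\<^sub>R v))) \<partial>lborel) \<le> C" and C: "C < \<infinity>"
  shows "integrable (lborel \<Otimes>\<^sub>M lborel) (\<lambda>(x, t). indicator {0..1::real} t *\<^sub>R (u x * g (x + t *\<^sub>R v)))"
proof (rule integrableI_bounded)
  let ?F = "\<lambda>x t. indicator {0..1::real} t *\<^sub>R (u x * g (x + t *\<^sub>R v))"
  show "(\<lambda>(x, t). ?F x t) \<in> borel_measurable (lborel \<Otimes>\<^sub>M lborel)" by measurable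
  have "(\<integral>\<^sup>+ z. ennreal (norm (case z of (x, t) \<Rightarrow> ?F x t)) \<partial>(lborel \<Otimes>\<^sub>M lborel)) =
      (\<integral>\<^sup>+ t. \<integral>\<^sup>+ x. ennreal (norm (?F x t)) \<partial>lborel \<partial>lborel)"
    by (subst lborel_pair.nn_integral_snd[symmetric]) auto
  also have "\<dots> \<le> (\<integral>\<^sup>+ t. C * indicator {0..1::real} t \<partial>lborel)"
  proof (rule nn_integral_mono)
    fix t :: real
    show "(\<integral>\<^sup>+ x. ennreal (norm (?F x t)) \<partial>lborel) \<le> C * indicator {0..1::real} t"
      using bound[of t] by (cases "t \<in> {0..1}") auto
  qed
  also have "\<dots> < \<infinity>" using C by (simp add: nn_integral_cmult_indicator)
  finally show "(\<integral>\<^sup>+ z. ennreal (norm (case z of (x, t) \<Rightarrow> ?F x t)) \<partial>(lborel \<Otimes>\<^sub>M lborel)) < \<infinity>" .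
qed

lemma Fubini_segment:
  fixes u g :: "'a::euclidean_space \<Rightarrow> complex"
  assumes int: "integrable (lborel \<Otimes>\<^sub>M lborel) (\<lambda>(x, t). indicator {0..1::real} t *\<^sub>R (u x * g (x + t *\<^sub>R v)))"
  shows "integrable lborel (\<lambda>t. indicator {0..1::real} t *\<^sub>R (LINT x|lborel. u x * g (x + t *\<^sub>R v)))"
    "integrable lborel (\<lambda>x. u x * unit_integral (\<lambda>t. g (x + t *\<^sub>R v)))"
    "(LINT x|lborel. u x * unit_integral (\<lambda>t. g (x + t *\<^sub>R v))) =
      unit_integral (\<lambda>t. LINT x|lborel. u x * g (x + t *\<^sub>R v))"
proof -
  have e: "unit_integral (\<lambda>t. u x * g (x + t *\<^sub>R v)) = u x * unit_integral (\<lambda>t. g (x + t *\<^sub>R v))" for x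
    by (simp flip: integral_mult_right_zero mult_scaleR_right)
  show "integrable lborel (\<lambda>t. indicator {0..1::real} t *\<^sub>R (LINT x|lborel. u x * g (x + t *\<^sub>R v)))"
    using lborel_pair.integrable_snd[OF int] by simp
  show "integrable lborel (\<lambda>x. u x * unit_integral (\<lambda>t. g (x + t *\<^sub>R v)))"
    using lborel_pair.integrable_fst[OF int] by (simp only: e)
  show "(LINT x|lborel. u x * unit_integral (\<lambda>t. g (x + t *\<^sub>R v))) =
      unit_integral (\<lambda>t. LINT x|lborel. u x * g (x + t *\<^sub>R v))"
    using lborel_pair.Fubini_integral[OF int] by (simp add: e)
qed

text \<open>The points \<open>x\<close> from which the segment meets the support of \<open>h\<close> form the compact set \<open>K'\<close>, on
  which \<open>F\<close> is integrable.\<close>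

lemma integrable_pair_segment_test:
  fixes F :: "'a::euclidean_space \<Rightarrow> complex"
  assumes F [measurable]: "F \<in> borel_measurable borel" and l: "locally_integrable UNIV F"
    and h: "continuous_on UNIV h" and K: "compact K" "\<And>x. x \<notin> K \<Longrightarrow> h x = 0"
  shows "integrable (lborel \<Otimes>\<^sub>M lborel) (\<lambda>(x, t). indicator {0..1::real} t *\<^sub>R (F x * h (x + t *\<^sub>R v)))"
proof -
  define K' where "K' = (\<lambda>(x, t). x - t *\<^sub>R v) ` (K \<times> {0..1::real})"
  have K': "compact K'" unfolding K'_def using K(1) by (rule compact_shift_segment)
  have [measurable]: "K' \<in> sets borel" using K' by (simp add: borel_compact)
  have [measurable]: "h \<in> borel_measurable borel" using h by (simp add: borel_measurable_continuous_onI)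
  obtain M where M: "\<And>x. norm (h x) \<le> M * indicator K x"
    using bounded_by_indicator[OF h K] by blast
  show ?thesis
  proof (rule integrable_pair_segment)
    fix t :: real assume t: "t \<in> {0..1}"
    have "norm (h (x + t *\<^sub>R v)) \<le> \<bar>M\<bar> * indicator K' x" for x
    proof (cases "x + t *\<^sub>R v \<in> K")
      case True
      then have "x \<in> K'" unfolding K'_def using t by (force intro!: image_eqI[of _ _ "(x + t *\<^sub>R v, t)"])
      then show ?thesis using M[of "x + t *\<^sub>R v"] True by simp
    qed (simp add: K(2))
    note hb = this
    have "(\<integral>\<^sup>+x. ennreal (norm (F x * h (x + t *\<^sub>R v))) \<partial>lborel) \<le>
        (\<integral>\<^sup>+x. ennreal \<bar>M\<bar> * (indicator K' x * ennreal (norm (F x))) \<partial>lborel)"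
    proof (rule nn_integral_mono)
      fix x
      show "ennreal (norm (F x * h (x + t *\<^sub>R v))) \<le> ennreal \<bar>M\<bar> * (indicator K' x * ennreal (norm (F x)))"
        using hb[of x] mult_left_mono[OF hb[of x] norm_ge_zero[of "F x"]]
        by (cases "x \<in> K'") (simp_all add: norm_mult ennreal_mult[symmetric] mult.commute)
    qed
    then show "(\<integral>\<^sup>+x. ennreal (norm (F x * h (x + t *\<^sub>R v))) \<partial>lborel) \<le>
        ennreal \<bar>M\<bar> * (\<integral>\<^sup>+x. indicator K' x * ennreal (norm (F x)) \<partial>lborel)"
      by (subst nn_integral_cmult[symmetric]) auto
  qed (use locally_integrable_lborel(2)[OF F l K'] in \<open>auto simp: ennreal_mult_less_top\<close>)
qed

text \<open>Here the unshifted factor has compact support; a shift of the integration variable reduces the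
  bound to the integral of \<open>g\<close> over the compact set swept out by the segments.\<close>

lemma integrable_pair_segment_local:
  fixes g :: "'a::euclidean_space \<Rightarrow> complex"
  assumes g [measurable]: "g \<in> borel_measurable borel" and l: "locally_integrable UNIV g"
    and u [measurable]: "u \<in> borel_measurable borel" and K: "compact K"
    and le: "\<And>x. norm (u x) \<le> M * indicator K x"
  shows "integrable (lborel \<Otimes>\<^sub>M lborel) (\<lambda>(x, t). indicator {0..1::real} t *\<^sub>R (u x * g (x + t *\<^sub>R v)))"
proof -
  define K' where "K' = (\<lambda>(x, t). x - t *\<^sub>R (- v)) ` (K \<times> {0..1::real})"
  have K': "compact K'" unfolding K'_def using K(1) by (rule compact_shift_segment)
  have [measurable]: "K' \<in> sets borel" using K' by (simp add: borel_compact)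
  let ?G = "\<lambda>x. ennreal \<bar>M\<bar> * (indicator K' x * ennreal (norm (g x)))"
  show ?thesis
  proof (rule integrable_pair_segment)
    fix t :: real assume t: "t \<in> {0..1}"
    have "(\<integral>\<^sup>+x. ennreal (norm (u x * g (x + t *\<^sub>R v))) \<partial>lborel) \<le> (\<integral>\<^sup>+x. ?G (x + t *\<^sub>R v) \<partial>lborel)"
    proof (rule nn_integral_mono)
      fix x
      show "ennreal (norm (u x * g (x + t *\<^sub>R v))) \<le> ?G (x + t *\<^sub>R v)"
      proof (cases "x \<in> K")
        case True
        then have "x + t *\<^sub>R v \<in> K'" unfolding K'_def using t by (force intro!: image_eqI[of _ _ "(x, t)"])
        moreover have "norm (u x) \<le> \<bar>M\<bar>" using le[of x] True by simp
        ultimately show ?thesis by (simp add: norm_mult ennreal_mult[symmetric] mult_right_mono)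
      next
        case False
        then have "u x = 0" using le[of x] by simp
        then show ?thesis by simp
      qed
    qed
    also have "\<dots> = (\<integral>\<^sup>+x. ?G x \<partial>lborel)" by (rule nn_integral_lborel_shift) measurable
    also have "\<dots> = ennreal \<bar>M\<bar> * (\<integral>\<^sup>+x. indicator K' x * ennreal (norm (g x)) \<partial>lborel)"
      by (rule nn_integral_cmult) measurable
    finally show "(\<integral>\<^sup>+x. ennreal (norm (u x * g (x + t *\<^sub>R v))) \<partial>lborel) \<le>
        ennreal \<bar>M\<bar> * (\<integral>\<^sup>+x. indicator K' x * ennreal (norm (g x)) \<partial>lborel)" .
  qed (use locally_integrable_lborel(2)[OF g l K'] in \<open>auto simp: ennreal_mult_less_top\<close>)
qed

lemma test_function_difference:
  fixes \<phi> :: "'a::euclidean_space \<Rightarrow> complex"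
  assumes phi: "\<phi> \<in> test_functions D"
  shows "\<phi> (x + v) - \<phi> x = unit_integral (\<lambda>t. ddir v \<phi> (x + t *\<^sub>R v))"
proof -
  have D: "((\<lambda>t. \<phi> (x + t *\<^sub>R v)) has_vector_derivative ddir v \<phi> (x + t *\<^sub>R v)) (at t within {0..1})" for t
  proof -
    have "(\<phi> has_derivative frechet_derivative \<phi> (at (x + t *\<^sub>R v))) (at (x + t *\<^sub>R v))"
      using test_functions_D(4)[OF phi] frechet_derivative_works by blast
    then have "((\<lambda>t. \<phi> (x + t *\<^sub>R v)) has_derivative (\<lambda>s. frechet_derivative \<phi> (at (x + t *\<^sub>R v)) (s *\<^sub>R v))) (at t within {0..1})"
      by (rule has_derivative_compose[rotated]) (auto intro!: derivative_eq_intros)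
    moreover have "linear (frechet_derivative \<phi> (at (x + t *\<^sub>R v)))"
      using test_functions_D(4)[OF phi] by (rule linear_frechet_derivative)
    ultimately show ?thesis by (simp add: has_vector_derivative_def linear_scale)
  qed
  have cont: "continuous_on {0..1} (\<lambda>t. ddir v \<phi> (x + t *\<^sub>R v))"
    by (rule continuous_on_compose2[OF test_functions_D(6)[OF phi]]) (auto intro!: continuous_intros)
  have "(LBINT t=ereal 0..ereal 1. ddir v \<phi> (x + t *\<^sub>R v)) = \<phi> (x + 1 *\<^sub>R v) - \<phi> (x + 0 *\<^sub>R v)"
    using cont D by (intro interval_integral_FTC_finite) auto
  then show ?thesis
    by (simp add: interval_integral_Icc set_lebesgue_integral_def)
qed

text \<open>Averaging the derivative along segments does not change its integral, by translation invariance,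
  but turns it into the integral of \<open>\<phi> (x + v) - \<phi> x\<close>, which is zero.\<close>

lemma integral_ddir_test:
  fixes \<phi> :: "'a::euclidean_space \<Rightarrow> complex"
  assumes phi: "\<phi> \<in> test_functions UNIV"
  shows "(LINT x|lborel. ddir v \<phi> x) = 0"
proof -
  obtain K where K: "compact K" "K \<subseteq> UNIV" "\<And>x. x \<notin> K \<Longrightarrow> \<phi> x = 0" "\<And>b x. x \<notin> K \<Longrightarrow> ddir b \<phi> x = 0"
    using test_functions_supp[OF phi] by blast
  have [measurable]: "\<phi> \<in> borel_measurable borel" "ddir v \<phi> \<in> borel_measurable borel"
    using test_functions_D[OF phi] by (auto intro: borel_measurable_continuous_onI)
  have 1: "locally_integrable UNIV (\<lambda>x::'a. 1)"
    by (rule locally_integrable_continuous) auto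
  have i: "integrable lborel \<phi>"
    using integrable_mult_supported[OF 1 K(1,2), of \<phi>] K(3) test_functions_D(5)[OF phi]
    by (simp add: integrable_completion)
  have "(LINT x|lborel. ddir v \<phi> x) = unit_integral (\<lambda>t. LINT x|lborel. ddir v \<phi> x)"
    by simp
  also have "\<dots> = unit_integral (\<lambda>t. LINT x|lborel. 1 * ddir v \<phi> (x + t *\<^sub>R v))"
    by (subst lborel_shift) auto
  also have "\<dots> = (LINT x|lborel. 1 * unit_integral (\<lambda>t. ddir v \<phi> (x + t *\<^sub>R v)))"
    by (rule Fubini_segment(3)[OF integrable_pair_segment_test, symmetric]) (use K 1 test_functions_D[OF phi] in auto)
  also have "\<dots> = (LINT x|lborel. \<phi> (x + v) - \<phi> x)"
    by (simp add: test_function_difference[OF phi])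
  also have "\<dots> = 0" using i by (simp add: lborel_shift)
  finally show ?thesis .
qed

section \<open>Smooth factors and the difference formula for weak derivatives\<close>

text \<open>The product rule needs no approximation when one factor is smooth: \<open>\<eta> \<phi>\<close> is again a test
  function.\<close>

lemma has_weak_pderiv_mult_smooth:
  assumes D: "open D" and w: "has_weak_pderiv D b f g" and chi: "\<And>m. times_continuously_differentiable m \<eta>"
  shows "has_weak_pderiv D b (\<lambda>x. \<eta> x * f x) (\<lambda>x. \<eta> x * g x + ddir b \<eta> x * f x)"
  unfolding has_weak_pderiv_iff[OF D]
proof (intro conjI ballI)
  have l: "locally_integrable D f" "locally_integrable D g" using w by (auto simp: has_weak_pderiv_def)
  have c: "continuous_on UNIV \<eta>" "continuous_on UNIV (ddir b \<eta>)" "\<And>x. \<eta> differentiable at x"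
    using chi[of 0] chi[of 1] continuous_ddir[of \<eta>] by auto
  have lc: "locally_integrable D (\<lambda>x. \<eta> x * f x)" "locally_integrable D (\<lambda>x. \<eta> x * g x)"
     "locally_integrable D (\<lambda>x. ddir b \<eta> x * f x)"
    using locally_integrable_mult_continuous[OF l(1) c(1)] locally_integrable_mult_continuous[OF l(2) c(1)]
      locally_integrable_mult_continuous[OF l(1) c(2)] by (simp_all add: mult.commute)
  show "locally_integrable D (\<lambda>x. \<eta> x * f x)" by fact
  show "locally_integrable D (\<lambda>x. \<eta> x * g x + ddir b \<eta> x * f x)"
    using locally_integrable_lincomb[OF lc(2,3), of 1 1] by simp
  fix \<phi> assume phi: "\<phi> \<in> test_functions D"
  have d: "ddir b (\<lambda>x. \<eta> x * \<phi> x) x = \<eta> x * ddir b \<phi> x + ddir b \<eta> x * \<phi> x" for x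
    by (rule fun_cong[OF ddir_mult]) (use c test_functions_D(4)[OF phi] in auto)
  note phi' = test_functions_mult[OF phi chi]
  have "(LINT x|lebesgue. \<eta> x * f x * ddir b \<phi> x) =
     (LINT x|lebesgue. f x * ddir b (\<lambda>x. \<eta> x * \<phi> x) x - (ddir b \<eta> x * f x) * \<phi> x)"
    by (simp add: d algebra_simps)
  also have "\<dots> = (LINT x|lebesgue. f x * ddir b (\<lambda>x. \<eta> x * \<phi> x) x) - (LINT x|lebesgue. (ddir b \<eta> x * f x) * \<phi> x)"
    by (intro Bochner_Integration.integral_diff integrable_mult_test(2)[OF l(1) phi'] integrable_mult_test(1)[OF lc(3) phi])
  also have "\<dots> = - (LINT x|lebesgue. g x * (\<eta> x * \<phi> x)) - (LINT x|lebesgue. (ddir b \<eta> x * f x) * \<phi> x)"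
    by (simp add: has_weak_pderivD[OF D w phi'])
  also have "\<dots> = - ((LINT x|lebesgue. (\<eta> x * g x) * \<phi> x) + (LINT x|lebesgue. (ddir b \<eta> x * f x) * \<phi> x))"
    by (simp add: mult_ac)
  also have "\<dots> = - (LINT x|lebesgue. (\<eta> x * g x) * \<phi> x + (ddir b \<eta> x * f x) * \<phi> x)"
    using Bochner_Integration.integral_add[OF integrable_mult_test(1)[OF lc(2) phi] integrable_mult_test(1)[OF lc(3) phi]]
    by simp
  finally show "(LINT x|lebesgue. \<eta> x * f x * ddir b \<phi> x) = - (LINT x|lebesgue. (\<eta> x * g x + ddir b \<eta> x * f x) * \<phi> x)"
    by (simp add: algebra_simps)
qed

text \<open>The constant function \<open>1\<close> has weak derivative \<open>0\<close> because derivatives of test functions integrate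
  to zero; the product rule does the rest.\<close>

lemma has_weak_pderiv_smooth:
  assumes D: "open D" and f: "\<And>m. times_continuously_differentiable m f"
  shows "has_weak_pderiv D b f (ddir b f)"
proof -
  have "has_weak_pderiv D b (\<lambda>x. 1) (\<lambda>x. 0)"
    unfolding has_weak_pderiv_iff[OF D]
  proof (intro conjI ballI locally_integrable_continuous)
    fix \<phi> assume "\<phi> \<in> test_functions D"
    then have phi: "\<phi> \<in> test_functions UNIV" by (rule test_functions_mono[rotated]) simp
    have "ddir b \<phi> \<in> borel_measurable borel"
      using test_functions_D(6)[OF phi] by (rule borel_measurable_continuous_onI)
    then have "(LINT x|lebesgue. ddir b \<phi> x) = 0"
      using integral_ddir_test[OF phi] by (simp add: integral_completion)
    then show "(LINT x|lebesgue. 1 * ddir b \<phi> x) = - (LINT x|lebesgue. 0 * \<phi> x)" by simp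
  qed auto
  from has_weak_pderiv_mult_smooth[OF D this f] show ?thesis by simp
qed

text \<open>Truncation to balls makes Fubini applicable; countably many balls suffice.\<close>

lemma AE_integrable_segment:
  fixes g :: "'a::euclidean_space \<Rightarrow> complex"
  assumes g [measurable]: "g \<in> borel_measurable borel" and l: "locally_integrable UNIV g"
  shows "AE x in lborel. integrable lborel (\<lambda>t. indicator {0..1::real} t *\<^sub>R g (x + t *\<^sub>R v))"
proof -
  have "AE x in lborel. x \<in> cball 0 (real n) \<longrightarrow> integrable lborel (\<lambda>t. indicator {0..1::real} t *\<^sub>R g (x + t *\<^sub>R v))" for n
  proof -
    have "integrable (lborel \<Otimes>\<^sub>M lborel) (\<lambda>(x, t). indicator {0..1::real} t *\<^sub>R (indicator (cball 0 (real n)) x * g (x + t *\<^sub>R v)))"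
      by (rule integrable_pair_segment_local[where K="cball 0 (real n)" and M=1, OF g l]) (auto simp: indicator_def)
    then have "AE x in lborel. integrable lborel (\<lambda>t. indicator {0..1::real} t *\<^sub>R (indicator (cball 0 (real n)) x * g (x + t *\<^sub>R v)))"
      by (drule_tac lborel_pair.AE_integrable_fst) simp
    then show ?thesis by eventually_elim (auto simp: indicator_def)
  qed
  then have "AE x in lborel. \<forall>n. x \<in> cball 0 (real n) \<longrightarrow> integrable lborel (\<lambda>t. indicator {0..1::real} t *\<^sub>R g (x + t *\<^sub>R v))"
    by (intro AE_all_countable[THEN iffD2] allI)
  then show ?thesis
    by eventually_elim (meson mem_cball_0 real_arch_simple)
qed

lemma locally_integrable_segment_average:
  fixes g :: "'a::euclidean_space \<Rightarrow> complex"
  assumes g [measurable]: "g \<in> borel_measurable borel" and l: "locally_integrable UNIV g"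
  shows "locally_integrable UNIV (\<lambda>x. LINT t|lborel. indicator {0..1::real} t *\<^sub>R g (x + t *\<^sub>R v))"
  unfolding locally_integrable_def
proof (intro allI impI)
  fix K :: "'a set" assume "compact K \<and> K \<subseteq> UNIV"
  then have K: "compact K" by simp
  then have [measurable]: "K \<in> sets borel" by (simp add: borel_compact)
  have "integrable (lborel \<Otimes>\<^sub>M lborel) (\<lambda>(x, t). indicator {0..1::real} t *\<^sub>R (indicator K x * g (x + t *\<^sub>R v)))"
    by (rule integrable_pair_segment_local[where K=K and M=1, OF g l]) (auto simp: indicator_def K)
  then have "integrable lborel (\<lambda>x. LINT t|lborel. indicator {0..1::real} t *\<^sub>R (indicator K x * g (x + t *\<^sub>R v)))"
    by (drule_tac lborel_pair.integrable_fst) simp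
  also have "(\<lambda>x. LINT t|lborel. indicator {0..1::real} t *\<^sub>R (indicator K x * g (x + t *\<^sub>R v))) =
     (\<lambda>x. indicator K x *\<^sub>R unit_integral (\<lambda>t. g (x + t *\<^sub>R v)))"
    by (auto simp: indicator_def)
  finally show "(\<lambda>x. LINT t|lborel. indicator {0..1::real} t *\<^sub>R g (x + t *\<^sub>R v)) absolutely_integrable_on K"
    unfolding set_integrable_def by (subst integrable_completion) auto
qed

lemma locally_integrable_shift:
  fixes f :: "'a::euclidean_space \<Rightarrow> complex"
  assumes f [measurable]: "f \<in> borel_measurable borel" and l: "locally_integrable UNIV f"
  shows "locally_integrable UNIV (\<lambda>x. f (x + v))"
  unfolding locally_integrable_def
proof (intro allI impI)
  fix K :: "'a set" assume "compact K \<and> K \<subseteq> UNIV"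
  then have K: "compact K" by simp
  then have [measurable]: "K \<in> sets borel" by (simp add: borel_compact)
  have K': "compact ((\<lambda>x. x + v) ` K)"
    using K by (intro compact_continuous_image continuous_intros)
  then have [measurable]: "(\<lambda>x. x + v) ` K \<in> sets borel" by (simp add: borel_compact)
  have "integrable lborel (\<lambda>x. indicator ((\<lambda>x. x + v) ` K) x *\<^sub>R f x)"
    by (rule locally_integrable_lborel[OF f l K'])
  then have "integrable lborel (\<lambda>x. indicator ((\<lambda>x. x + v) ` K) (x + v) *\<^sub>R f (x + v))"
    by (subst lborel_shift(2)[where f="\<lambda>x. indicator ((\<lambda>x. x + v) ` K) x *\<^sub>R f x"]) auto
  also have "(\<lambda>x. indicator ((\<lambda>x. x + v) ` K) (x + v) *\<^sub>R f (x + v)) = (\<lambda>x. indicator K x *\<^sub>R f (x + v))"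
    by (intro ext) (auto simp: indicator_def image_iff)
  finally show "(\<lambda>x. f (x + v)) absolutely_integrable_on K"
    unfolding set_integrable_def by (subst integrable_completion) auto
qed

lemma has_weak_pderiv_lborelD:
  fixes f g :: "'a::euclidean_space \<Rightarrow> complex"
  assumes f: "f \<in> borel_measurable borel" and g: "g \<in> borel_measurable borel"
    and w: "has_weak_pderiv UNIV v f g" and phi: "\<phi> \<in> test_functions UNIV"
  shows "(LINT x|lborel. f x * ddir v \<phi> x) = - (LINT x|lborel. g x * \<phi> x)"
proof -
  have [measurable]: "\<phi> \<in> borel_measurable borel" "ddir v \<phi> \<in> borel_measurable borel"
    using test_functions_D[OF phi] by (auto intro: borel_measurable_continuous_onI)
  show ?thesis using has_weak_pderivD[OF open_UNIV w phi] f g by (simp add: integral_completion)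
qed

text \<open>The fundamental theorem of calculus for weak derivatives. Against a test function \<open>\<phi>\<close>, the shift
  is moved onto \<open>\<phi>\<close>, where the classical theorem applies; the definition of the weak derivative and
  a shift back produce the average of \<open>g\<close>. The fundamental lemma removes \<open>\<phi>\<close>.\<close>

lemma weak_pderiv_difference:
  fixes f g :: "'a::euclidean_space \<Rightarrow> complex"
  assumes f [measurable]: "f \<in> borel_measurable borel" and g [measurable]: "g \<in> borel_measurable borel"
    and w: "has_weak_pderiv UNIV v f g"
  shows "AE x in lborel. f (x + v) - f x = unit_integral (\<lambda>t. g (x + t *\<^sub>R v))"
proof -
  define J where "J x = unit_integral (\<lambda>t. g (x + t *\<^sub>R v))" for x
  have J [measurable]: "J \<in> borel_measurable borel" unfolding J_def[abs_def] by measurable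
  have l: "locally_integrable UNIV f" "locally_integrable UNIV g" using w by (auto simp: has_weak_pderiv_def)
  have lJ: "locally_integrable UNIV J" unfolding J_def[abs_def] by (rule locally_integrable_segment_average[OF g l(2)])
  have lf: "locally_integrable UNIV (\<lambda>x. f (x + v))" by (rule locally_integrable_shift[OF f l(1)])
  have lfd: "locally_integrable UNIV (\<lambda>x. f (x + v) - f x)"
    using locally_integrable_lincomb[OF lf l(1), of 1 "-1"] by simp
  have ll: "locally_integrable UNIV (\<lambda>x. (f (x + v) - f x) - J x)"
    using locally_integrable_lincomb[OF lfd lJ, of 1 "-1"] by simp
  have "AE x in lebesgue. x \<in> UNIV \<longrightarrow> (f (x + v) - f x) - J x = 0"
  proof (rule fundamental_lemma[OF open_UNIV ll])
    fix \<phi> :: "'a \<Rightarrow> complex" assume phi: "\<phi> \<in> test_functions UNIV"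
    obtain K where K: "compact K" "K \<subseteq> UNIV" "\<And>x. x \<notin> K \<Longrightarrow> \<phi> x = 0" "\<And>b x. x \<notin> K \<Longrightarrow> ddir b \<phi> x = 0"
      using test_functions_supp[OF phi] by blast
    have cont: "continuous_on UNIV \<phi>" "continuous_on UNIV (ddir u \<phi>)" for u
      using test_functions_D[OF phi] by auto
    have [measurable]: "\<phi> \<in> borel_measurable borel" "ddir u \<phi> \<in> borel_measurable borel" for u
      using cont by (auto intro: borel_measurable_continuous_onI)
    have phis: "(\<lambda>x. \<phi> (x + u)) \<in> test_functions UNIV" for u by (rule test_functions_shift[OF phi])
    have int: "integrable lborel (\<lambda>x. F x * \<psi> x)"
      if "F \<in> borel_measurable borel" "locally_integrable UNIV F" "\<psi> \<in> test_functions UNIV" for F \<psi>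
    proof -
      have "\<psi> \<in> borel_measurable borel" using test_functions_D(5)[OF that(3)] by (rule borel_measurable_continuous_onI)
      then show ?thesis using integrable_mult_test(1)[OF that(2,3)] that(1) by (simp add: integrable_completion)
    qed
    have ddir_eq: "ddir (- v) \<phi> (x + u) = - ddir v (\<lambda>x. \<phi> (x + u)) x" for x u
    proof -
      have "ddir v (\<lambda>x. \<phi> (x + u)) x = ddir v \<phi> (x + u)"
        by (rule fun_cong[OF ddir_shift]) (rule test_functions_D(4)[OF phi])
      then show ?thesis using ddir_direction(2)[OF test_functions_D(4)[OF phi], of "x + u" v] by simp
    qed
    have "(LINT x|lborel. (f (x + v) - f x) * \<phi> x) = (LINT x|lborel. f (x + v) * \<phi> x) - (LINT x|lborel. f x * \<phi> x)"
      unfolding left_diff_distrib by (intro Bochner_Integration.integral_diff int lf l phi) auto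
    also have "(LINT x|lborel. f (x + v) * \<phi> x) = (LINT x|lborel. f x * \<phi> (x + - v))"
      using lborel_shift(1)[where f="\<lambda>x. f x * \<phi> (x + - v)" and v=v] by simp
    also have "\<dots> - (LINT x|lborel. f x * \<phi> x) = (LINT x|lborel. f x * \<phi> (x + - v) - f x * \<phi> x)"
      by (intro Bochner_Integration.integral_diff[symmetric] int l phi phis) auto
    also have "\<dots> = (LINT x|lborel. f x * unit_integral (\<lambda>t. ddir (- v) \<phi> (x + t *\<^sub>R (- v))))"
      unfolding right_diff_distrib[symmetric] test_function_difference[OF phi] ..
    also have "\<dots> = unit_integral (\<lambda>t. LINT x|lborel. f x * ddir (- v) \<phi> (x + t *\<^sub>R (- v)))"
      by (rule Fubini_segment(3)[OF integrable_pair_segment_test[OF f l(1) cont(2) K(1) K(4)]])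
    also have "\<dots> = unit_integral (\<lambda>t. LINT x|lborel. g x * \<phi> (x + t *\<^sub>R (- v)))"
    proof -
      have "(LINT x|lborel. f x * ddir (- v) \<phi> (x + u)) = (LINT x|lborel. g x * \<phi> (x + u))" for u
        using has_weak_pderiv_lborelD[OF f g w phis[of u]] by (simp add: ddir_eq)
      then show ?thesis by (simp only:)
    qed
    also have "\<dots> = unit_integral (\<lambda>t. LINT x|lborel. g (x + t *\<^sub>R v) * \<phi> x)"
    proof -
      have "(LINT x|lborel. g x * \<phi> (x + t *\<^sub>R (- v))) = (LINT x|lborel. g (x + t *\<^sub>R v) * \<phi> x)" for t
        using lborel_shift(1)[where f="\<lambda>x. g x * \<phi> (x + t *\<^sub>R (- v))" and v="t *\<^sub>R v"] by simp
      then show ?thesis by simp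
    qed
    also have "\<dots> = unit_integral (\<lambda>t. LINT x|lborel. \<phi> x * g (x + t *\<^sub>R v))"
      by (simp add: mult.commute)
    also have "\<dots> = (LINT x|lborel. \<phi> x * J x)"
    proof -
      obtain M where M: "\<And>x. norm (\<phi> x) \<le> M * indicator K x"
        using bounded_by_indicator[OF cont(1) K(1,3)] by blast
      show ?thesis unfolding J_def
        by (rule Fubini_segment(3)[OF integrable_pair_segment_local[OF g l(2) _ K(1) M], symmetric]) measurable
    qed
    also have "\<dots> = (LINT x|lborel. J x * \<phi> x)" by (simp add: mult.commute)
    finally have *: "(LINT x|lborel. (f (x + v) - f x) * \<phi> x) = (LINT x|lborel. J x * \<phi> x)" .
    have "(LINT x|lebesgue. (f (x + v) - f x - J x) * \<phi> x) = (LINT x|lborel. (f (x + v) - f x - J x) * \<phi> x)"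
      by (rule integral_completion) measurable
    also have "\<dots> = (LINT x|lborel. (f (x + v) - f x) * \<phi> x) - (LINT x|lborel. J x * \<phi> x)"
      unfolding left_diff_distrib[of "f (_ + v) - f _" "J _"]
      by (intro Bochner_Integration.integral_diff int lfd lJ phi) auto
    finally show "(LINT x|lebesgue. (f (x + v) - f x - J x) * \<phi> x) = 0" using * by simp
  qed
  then have "AE x in lebesgue. f (x + v) - f x = J x" by eventually_elim simp
  then show ?thesis unfolding J_def[symmetric] by (subst (asm) AE_lborel_iff_lebesgue) auto
qed

section \<open>The fourth power of an H1 function is integrable in dimension at most three\<close>

lemma ennreal_le_if_power2_le:
  assumes "x\<^sup>2 \<le> ennreal (c\<^sup>2)" "0 \<le> c" shows "x \<le> ennreal c"
proof (cases x)
  case (real r)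
  then have "r\<^sup>2 \<le> c\<^sup>2" using assms by (simp add: ennreal_power)
  then show ?thesis using real assms(2) power2_le_imp_le by (auto intro!: ennreal_leI)
next
  case top
  then show ?thesis using assms(1) by (simp add: ennreal_top_eq_mult_iff power2_eq_square top_unique)
qed

text \<open>Jensen's inequality applied to the difference formula.\<close>

lemma weak_pderiv_difference_square:
  fixes f g :: "'a::euclidean_space \<Rightarrow> complex"
  assumes f [measurable]: "f \<in> borel_measurable borel" and g [measurable]: "g \<in> borel_measurable borel"
    and w: "has_weak_pderiv UNIV v f g"
  shows "AE x in lborel. ennreal ((norm (f (x + v) - f x))\<^sup>2) \<le>
    (\<integral>\<^sup>+t. indicator {0..1::real} t * ennreal ((norm (g (x + t *\<^sub>R v)))\<^sup>2) \<partial>lborel)"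
proof -
  have l: "locally_integrable UNIV g" using w by (auto simp: has_weak_pderiv_def)
  from weak_pderiv_difference[OF f g w] AE_integrable_segment[OF g l, of v]
  show ?thesis
  proof eventually_elim
    case (elim x)
    have "ennreal (norm (f (x + v) - f x)) \<le> (\<integral>\<^sup>+t. norm (indicator {0..1::real} t *\<^sub>R g (x + t *\<^sub>R v)) \<partial>lborel)"
      unfolding elim(1) by (rule integral_norm_bound_ennreal[OF elim(2)])
    also have "\<dots> = (\<integral>\<^sup>+t. indicator {0..1::real} t * (indicator {0..1} t * ennreal (norm (g (x + t *\<^sub>R v)))) \<partial>lborel)"
      by (intro nn_integral_cong) (auto simp: indicator_def)
    finally have "(ennreal (norm (f (x + v) - f x)))\<^sup>2 \<le>
        (\<integral>\<^sup>+t. indicator {0..1::real} t * (indicator {0..1} t * ennreal (norm (g (x + t *\<^sub>R v)))) \<partial>lborel)\<^sup>2"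
      by (rule power_mono) simp
    also have "\<dots> \<le> (\<integral>\<^sup>+t. (indicator {0..1::real} t)\<^sup>2 \<partial>lborel) *
       (\<integral>\<^sup>+t. (indicator {0..1::real} t * ennreal (norm (g (x + t *\<^sub>R v))))\<^sup>2 \<partial>lborel)"
      by (rule Cauchy_Schwarz_nn_integral) measurable
    also have "(\<integral>\<^sup>+t. (indicator {0..1::real} t)\<^sup>2 \<partial>lborel) = (\<integral>\<^sup>+t. (indicator {0..1::real} t :: ennreal) \<partial>lborel)"
      by (intro nn_integral_cong) (auto simp: indicator_def)
    also have "\<dots> = 1" by simp
    also have "(\<integral>\<^sup>+t. (indicator {0..1::real} t * ennreal (norm (g (x + t *\<^sub>R v))))\<^sup>2 \<partial>lborel) =
       (\<integral>\<^sup>+t. indicator {0..1::real} t * ennreal ((norm (g (x + t *\<^sub>R v)))\<^sup>2) \<partial>lborel)"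
      by (intro nn_integral_cong) (auto simp: indicator_def ennreal_power)
    finally show ?case by (simp add: ennreal_power)
  qed
qed

lemma nn_integral_lborel_affine:
  fixes w :: "'a::euclidean_space \<Rightarrow> ennreal"
  assumes w [measurable]: "w \<in> borel_measurable borel" and h: "h > 0"
  shows "(\<integral>\<^sup>+y. w (x + h *\<^sub>R y) \<partial>lborel) = ennreal (1 / h ^ DIM('a)) * (\<integral>\<^sup>+y. w y \<partial>lborel)"
proof -
  have "(\<integral>\<^sup>+y. w y \<partial>lborel) = (\<integral>\<^sup>+y. w y \<partial>density (distr lborel borel (\<lambda>y. x + h *\<^sub>R y)) (\<lambda>_. \<bar>h\<bar> ^ DIM('a)))"
    using h by (subst lborel_affine[of h x]) auto
  also have "\<dots> = ennreal (h ^ DIM('a)) * (\<integral>\<^sup>+y. w (x + h *\<^sub>R y) \<partial>lborel)"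
    using h by (simp add: nn_integral_density nn_integral_distr nn_integral_cmult)
  finally show ?thesis using h
    by (simp add: mult.assoc[symmetric] ennreal_mult[symmetric])
qed

definition cube_average :: "real \<Rightarrow> ('a::euclidean_space \<Rightarrow> ennreal) \<Rightarrow> 'a \<Rightarrow> ennreal" where
  "cube_average h w x = (\<integral>\<^sup>+y. indicator (cbox 0 One) y * w (x + h *\<^sub>R y) \<partial>lborel)"

lemma nn_integral_unit_cube: "(\<integral>\<^sup>+y. indicator (cbox 0 (One::'a::euclidean_space)) y \<partial>lborel) = 1"
  by (simp add: emeasure_lborel_cbox_eq)

lemma Jensen_unit_cube:
  assumes w [measurable]: "w \<in> borel_measurable borel"
  shows "(\<integral>\<^sup>+y. indicator (cbox 0 (One::'a::euclidean_space)) y * w y \<partial>lborel)\<^sup>2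
    \<le> (\<integral>\<^sup>+y. indicator (cbox 0 (One::'a::euclidean_space)) y * (w y)\<^sup>2 \<partial>lborel)"
proof -
  let ?Q = "cbox 0 (One::'a)"
  have "(\<integral>\<^sup>+y. indicator ?Q y * w y \<partial>lborel)\<^sup>2 = (\<integral>\<^sup>+y. indicator ?Q y * (indicator ?Q y * w y) \<partial>lborel)\<^sup>2"
    by (intro arg_cong[where f="\<lambda>x. x\<^sup>2"] nn_integral_cong) (auto simp: indicator_def)
  also have "\<dots> \<le> (\<integral>\<^sup>+y. (indicator ?Q y)\<^sup>2 \<partial>lborel) * (\<integral>\<^sup>+y. (indicator ?Q y * w y)\<^sup>2 \<partial>lborel)"
    by (rule Cauchy_Schwarz_nn_integral) measurable
  also have "(\<integral>\<^sup>+y. (indicator ?Q y)\<^sup>2 \<partial>lborel) = (\<integral>\<^sup>+y. (indicator ?Q y :: ennreal) \<partial>lborel)"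
    by (intro nn_integral_cong) (auto simp: indicator_def)
  also have "\<dots> = 1" by (rule nn_integral_unit_cube)
  also have "(\<integral>\<^sup>+y. (indicator ?Q y * w y)\<^sup>2 \<partial>lborel) = (\<integral>\<^sup>+y. indicator ?Q y * (w y)\<^sup>2 \<partial>lborel)"
    by (intro nn_integral_cong) (auto simp: indicator_def)
  finally show ?thesis by simp
qed

text \<open>Jensen's inequality, after which enlarging the cube to the whole space costs the factor by which
  the cube is smaller than the unit cube.\<close>

lemma cube_average_square_le:
  fixes w :: "'a::euclidean_space \<Rightarrow> ennreal"
  assumes w [measurable]: "w \<in> borel_measurable borel" and h: "h > 0"
  shows "(cube_average h w x)\<^sup>2 \<le> ennreal (1 / h ^ DIM('a)) * (\<integral>\<^sup>+y. (w y)\<^sup>2 \<partial>lborel)"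
proof -
  have "(cube_average h w x)\<^sup>2 \<le> (\<integral>\<^sup>+y. indicator (cbox 0 One) y * (w (x + h *\<^sub>R y))\<^sup>2 \<partial>lborel)"
    unfolding cube_average_def by (rule Jensen_unit_cube) measurable
  also have "\<dots> \<le> (\<integral>\<^sup>+y. (w (x + h *\<^sub>R y))\<^sup>2 \<partial>lborel)"
    by (intro nn_integral_mono) (auto simp: indicator_def)
  also have "\<dots> = ennreal (1 / h ^ DIM('a)) * (\<integral>\<^sup>+y. (w y)\<^sup>2 \<partial>lborel)"
    by (rule nn_integral_lborel_affine) (use h in measurable)
  finally show ?thesis .
qed

definition cube_oscillation :: "real \<Rightarrow> ('a::euclidean_space \<Rightarrow> real) \<Rightarrow> 'a \<Rightarrow> ennreal" where
  "cube_oscillation s u x = (\<integral>\<^sup>+y. indicator (cbox 0 One) y * ennreal \<bar>u x - u (x + s *\<^sub>R y)\<bar> \<partial>lborel)"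

lemma borel_measurable_cube_oscillation [measurable]:
  assumes [measurable]: "u \<in> borel_measurable borel"
  shows "cube_oscillation s u \<in> borel_measurable borel"
  unfolding cube_oscillation_def[abs_def] by measurable

lemma le_average_plus_oscillation:
  fixes u :: "'a::euclidean_space \<Rightarrow> real"
  assumes u [measurable]: "u \<in> borel_measurable borel" and pos: "\<And>x. 0 \<le> u x"
  shows "ennreal (u x) \<le> cube_average s (\<lambda>x. ennreal (u x)) x + cube_oscillation s u x"
proof -
  have "ennreal (u x) = (\<integral>\<^sup>+y. ennreal (u x) * indicator (cbox 0 (One::'a)) y \<partial>lborel)"
    by (simp add: nn_integral_cmult_indicator emeasure_lborel_cbox_eq)
  also have "\<dots> \<le> (\<integral>\<^sup>+y. indicator (cbox 0 One) y * ennreal (u (x + s *\<^sub>R y)) +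
      indicator (cbox 0 One) y * ennreal \<bar>u x - u (x + s *\<^sub>R y)\<bar> \<partial>lborel)"
    by (intro nn_integral_mono) (auto simp: indicator_def pos ennreal_plus[symmetric] simp del: ennreal_plus intro!: ennreal_leI)
  also have "\<dots> = cube_average s (\<lambda>x. ennreal (u x)) x + cube_oscillation s u x"
    unfolding cube_average_def cube_oscillation_def by (rule nn_integral_add) measurable
  finally show ?thesis .
qed

lemma norm_power2_Basis: "(norm (y::'a::euclidean_space))\<^sup>2 = (\<Sum>b\<in>Basis. (y \<bullet> b)\<^sup>2)"
proof -
  have "(norm y)\<^sup>2 = y \<bullet> y" by (rule power2_norm_eq_inner)
  also have "\<dots> = (\<Sum>b\<in>Basis. (y \<bullet> b) * (y \<bullet> b))" by (rule euclidean_inner)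
  finally show ?thesis by (simp add: power2_eq_square)
qed

lemma norm_unit_cube_le: "y \<in> cbox 0 (One::'a::euclidean_space) \<Longrightarrow> (norm y)\<^sup>2 \<le> DIM('a)"
proof -
  assume y: "y \<in> cbox 0 One"
  have "(norm y)\<^sup>2 = (\<Sum>b\<in>Basis. (y \<bullet> b)\<^sup>2)"
    by (rule norm_power2_Basis)
  also have "\<dots> \<le> (\<Sum>b\<in>(Basis::'a set). 1)"
    using y by (intro sum_mono) (auto simp: mem_box power_le_one)
  finally show "(norm y)\<^sup>2 \<le> DIM('a)" by simp
qed

text \<open>Each point of the cube contributes a shift by at most \<open>s\<close> times its diagonal.\<close>

lemma cube_oscillation_L2:
  fixes u :: "'a::euclidean_space \<Rightarrow> real"
  assumes u [measurable]: "u \<in> borel_measurable borel"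
    and shift: "\<And>v. (\<integral>\<^sup>+x. ennreal ((u (x + v) - u x)\<^sup>2) \<partial>lborel) \<le> ennreal (A * (norm v)\<^sup>2)" and A: "0 \<le> A"
  shows "(\<integral>\<^sup>+x. (cube_oscillation s u x)\<^sup>2 \<partial>lborel) \<le> ennreal (A * DIM('a) * s\<^sup>2)"
proof -
  let ?Q = "cbox 0 (One::'a)"
  have "(\<integral>\<^sup>+x. (cube_oscillation s u x)\<^sup>2 \<partial>lborel) \<le>
     (\<integral>\<^sup>+x. \<integral>\<^sup>+y. indicator ?Q y * (ennreal \<bar>u x - u (x + s *\<^sub>R y)\<bar>)\<^sup>2 \<partial>lborel \<partial>lborel)"
    unfolding cube_oscillation_def by (intro nn_integral_mono Jensen_unit_cube) measurable
  also have "\<dots> = (\<integral>\<^sup>+y. \<integral>\<^sup>+x. indicator ?Q y * (ennreal \<bar>u x - u (x + s *\<^sub>R y)\<bar>)\<^sup>2 \<partial>lborel \<partial>lborel)"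
    by (rule lborel_pair.Fubini') measurable
  also have "\<dots> = (\<integral>\<^sup>+y. indicator ?Q y * (\<integral>\<^sup>+x. ennreal ((u (x + s *\<^sub>R y) - u x)\<^sup>2) \<partial>lborel) \<partial>lborel)"
    by (subst nn_integral_cmult) (auto simp: ennreal_power power2_commute)
  also have "\<dots> \<le> (\<integral>\<^sup>+y. ennreal (A * DIM('a) * s\<^sup>2) * indicator ?Q y \<partial>lborel)"
  proof (rule nn_integral_mono)
    fix y :: 'a
    show "indicator ?Q y * (\<integral>\<^sup>+x. ennreal ((u (x + s *\<^sub>R y) - u x)\<^sup>2) \<partial>lborel) \<le> ennreal (A * DIM('a) * s\<^sup>2) * indicator ?Q y"
    proof (cases "y \<in> ?Q")
      case True
      have "(\<integral>\<^sup>+x. ennreal ((u (x + s *\<^sub>R y) - u x)\<^sup>2) \<partial>lborel) \<le> ennreal (A * (norm (s *\<^sub>R y))\<^sup>2)" by (rule shift)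
      also have "\<dots> \<le> ennreal (A * DIM('a) * s\<^sup>2)"
        using mult_left_mono[OF norm_unit_cube_le[OF True], of "A * s\<^sup>2"] A
        by (intro ennreal_leI) (simp add: power_mult_distrib mult_ac)
      finally show ?thesis using True by simp
    qed simp
  qed
  also have "\<dots> = ennreal (A * DIM('a) * s\<^sup>2)"
    by (simp add: nn_integral_cmult_indicator emeasure_lborel_cbox_eq)
  finally show ?thesis .
qed

text \<open>With \<open>h = 4\<^sup>-\<^sup>k\<close>, splitting \<open>u\<close> into its average over cubes of side \<open>4 h\<close> and the oscillation gives
  the recursion: the supremum \<open>S h\<close> of the averages is at most \<open>S (4 h)\<close> plus the average of the
  oscillation. The latter is bounded by \<open>h powr (- d / 2)\<close> times an \<open>L\<^sup>2\<close> norm of order \<open>h\<close>, so by a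
  multiple of \<open>h powr (- 1 / 2) = 2\<^sup>k\<close> if \<open>d \<le> 3\<close>, and a geometric sum remains.\<close>

lemma cube_average_growth:
  fixes u :: "'a::euclidean_space \<Rightarrow> real"
  assumes u [measurable]: "u \<in> borel_measurable borel" and pos: "\<And>x. 0 \<le> u x" and dim: "DIM('a) \<le> 3"
    and shift: "\<And>v. (\<integral>\<^sup>+x. ennreal ((u (x + v) - u x)\<^sup>2) \<partial>lborel) \<le> ennreal (A * (norm v)\<^sup>2)" and A: "0 \<le> A"
    and C: "0 \<le> C" "64 * A * DIM('a) \<le> C\<^sup>2" and N: "(\<integral>\<^sup>+x. ennreal ((u x)\<^sup>2) \<partial>lborel) \<le> ennreal (C\<^sup>2)"
  shows "cube_average (1 / 4 ^ k) (\<lambda>x. ennreal (u x)) x \<le> ennreal (C * 2 ^ k)"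
proof (induction k arbitrary: x)
  case 0
  have "(cube_average 1 (\<lambda>x. ennreal (u x)) x)\<^sup>2 \<le> ennreal (C\<^sup>2)"
    using cube_average_square_le[of "\<lambda>x. ennreal (u x)" 1 x] N pos by (simp add: ennreal_power)
  then show ?case using C by (auto intro: ennreal_le_if_power2_le)
next
  case (Suc k)
  define h :: real where "h = 1 / 4 ^ Suc k"
  have h: "h > 0" "h \<le> 1" "4 * h = 1 / 4 ^ k" using one_le_power[of "4::real" "Suc k"]
    by (auto simp: h_def divide_le_eq)
  let ?w = "cube_oscillation (4 * h) u"
  have wm [measurable]: "?w \<in> borel_measurable borel" by measurable
  have "h ^ 3 \<le> h ^ DIM('a)" using h dim by (intro power_decreasing) auto
  then have hd: "1 / h ^ DIM('a) \<le> 1 / h ^ 3" using h by (intro divide_left_mono) auto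
  have "(cube_average h ?w x)\<^sup>2 \<le> ennreal (1 / h ^ DIM('a)) * ennreal (A * DIM('a) * (4 * h)\<^sup>2)"
    by (rule order_trans[OF cube_average_square_le[OF wm h(1)] mult_left_mono[OF cube_oscillation_L2[OF u shift A]]]) simp
  also have "\<dots> \<le> ennreal (1 / h ^ 3) * ennreal (A * DIM('a) * (4 * h)\<^sup>2)"
    using hd by (intro mult_right_mono ennreal_leI) auto
  also have "\<dots> = ennreal (16 * A * DIM('a) / h)"
    using h A by (subst ennreal_mult[symmetric]) (auto simp: power2_eq_square power3_eq_cube field_simps)
  also have "\<dots> \<le> ennreal ((C * 2 ^ Suc k / 2)\<^sup>2)"
  proof (rule ennreal_leI)
    have "16 * A * DIM('a) / h \<le> (C\<^sup>2 / 4) * 4 ^ Suc k"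
      using mult_right_mono[OF C(2), of "4 ^ Suc k / 4"] by (simp add: h_def)
    also have "(4::real) ^ Suc k = (2 ^ Suc k)\<^sup>2" by (simp add: power_mult[symmetric] mult.commute[of _ 2] power_mult)
    finally show "16 * A * DIM('a) / h \<le> (C * 2 ^ Suc k / 2)\<^sup>2" by (simp add: power_mult_distrib power_divide)
  qed
  finally have w: "cube_average h ?w x \<le> ennreal (C * 2 ^ Suc k / 2)"
    by (rule ennreal_le_if_power2_le) (use C in auto)
  have "cube_average h (\<lambda>x. ennreal (u x)) x \<le> (\<integral>\<^sup>+y. indicator (cbox 0 One) y * ennreal (C * 2 ^ k) +
     indicator (cbox 0 One) y * ?w (x + h *\<^sub>R y) \<partial>lborel)"
    unfolding cube_average_def distrib_left[symmetric]
  proof (intro nn_integral_mono mult_left_mono)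
    fix y
    have "ennreal (u (x + h *\<^sub>R y)) \<le> cube_average (4 * h) (\<lambda>x. ennreal (u x)) (x + h *\<^sub>R y) + ?w (x + h *\<^sub>R y)"
      by (rule le_average_plus_oscillation[OF u pos])
    also have "\<dots> \<le> ennreal (C * 2 ^ k) + ?w (x + h *\<^sub>R y)"
      unfolding h by (intro add_right_mono Suc)
    finally show "ennreal (u (x + h *\<^sub>R y)) \<le> ennreal (C * 2 ^ k) + ?w (x + h *\<^sub>R y)" .
  qed simp
  also have "\<dots> = (\<integral>\<^sup>+y. indicator (cbox 0 (One::'a)) y * ennreal (C * 2 ^ k) \<partial>lborel) + cube_average h ?w x"
    unfolding cube_average_def by (rule nn_integral_add) measurable
  also have "(\<integral>\<^sup>+y. indicator (cbox 0 (One::'a)) y * ennreal (C * 2 ^ k) \<partial>lborel) = ennreal (C * 2 ^ k)"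
    by (subst nn_integral_multc) (auto simp: emeasure_lborel_cbox_eq)
  also have "ennreal (C * 2 ^ k) + cube_average h ?w x \<le> ennreal (C * 2 ^ k) + ennreal (C * 2 ^ Suc k / 2)"
    by (intro add_left_mono w)
  also have "\<dots> = ennreal (C * 2 ^ Suc k)" using C by (simp add: ennreal_plus[symmetric] del: ennreal_plus)
  finally show ?case unfolding h_def .
qed

text \<open>At a point where \<open>u\<close> lies between \<open>2 C 2\<^sup>k\<close> and \<open>4 C 2\<^sup>k\<close>, the average over the cube of side \<open>4\<^sup>-\<^sup>k\<close>
  accounts for at most half of \<open>u\<close>, so \<open>u\<close> is at most twice the oscillation \<open>w k\<close>. Then
  \<open>u ^ 4 \<le> 64 C\<^sup>2 4\<^sup>k (w k)\<^sup>2\<close>, whose integral is of order \<open>4\<^sup>k 16\<^sup>-\<^sup>k\<close> and summable.\<close>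

lemma L4_of_Lipschitz_shifts:
  fixes u :: "'a::euclidean_space \<Rightarrow> real"
  assumes u [measurable]: "u \<in> borel_measurable borel" and pos: "\<And>x. 0 \<le> u x" and dim: "DIM('a) \<le> 3"
    and shift: "\<And>v. (\<integral>\<^sup>+x. ennreal ((u (x + v) - u x)\<^sup>2) \<partial>lborel) \<le> ennreal (A * (norm v)\<^sup>2)" and A: "0 \<le> A"
    and L2: "(\<integral>\<^sup>+x. ennreal ((u x)\<^sup>2) \<partial>lborel) < \<infinity>"
  shows "(\<integral>\<^sup>+x. ennreal ((u x) ^ 4) \<partial>lborel) < \<infinity>"
proof -
  obtain N where N: "(\<integral>\<^sup>+x. ennreal ((u x)\<^sup>2) \<partial>lborel) = ennreal N" "0 \<le> N"
    using L2 by (metis ennreal_cases infinity_ennreal_def less_irrefl)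
  define C where "C = sqrt (N + 64 * A * DIM('a) + 1)"
  have C2: "C\<^sup>2 = N + 64 * A * DIM('a) + 1" and C: "C > 0" using N A by (auto simp: C_def intro!: add_nonneg_pos)
  have grow: "cube_average (1 / 4 ^ k) (\<lambda>x. ennreal (u x)) x \<le> ennreal (C * 2 ^ k)" for k x
    by (rule cube_average_growth[OF u pos dim shift A]) (use C C2 N A in \<open>auto intro!: ennreal_leI\<close>)
  define w where "w k = cube_oscillation (1 / 4 ^ k) u" for k :: nat
  have [measurable]: "w k \<in> borel_measurable borel" for k unfolding w_def by measurable
  \<comment> \<open>The first summand covers the points with \<open>u x \<le> 2 * C\<close>; at
      the others one term of the series suffices.\<close>
  have pw: "ennreal ((u x) ^ 4) \<le> ennreal (4 * C\<^sup>2) * ennreal ((u x)\<^sup>2) + (\<Sum>k. ennreal (64 * C\<^sup>2 * 4 ^ k) * (w k x)\<^sup>2)" for x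
  proof (cases "u x \<le> 2 * C")
    case True
    have "(u x) ^ 4 = (u x)\<^sup>2 * (u x)\<^sup>2" by (simp add: power_add[symmetric])
    also have "\<dots> \<le> (2 * C)\<^sup>2 * (u x)\<^sup>2" using True pos by (intro mult_right_mono power_mono) auto
    finally have "ennreal ((u x) ^ 4) \<le> ennreal (4 * C\<^sup>2) * ennreal ((u x)\<^sup>2)"
      by (simp add: ennreal_mult[symmetric] power_mult_distrib ennreal_leI)
    then show ?thesis by (rule order_trans) simp
  next
    case False
    have ex: "\<exists>n. u x \<le> 4 * C * 2 ^ n"
    proof -
      obtain n where "u x / (4 * C) < 2 ^ n" using real_arch_pow[of 2 "u x / (4 * C)"] by auto
      then show ?thesis using C by (intro exI[of _ n]) (simp add: field_simps)
    qed
    define n where "n = (LEAST n. u x \<le> 4 * C * 2 ^ n)"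
    have n1: "u x \<le> 4 * C * 2 ^ n" unfolding n_def by (rule LeastI_ex[OF ex])
    have n2: "2 * C * 2 ^ n \<le> u x"
    proof (cases n)
      case 0 then show ?thesis using False by simp
    next
      case (Suc m)
      then have "\<not> u x \<le> 4 * C * 2 ^ m" using not_less_Least[of m "\<lambda>n. u x \<le> 4 * C * 2 ^ n"] by (simp add: n_def)
      then show ?thesis using Suc by simp
    qed
    have "ennreal (u x) \<le> ennreal (C * 2 ^ n) + w n x"
      using order_trans[OF le_average_plus_oscillation[OF u pos, of x "1 / 4 ^ n"] add_right_mono[OF grow]]
      by (simp add: w_def)
    then have wn: "ennreal (u x / 2) \<le> w n x"
    proof (cases "w n x")
      case (real r)
      then have "u x \<le> C * 2 ^ n + r"
        using \<open>ennreal (u x) \<le> ennreal (C * 2 ^ n) + w n x\<close> C by (simp add: ennreal_plus[symmetric] del: ennreal_plus)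
      then have "u x / 2 \<le> r" using n2 by linarith
      then show ?thesis using real by (simp add: ennreal_leI)
    qed auto
    have "(u x) ^ 4 = (u x)\<^sup>2 * (u x)\<^sup>2" by (simp add: power_add[symmetric])
    also have "\<dots> \<le> (4 * C * 2 ^ n)\<^sup>2 * (u x)\<^sup>2" using n1 pos by (intro mult_right_mono power_mono) auto
    also have "\<dots> = 64 * C\<^sup>2 * 4 ^ n * (u x / 2)\<^sup>2"
      by (simp add: power_mult_distrib power_divide power_mult[symmetric] mult.commute[of n 2]) (simp add: power_mult)
    finally have "ennreal ((u x) ^ 4) \<le> ennreal (64 * C\<^sup>2 * 4 ^ n) * (ennreal (u x / 2))\<^sup>2"
      using pos[of x] by (simp add: ennreal_mult[symmetric] ennreal_power ennreal_leI)
    also have "\<dots> \<le> ennreal (64 * C\<^sup>2 * 4 ^ n) * (w n x)\<^sup>2"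
      by (intro mult_left_mono power_mono wn) auto
    also have "\<dots> \<le> (\<Sum>k. ennreal (64 * C\<^sup>2 * 4 ^ k) * (w k x)\<^sup>2)"
      using sum_le_suminf[of "\<lambda>k. ennreal (64 * C\<^sup>2 * 4 ^ k) * (w k x)\<^sup>2" "{n}"] by simp
    finally show ?thesis by (rule order_trans) simp
  qed
  have "(\<integral>\<^sup>+x. ennreal ((u x) ^ 4) \<partial>lborel) \<le>
     (\<integral>\<^sup>+x. ennreal (4 * C\<^sup>2) * ennreal ((u x)\<^sup>2) + (\<Sum>k. ennreal (64 * C\<^sup>2 * 4 ^ k) * (w k x)\<^sup>2) \<partial>lborel)"
    by (intro nn_integral_mono pw)
  also have "\<dots> = (\<integral>\<^sup>+x. ennreal (4 * C\<^sup>2) * ennreal ((u x)\<^sup>2) \<partial>lborel) +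
     (\<integral>\<^sup>+x. (\<Sum>k. ennreal (64 * C\<^sup>2 * 4 ^ k) * (w k x)\<^sup>2) \<partial>lborel)"
    by (rule nn_integral_add) measurable
  also have "\<dots> = ennreal (4 * C\<^sup>2) * ennreal N + (\<Sum>k. ennreal (64 * C\<^sup>2 * 4 ^ k) * (\<integral>\<^sup>+x. (w k x)\<^sup>2 \<partial>lborel))"
    by (simp add: nn_integral_cmult nn_integral_suminf N)
  also have "\<dots> \<le> ennreal (4 * C\<^sup>2) * ennreal N + (\<Sum>k. ennreal (64 * C\<^sup>2 * A * DIM('a) * (1 / 4) ^ k))"
  proof (intro add_left_mono suminf_le)
    fix k
    have "ennreal (64 * C\<^sup>2 * 4 ^ k) * (\<integral>\<^sup>+x. (w k x)\<^sup>2 \<partial>lborel) \<le> ennreal (64 * C\<^sup>2 * 4 ^ k) * ennreal (A * DIM('a) * (1 / 4 ^ k)\<^sup>2)"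
      unfolding w_def by (intro mult_left_mono cube_oscillation_L2[OF u shift A]) auto
    also have "\<dots> = ennreal (64 * C\<^sup>2 * A * DIM('a) * (1 / 4) ^ k)"
      using A C by (subst ennreal_mult[symmetric]) (auto simp: power2_eq_square field_simps)
    finally show "ennreal (64 * C\<^sup>2 * 4 ^ k) * (\<integral>\<^sup>+x. (w k x)\<^sup>2 \<partial>lborel) \<le> ennreal (64 * C\<^sup>2 * A * DIM('a) * (1 / 4) ^ k)" .
  qed auto
  also have "\<dots> = ennreal (4 * C\<^sup>2) * ennreal N + ennreal (\<Sum>k. 64 * C\<^sup>2 * A * DIM('a) * (1 / 4) ^ k)"
    using A by (subst suminf_ennreal2) (auto intro!: summable_mult summable_geometric)
  also have "\<dots> < \<infinity>" by (simp add: ennreal_mult_less_top)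
  finally show ?thesis .
qed

text \<open>The modulus of \<open>f\<close> inherits the Lipschitz bound for shifts from \<open>f\<close>.\<close>

lemma H1_imp_L4:
  fixes f :: "'a::euclidean_space \<Rightarrow> complex" and G :: "'a \<Rightarrow> 'a \<Rightarrow> complex"
  assumes f [measurable]: "f \<in> borel_measurable borel" and G [measurable]: "\<And>b. b \<in> Basis \<Longrightarrow> G b \<in> borel_measurable borel"
    and w: "\<And>b. b \<in> Basis \<Longrightarrow> has_weak_pderiv UNIV b f (G b)" and dim: "DIM('a) \<le> 3"
    and f2: "(\<integral>\<^sup>+x. ennreal ((norm (f x))\<^sup>2) \<partial>lborel) < \<infinity>"
    and G2: "\<And>b. b \<in> Basis \<Longrightarrow> (\<integral>\<^sup>+x. ennreal ((norm (G b x))\<^sup>2) \<partial>lborel) < \<infinity>"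
  shows "(\<integral>\<^sup>+x. ennreal ((norm (f x)) ^ 4) \<partial>lborel) < \<infinity>"
proof -
  define S where "S x = (\<Sum>b\<in>Basis. (norm (G b x))\<^sup>2)" for x
  have [measurable]: "S \<in> borel_measurable borel" unfolding S_def[abs_def] by measurable
  have S0: "S x \<ge> 0" for x by (auto simp: S_def sum_nonneg)
  have "(\<integral>\<^sup>+x. ennreal (S x) \<partial>lborel) = (\<Sum>b\<in>Basis. (\<integral>\<^sup>+x. ennreal ((norm (G b x))\<^sup>2) \<partial>lborel))"
    unfolding S_def by (subst nn_integral_sum[symmetric]) (auto simp: sum_ennreal)
  also have "\<dots> < \<infinity>" using G2 by (simp add: ennreal_sum_less_top)
  finally obtain A where A: "(\<integral>\<^sup>+x. ennreal (S x) \<partial>lborel) = ennreal A" "0 \<le> A"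
    by (metis ennreal_cases infinity_ennreal_def less_irrefl)
  show ?thesis
  proof (rule L4_of_Lipschitz_shifts[OF _ _ dim _ A(2) f2])
    fix v :: 'a
    define g where "g x = (\<Sum>b\<in>Basis. of_real (v \<bullet> b) * G b x)" for x
    have g [measurable]: "g \<in> borel_measurable borel" unfolding g_def[abs_def] by measurable
    have wg: "has_weak_pderiv UNIV v f g"
      unfolding g_def[abs_def] by (rule has_weak_pderiv_direction[OF open_UNIV w])
    have gS: "(norm (g x))\<^sup>2 \<le> (norm v)\<^sup>2 * S x" for x
    proof -
      have "norm (g x) \<le> (\<Sum>b\<in>Basis. \<bar>v \<bullet> b\<bar> * norm (G b x))"
        unfolding g_def by (rule order_trans[OF norm_sum]) (simp add: norm_mult)
      then have "(norm (g x))\<^sup>2 \<le> (\<Sum>b\<in>Basis. \<bar>v \<bullet> b\<bar> * norm (G b x))\<^sup>2" by (rule power_mono) simp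
      also have "\<dots> \<le> (\<Sum>b\<in>Basis. \<bar>v \<bullet> b\<bar>\<^sup>2) * S x"
        unfolding S_def by (rule Cauchy_Schwarz_ineq_sum)
      also have "(\<Sum>b\<in>Basis. \<bar>v \<bullet> b\<bar>\<^sup>2) = (norm v)\<^sup>2"
        by (simp add: norm_power2_Basis)
      finally show ?thesis .
    qed
    have "(\<integral>\<^sup>+x. ennreal ((norm (f (x + v)) - norm (f x))\<^sup>2) \<partial>lborel) \<le> (\<integral>\<^sup>+x. ennreal ((norm (f (x + v) - f x))\<^sup>2) \<partial>lborel)"
      by (intro nn_integral_mono ennreal_leI) (simp add: abs_le_square_iff[symmetric] norm_triangle_ineq3)
    also have "\<dots> \<le> (\<integral>\<^sup>+x. \<integral>\<^sup>+t. indicator {0..1::real} t * ennreal ((norm (g (x + t *\<^sub>R v)))\<^sup>2) \<partial>lborel \<partial>lborel)"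
      by (rule nn_integral_mono_AE[OF weak_pderiv_difference_square[OF f g wg]])
    also have "\<dots> \<le> (\<integral>\<^sup>+x. \<integral>\<^sup>+t. indicator {0..1::real} t * ennreal ((norm v)\<^sup>2 * S (x + t *\<^sub>R v)) \<partial>lborel \<partial>lborel)"
      by (intro nn_integral_mono mult_left_mono ennreal_leI gS) auto
    also have "\<dots> = (\<integral>\<^sup>+t. \<integral>\<^sup>+x. indicator {0..1::real} t * ennreal ((norm v)\<^sup>2 * S (x + t *\<^sub>R v)) \<partial>lborel \<partial>lborel)"
      by (rule lborel_pair.Fubini') measurable
    also have "\<dots> = (\<integral>\<^sup>+t. indicator {0..1::real} t * (\<integral>\<^sup>+x. ennreal ((norm v)\<^sup>2 * S (x + t *\<^sub>R v)) \<partial>lborel) \<partial>lborel)"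
      by (intro nn_integral_cong nn_integral_cmult) measurable
    also have "\<dots> = (\<integral>\<^sup>+t. indicator {0..1::real} t * (\<integral>\<^sup>+x. ennreal ((norm v)\<^sup>2 * S x) \<partial>lborel) \<partial>lborel)"
      by (subst nn_integral_lborel_shift[of "\<lambda>x. ennreal ((norm v)\<^sup>2 * S x)"]) auto
    also have "\<dots> = (\<integral>\<^sup>+x. ennreal ((norm v)\<^sup>2 * S x) \<partial>lborel)"
      by (subst nn_integral_multc) auto
    also have "\<dots> = ennreal (A * (norm v)\<^sup>2)"
      using S0 A by (simp add: ennreal_mult nn_integral_cmult nn_integral_multc mult.commute)
    finally show "(\<integral>\<^sup>+x. ennreal ((norm (f (x + v)) - norm (f x))\<^sup>2) \<partial>lborel) \<le> ennreal (A * (norm v)\<^sup>2)" .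
  qed auto
qed

section \<open>Square-integrable functions\<close>

lemma Lp_norm_2: "(Lp_norm D 2 f)\<^sup>2 = (LINT x|lebesgue_on D. (norm (f x))\<^sup>2)"
proof -
  have "0 \<le> (LINT x|lebesgue_on D. (norm (f x))\<^sup>2)" by (intro Bochner_Integration.integral_nonneg) auto
  then show ?thesis by (simp add: Lp_norm_def powr_half_sqrt)
qed

lemma Lp_norm_4: "(Lp_norm D 4 f) ^ 4 = (LINT x|lebesgue_on D. (norm (f x)) ^ 4)"
proof -
  have nn: "0 \<le> (LINT x|lebesgue_on D. (norm (f x)) ^ 4)" by (intro Bochner_Integration.integral_nonneg) auto
  have "((LINT x|lebesgue_on D. (norm (f x)) ^ 4) powr (1 / 4)) ^ 4 = (LINT x|lebesgue_on D. (norm (f x)) ^ 4)"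
    using nn by (cases "(LINT x|lebesgue_on D. (norm (f x)) ^ 4) = 0")
      (simp_all add: powr_power)
  then show ?thesis by (simp add: Lp_norm_def)
qed

abbreviation L2_sq :: "'a::euclidean_space set \<Rightarrow> ('a \<Rightarrow> complex) \<Rightarrow> real" where
  "L2_sq D f \<equiv> (LINT x|lebesgue_on D. (cmod (f x))\<^sup>2)"

lemma L2_sq_nonneg: "0 \<le> L2_sq D f"
  by (intro Bochner_Integration.integral_nonneg) auto

lemma L2_space_D:
  assumes "f \<in> L2_space D"
  shows "f \<in> borel_measurable (lebesgue_on D)" "integrable (lebesgue_on D) (\<lambda>x. (cmod (f x))\<^sup>2)"
  using assms by (auto simp: L2_space_def)

lemma cmod_mult_le_squares: "cmod u * cmod v \<le> (cmod u)\<^sup>2 + (cmod v)\<^sup>2"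
proof -
  have "0 \<le> cmod u * cmod v" by simp
  then show ?thesis using sum_squares_bound[of "cmod u" "cmod v"] by linarith
qed

lemma L2_space_integrable_mult:
  assumes f: "f \<in> L2_space D" and g: "g \<in> L2_space D"
  shows "integrable (lebesgue_on D) (\<lambda>x. f x * g x)"
proof (rule Bochner_Integration.integrable_bound)
  note [measurable] = L2_space_D(1)[OF f] L2_space_D(1)[OF g]
  show "integrable (lebesgue_on D) (\<lambda>x. (cmod (f x))\<^sup>2 + (cmod (g x))\<^sup>2)"
    using L2_space_D[OF f] L2_space_D[OF g] by auto
  show "(\<lambda>x. f x * g x) \<in> borel_measurable (lebesgue_on D)" by measurable
  show "AE x in lebesgue_on D. cmod (f x * g x) \<le> norm ((cmod (f x))\<^sup>2 + (cmod (g x))\<^sup>2)"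
    by (simp add: norm_mult cmod_mult_le_squares)
qed

lemma L2_space_cnj: "f \<in> L2_space D \<Longrightarrow> (\<lambda>x. cnj (f x)) \<in> L2_space D"
  unfolding L2_space_def by (auto simp: borel_measurable_complex_iff)

lemma L2_space_lincomb:
  assumes f: "f \<in> L2_space D" and g: "g \<in> L2_space D"
  shows "(\<lambda>x. c * f x + d * g x) \<in> L2_space D"
proof -
  note [measurable] = L2_space_D(1)[OF f] L2_space_D(1)[OF g]
  have "integrable (lebesgue_on D) (\<lambda>x. (cmod (c * f x + d * g x))\<^sup>2)"
  proof (rule Bochner_Integration.integrable_bound)
    show "integrable (lebesgue_on D) (\<lambda>x. 2 * (cmod c)\<^sup>2 * (cmod (f x))\<^sup>2 + 2 * (cmod d)\<^sup>2 * (cmod (g x))\<^sup>2)"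
      using L2_space_D[OF f] L2_space_D[OF g] by auto
    show "(\<lambda>x. (cmod (c * f x + d * g x))\<^sup>2) \<in> borel_measurable (lebesgue_on D)" by measurable
    have "(cmod (c * f x + d * g x))\<^sup>2 \<le> 2 * (cmod c)\<^sup>2 * (cmod (f x))\<^sup>2 + 2 * (cmod d)\<^sup>2 * (cmod (g x))\<^sup>2" for x
    proof -
      have "(cmod (c * f x + d * g x))\<^sup>2 \<le> (cmod (c * f x) + cmod (d * g x))\<^sup>2"
        by (intro power_mono norm_triangle_ineq) auto
      also have "\<dots> \<le> 2 * (cmod (c * f x))\<^sup>2 + 2 * (cmod (d * g x))\<^sup>2"
        using sum_squares_bound[of "cmod (c * f x)" "cmod (d * g x)"] by (simp add: power2_sum)
      finally show ?thesis by (simp add: norm_mult power_mult_distrib)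
    qed
    then show "AE x in lebesgue_on D. norm ((cmod (c * f x + d * g x))\<^sup>2) \<le>
        norm (2 * (cmod c)\<^sup>2 * (cmod (f x))\<^sup>2 + 2 * (cmod d)\<^sup>2 * (cmod (g x))\<^sup>2)"
      by auto
  qed
  then show ?thesis by (simp add: L2_space_def)
qed

lemma L2_space_diff: "f \<in> L2_space D \<Longrightarrow> g \<in> L2_space D \<Longrightarrow> (\<lambda>x. f x - g x) \<in> L2_space D"
  using L2_space_lincomb[of f D g 1 "-1"] by simp

lemma L2_Cauchy_Schwarz:
  assumes f: "f \<in> L2_space D" and g: "g \<in> L2_space D"
  shows "(cmod (LINT x|lebesgue_on D. f x * g x))\<^sup>2 \<le> L2_sq D f * L2_sq D g"
proof -
  note [measurable] = L2_space_D(1)[OF f] L2_space_D(1)[OF g]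
  have nn: "(\<integral>\<^sup>+x. (ennreal (cmod (h x)))\<^sup>2 \<partial>lebesgue_on D) = ennreal (L2_sq D h)" if "h \<in> L2_space D" for h
    using L2_space_D[OF that] by (subst nn_integral_eq_integral[symmetric]) (auto simp: ennreal_power)
  have "ennreal (cmod (LINT x|lebesgue_on D. f x * g x)) \<le> (\<integral>\<^sup>+x. ennreal (cmod (f x)) * ennreal (cmod (g x)) \<partial>lebesgue_on D)"
    using integral_norm_bound_ennreal[OF L2_space_integrable_mult[OF f g]]
    by (simp add: norm_mult ennreal_mult)
  then have "(ennreal (cmod (LINT x|lebesgue_on D. f x * g x)))\<^sup>2 \<le> (\<integral>\<^sup>+x. ennreal (cmod (f x)) * ennreal (cmod (g x)) \<partial>lebesgue_on D)\<^sup>2"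
    by (rule power_mono) simp
  also have "\<dots> \<le> (\<integral>\<^sup>+x. (ennreal (cmod (f x)))\<^sup>2 \<partial>lebesgue_on D) * (\<integral>\<^sup>+x. (ennreal (cmod (g x)))\<^sup>2 \<partial>lebesgue_on D)"
    by (rule Cauchy_Schwarz_nn_integral) measurable
  finally show ?thesis
    unfolding nn[OF f] nn[OF g] by (simp add: ennreal_power ennreal_mult[symmetric] L2_sq_nonneg)
qed

text \<open>Strong convergence of one factor in \<open>L\<^sup>2\<close>, by the Cauchy-Schwarz inequality.\<close>

lemma L2_limit:
  assumes h: "h \<in> L2_space D" and f: "f \<in> L2_space D" and g: "\<And>m::nat. g m \<in> L2_space D"
    and lim: "(\<lambda>m. L2_sq D (\<lambda>x. f x - g m x)) \<longlonglongrightarrow> 0"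
  shows "(\<lambda>m. LINT x|lebesgue_on D. h x * g m x) \<longlonglongrightarrow> (LINT x|lebesgue_on D. h x * f x)"
proof -
  have "(\<lambda>m. (cmod ((LINT x|lebesgue_on D. h x * f x) - (LINT x|lebesgue_on D. h x * g m x)))\<^sup>2) \<longlonglongrightarrow> 0"
  proof (rule Lim_null_comparison)
    have "(cmod ((LINT x|lebesgue_on D. h x * f x) - (LINT x|lebesgue_on D. h x * g m x)))\<^sup>2 \<le> L2_sq D h * L2_sq D (\<lambda>x. f x - g m x)" for m
    proof -
      have "(LINT x|lebesgue_on D. h x * f x) - (LINT x|lebesgue_on D. h x * g m x) = (LINT x|lebesgue_on D. h x * (f x - g m x))"
        unfolding right_diff_distrib by (intro Bochner_Integration.integral_diff[symmetric] L2_space_integrable_mult h f g)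
      then show ?thesis using L2_Cauchy_Schwarz[OF h L2_space_diff[OF f g]] by simp
    qed
    then show "\<forall>\<^sub>F m in sequentially. norm ((cmod ((LINT x|lebesgue_on D. h x * f x) - (LINT x|lebesgue_on D. h x * g m x)))\<^sup>2)
        \<le> L2_sq D h * L2_sq D (\<lambda>x. f x - g m x)" by simp
    show "(\<lambda>m. L2_sq D h * L2_sq D (\<lambda>x. f x - g m x)) \<longlonglongrightarrow> 0"
      using tendsto_mult[OF tendsto_const lim] by simp
  qed
  then have "(\<lambda>m. cmod ((LINT x|lebesgue_on D. h x * f x) - (LINT x|lebesgue_on D. h x * g m x))) \<longlonglongrightarrow> 0"
    by simp
  then have "(\<lambda>m. (LINT x|lebesgue_on D. h x * f x) - (LINT x|lebesgue_on D. h x * g m x)) \<longlonglongrightarrow> 0"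
    by (simp only: tendsto_norm_zero_iff)
  from tendsto_diff[OF tendsto_const[of "LINT x|lebesgue_on D. h x * f x"] this] show ?thesis by simp
qed

lemma AE_lebesgue_on_iff:
  "open D \<Longrightarrow> (AE x in lebesgue_on D. P x) \<longleftrightarrow> (AE x in lebesgue. x \<in> D \<longrightarrow> P x)"
  by (subst AE_restrict_space_iff) auto

lemma L2_space_cong_AE:
  assumes f: "f \<in> L2_space D" and eq: "AE x in lebesgue. x \<in> D \<longrightarrow> f x = g x" and D: "open D"
  shows "g \<in> L2_space D" "L2_sq D g = L2_sq D f"
proof -
  have "(\<lambda>x. indicator D x *\<^sub>R f x) \<in> borel_measurable lebesgue"
    using L2_space_D(1)[OF f] D by (subst (asm) borel_measurable_restrict_space_iff) auto
  moreover have "AE x in lebesgue. indicator D x *\<^sub>R f x = indicator D x *\<^sub>R g x"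
    using eq by eventually_elim (auto simp: indicator_def)
  ultimately have "(\<lambda>x. indicator D x *\<^sub>R g x) \<in> borel_measurable lebesgue"
    by (rule borel_measurable_AE)
  then have g: "g \<in> borel_measurable (lebesgue_on D)"
    using D by (subst borel_measurable_restrict_space_iff) auto
  have eq': "AE x in lebesgue_on D. (cmod (g x))\<^sup>2 = (cmod (f x))\<^sup>2"
    using eq D by (auto simp: AE_lebesgue_on_iff elim: eventually_mono)
  note [measurable] = g L2_space_D(1)[OF f]
  show "L2_sq D g = L2_sq D f" by (rule integral_cong_AE[OF _ _ eq']) measurable
  have "integrable (lebesgue_on D) (\<lambda>x. (cmod (g x))\<^sup>2)"
    by (subst integrable_cong_AE[OF _ _ eq']) (use L2_space_D(2)[OF f] in measurable)
  with g show "g \<in> L2_space D" by (simp add: L2_space_def)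
qed

lemma L2_imp_locally_integrable:
  assumes f: "f \<in> L2_space D" and D: "open D"
  shows "locally_integrable D f"
  unfolding locally_integrable_def
proof (intro allI impI)
  fix K :: "'a set" assume K: "compact K \<and> K \<subseteq> D"
  then have Ks [measurable]: "K \<in> sets lebesgue" by (simp add: borel_compact)
  have [measurable]: "(\<lambda>x. indicator D x *\<^sub>R f x) \<in> borel_measurable lebesgue"
    using L2_space_D(1)[OF f] D by (subst (asm) borel_measurable_restrict_space_iff) auto
  have i2: "integrable lebesgue (\<lambda>x. indicator D x *\<^sub>R (cmod (f x))\<^sup>2)"
    using L2_space_D(2)[OF f] D by (subst (asm) integrable_restrict_space) auto
  have eq: "(\<lambda>x. indicator K x *\<^sub>R f x) = (\<lambda>x. indicator K x *\<^sub>R (indicator D x *\<^sub>R f x))"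
    using K by (auto simp: indicator_def fun_eq_iff)
  have "integrable lebesgue (\<lambda>x. indicator K x *\<^sub>R f x)"
  proof (rule Bochner_Integration.integrable_bound)
    have "K \<in> lmeasurable" using K by (simp add: lmeasurable_compact)
    then have "emeasure lebesgue K < \<infinity>" unfolding fmeasurable_def by blast
    then show "integrable lebesgue (\<lambda>x. indicator K x + indicator D x *\<^sub>R (cmod (f x))\<^sup>2)"
      by (intro Bochner_Integration.integrable_add integrable_real_indicator Ks i2)
    show "(\<lambda>x. indicator K x *\<^sub>R f x) \<in> borel_measurable lebesgue"
      unfolding eq by measurable
    show "AE x in lebesgue. norm (indicator K x *\<^sub>R f x) \<le> norm (indicator K x + indicator D x *\<^sub>R (cmod (f x))\<^sup>2)"
    proof (rule AE_I2)
      fix x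
      have "cmod (f x) \<le> 1 + (cmod (f x))\<^sup>2"
        using sum_squares_bound[of "cmod (f x)" 1] norm_ge_zero[of "f x"] unfolding power_one mult_1_right by linarith
      then show "norm (indicator K x *\<^sub>R f x) \<le> norm (indicator K x + indicator D x *\<^sub>R (cmod (f x))\<^sup>2)"
        using K by (auto simp: indicator_def)
    qed
  qed
  then show "f absolutely_integrable_on K" by (simp add: set_integrable_def)
qed

lemma L2_space_iff_extend:
  assumes D: "D \<in> sets lebesgue"
  shows "f \<in> L2_space D \<longleftrightarrow> (\<lambda>x. indicator D x * f x) \<in> L2_space UNIV"
proof -
  have "(\<lambda>x. indicator D x *\<^sub>R f x) = (\<lambda>x. indicator D x * f x)" by (auto simp: indicator_def)
  moreover have "(\<lambda>x. indicator D x *\<^sub>R (cmod (f x))\<^sup>2) = (\<lambda>x. (cmod (indicator D x * f x))\<^sup>2)"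
    by (auto simp: indicator_def)
  ultimately show ?thesis
    using D by (simp add: L2_space_def lebesgue_on_UNIV_eq borel_measurable_restrict_space_iff integrable_restrict_space)
qed

lemma L2_space_extend:
  "f \<in> L2_space D \<Longrightarrow> D \<in> sets lebesgue \<Longrightarrow> (\<lambda>x. indicator D x * f x) \<in> L2_space UNIV"
  by (simp add: L2_space_iff_extend[of D])

lemma L2_space_subset:
  assumes f: "f \<in> L2_space D" and D: "D \<in> sets lebesgue" "E \<in> sets lebesgue" "E \<subseteq> D"
  shows "f \<in> L2_space E"
proof -
  let ?f = "\<lambda>x. indicator D x * f x"
  have f': "?f \<in> borel_measurable lebesgue" "integrable lebesgue (\<lambda>x. (cmod (?f x))\<^sup>2)"
    using L2_space_D[OF L2_space_extend[OF f D(1)]] by (simp_all add: lebesgue_on_UNIV_eq)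
  have eq: "(\<lambda>x. indicator E x * f x) = (\<lambda>x. indicator E x *\<^sub>R ?f x)"
    "(\<lambda>x. (cmod (indicator E x * f x))\<^sup>2) = (\<lambda>x. indicator E x *\<^sub>R (cmod (?f x))\<^sup>2)"
    using D(3) by (auto simp: indicator_def fun_eq_iff)
  have "(\<lambda>x. indicator E x * f x) \<in> borel_measurable lebesgue"
    unfolding eq by (rule borel_measurable_scaleR[OF borel_measurable_indicator[OF D(2)] f'(1)])
  moreover have "integrable lebesgue (\<lambda>x. (cmod (indicator E x * f x))\<^sup>2)"
    unfolding eq by (rule integrable_mult_indicator[OF D(2) f'(2)])
  ultimately show ?thesis unfolding L2_space_iff_extend[OF D(2)] by (simp add: L2_space_def lebesgue_on_UNIV_eq)
qed

lemma L2_space_continuous: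
  assumes h: "continuous_on UNIV h" and D: "D \<in> sets lebesgue" "bounded D"
  shows "h \<in> L2_space D"
proof -
  have hm: "h \<in> borel_measurable lebesgue"
    using h by (simp add: borel_measurable_continuous_onI measurable_completion)
  have "compact (h ` closure D)"
    using h D by (intro compact_continuous_image) (auto intro: continuous_on_subset)
  then obtain M where M: "\<And>x. x \<in> closure D \<Longrightarrow> norm (h x) \<le> M"
    by (meson bounded_iff compact_imp_bounded imageI)
  have "integrable lebesgue (\<lambda>x. indicator D x *\<^sub>R (cmod (h x))\<^sup>2)"
  proof (rule Bochner_Integration.integrable_bound)
    have "emeasure lebesgue D < \<infinity>"
      using bounded_set_imp_lmeasurable[OF D(2,1)] unfolding fmeasurable_def by blast
    then show "integrable lebesgue (\<lambda>x. M\<^sup>2 * indicator D x)"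
      by (intro integrable_mult_right integrable_real_indicator D(1))
    show "(\<lambda>x. indicator D x *\<^sub>R (cmod (h x))\<^sup>2) \<in> borel_measurable lebesgue"
      using hm D(1) by measurable
    have "(cmod (h x))\<^sup>2 \<le> M\<^sup>2" if "x \<in> D" for x
      using M[of x] that closure_subset by (intro power_mono) auto
    then show "AE x in lebesgue. norm (indicator D x *\<^sub>R (cmod (h x))\<^sup>2) \<le> norm (M\<^sup>2 * indicator D x)"
      by (auto simp: indicator_def)
  qed
  then have "integrable (lebesgue_on D) (\<lambda>x. (cmod (h x))\<^sup>2)"
    using D by (subst integrable_restrict_space) auto
  moreover have "h \<in> borel_measurable (lebesgue_on D)"
    using hm by (rule measurable_restrict_space1)
  ultimately show ?thesis by (simp add: L2_space_def)
qed

section \<open>Sobolev spaces\<close>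

lemma has_weak_pderiv_weak_pderiv:
  "has_weak_pderiv D b f g \<Longrightarrow> has_weak_pderiv D b f (weak_pderiv D b f)"
  unfolding weak_pderiv_def by (rule someI[of "has_weak_pderiv D b f"])

text \<open>This is how the selected weak derivative is identified in all that follows.\<close>

lemma weak_pderiv_AE_eq:
  "open D \<Longrightarrow> has_weak_pderiv D b f g \<Longrightarrow> AE x in lebesgue. x \<in> D \<longrightarrow> weak_pderiv D b f x = g x"
  using weak_pderiv_unique has_weak_pderiv_weak_pderiv by blast

lemma weak_pderiv_L2:
  assumes D: "open D" and g: "g \<in> L2_space D" "has_weak_pderiv D b f g"
  shows "weak_pderiv D b f \<in> L2_space D"
proof (rule L2_space_cong_AE(1)[OF g(1) _ D])
  show "AE x in lebesgue. x \<in> D \<longrightarrow> g x = weak_pderiv D b f x"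
    using weak_pderiv_AE_eq[OF D g(2)] by eventually_elim auto
qed

lemma H1_space_D:
  assumes D: "open D" and f: "f \<in> H1_space D" and b: "b \<in> Basis"
  shows "f \<in> L2_space D" "weak_pderiv D b f \<in> L2_space D" "has_weak_pderiv D b f (weak_pderiv D b f)"
proof -
  show "f \<in> L2_space D" using f by (simp add: H1_space_def)
  obtain g where g: "g \<in> L2_space D" "has_weak_pderiv D b f g" using f b by (auto simp: H1_space_def)
  show "weak_pderiv D b f \<in> L2_space D" by (rule weak_pderiv_L2[OF D g])
  show "has_weak_pderiv D b f (weak_pderiv D b f)" by (rule has_weak_pderiv_weak_pderiv[OF g(2)])
qed

text \<open>The definition provides some weak derivative in \<open>H\<^sup>1\<close>; the selected one agrees with it almost
  everywhere and therefore has the same weak derivatives.\<close>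

lemma H2_space_D:
  assumes D: "open D" and f: "f \<in> H2_space D" and b: "b \<in> Basis"
  shows "f \<in> L2_space D" "weak_pderiv D b f \<in> L2_space D" "has_weak_pderiv D b f (weak_pderiv D b f)"
    "weak_pderiv D b (weak_pderiv D b f) \<in> L2_space D"
    "has_weak_pderiv D b (weak_pderiv D b f) (weak_pderiv D b (weak_pderiv D b f))"
proof -
  show "f \<in> L2_space D" using f by (auto simp: H2_space_def)
  obtain g where g: "g \<in> H1_space D" "has_weak_pderiv D b f g" using f b by (auto simp: H2_space_def)
  note g1 = H1_space_D[OF D g(1) b]
  show "weak_pderiv D b f \<in> L2_space D" by (rule weak_pderiv_L2[OF D g1(1) g(2)])
  show "has_weak_pderiv D b f (weak_pderiv D b f)" by (rule has_weak_pderiv_weak_pderiv[OF g(2)])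
  have "AE x in lebesgue. x \<in> D \<longrightarrow> g x = weak_pderiv D b f x"
    using weak_pderiv_AE_eq[OF D g(2)] by eventually_elim auto
  then have w: "has_weak_pderiv D b (weak_pderiv D b f) (weak_pderiv D b g)"
    by (rule has_weak_pderiv_cong_AE[OF D g1(3)]) simp
  show "weak_pderiv D b (weak_pderiv D b f) \<in> L2_space D" by (rule weak_pderiv_L2[OF D g1(2) w])
  show "has_weak_pderiv D b (weak_pderiv D b f) (weak_pderiv D b (weak_pderiv D b f))"
    by (rule has_weak_pderiv_weak_pderiv[OF w])
qed

lemma H2_space_lincomb:
  assumes D: "open D" and f: "f \<in> H2_space D" and g: "g \<in> H2_space D"
  shows "(\<lambda>x. c * f x + d * g x) \<in> H2_space D"
proof -
  have H1: "(\<lambda>x. c * u x + d * v x) \<in> H1_space D" if u: "u \<in> H1_space D" and v: "v \<in> H1_space D" for u v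
  proof -
    have "\<exists>w\<in>L2_space D. has_weak_pderiv D b (\<lambda>x. c * u x + d * v x) w" if b: "b \<in> Basis" for b
      using has_weak_pderiv_lincomb[OF D H1_space_D(3)[OF D u b] H1_space_D(3)[OF D v b]]
        L2_space_lincomb[OF H1_space_D(2)[OF D u b] H1_space_D(2)[OF D v b]] by blast
    moreover have "(\<lambda>x. c * u x + d * v x) \<in> L2_space D"
      using u v by (intro L2_space_lincomb) (auto simp: H1_space_def)
    ultimately show ?thesis by (auto simp: H1_space_def)
  qed
  have "\<exists>w\<in>H1_space D. has_weak_pderiv D b (\<lambda>x. c * f x + d * g x) w" if b: "b \<in> Basis" for b
  proof -
    obtain f' where "f' \<in> H1_space D" "has_weak_pderiv D b f f'"
      using f b by (auto simp: H2_space_def)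
    moreover obtain g' where "g' \<in> H1_space D" "has_weak_pderiv D b g g'"
      using g b by (auto simp: H2_space_def)
    ultimately show ?thesis using H1 has_weak_pderiv_lincomb[OF D] by blast
  qed
  moreover have "(\<lambda>x. c * f x + d * g x) \<in> L2_space D"
    using f g by (intro L2_space_lincomb) (auto simp: H2_space_def)
  ultimately show ?thesis by (auto simp: H2_space_def)
qed

section \<open>Homogeneous Dirichlet conditions\<close>

text \<open>The norm in the definition of \<open>H\<^sup>1\<^sub>0\<close> involves the selected weak derivative of \<open>f - \<phi> m\<close>, which is
  the difference of that of \<open>f\<close> and the classical derivative of \<open>\<phi> m\<close>.\<close>

lemma H10_approximation:
  fixes D :: "'a::euclidean_space set"
  assumes D: "open D" "bounded D" and f: "f \<in> H10_space D"
  obtains \<phi> where "\<And>m::nat. \<phi> m \<in> test_functions D" "(\<lambda>m. L2_sq D (\<lambda>x. f x - \<phi> m x)) \<longlonglongrightarrow> 0"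
    "\<And>b. b \<in> Basis \<Longrightarrow> (\<lambda>m. L2_sq D (\<lambda>x. weak_pderiv D b f x - ddir b (\<phi> m) x)) \<longlonglongrightarrow> 0"
proof -
  have H1: "f \<in> H1_space D" using f by (auto simp: H10_space_def)
  obtain \<phi> where phi: "\<And>m::nat. \<phi> m \<in> test_functions D" and lim: "(\<lambda>m. H1_norm D (\<lambda>x. f x - \<phi> m x)) \<longlonglongrightarrow> 0"
    using f by (auto simp: H10_space_def)
  have Ds: "D \<in> sets lebesgue" using D by simp
  define N where "N m = (H1_norm D (\<lambda>x. f x - \<phi> m x))\<^sup>2" for m
  have N: "N \<longlonglongrightarrow> 0" unfolding N_def[abs_def] using tendsto_power[OF lim, of 2] by simp
  have fL: "f \<in> L2_space D" using H1 by (auto simp: H1_space_def)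
  have phiL: "\<phi> m \<in> L2_space D" "ddir b (\<phi> m) \<in> L2_space D" for m b
    using test_functions_D(5,6)[OF phi[of m]] Ds D(2) by (auto intro!: L2_space_continuous)
  have ae: "AE x in lebesgue. x \<in> D \<longrightarrow> weak_pderiv D b (\<lambda>x. f x - \<phi> m x) x = weak_pderiv D b f x - ddir b (\<phi> m) x"
    if b: "b \<in> Basis" for m b
    using weak_pderiv_AE_eq[OF D(1) has_weak_pderiv_lincomb[OF D(1) H1_space_D(3)[OF D(1) H1 b]
          has_weak_pderiv_smooth[OF D(1) test_functions_D(1)[OF phi[of m]]], of 1 "-1"]] by simp
  have dL: "(\<lambda>x. weak_pderiv D b f x - ddir b (\<phi> m) x) \<in> L2_space D" if b: "b \<in> Basis" for m b
    by (rule L2_space_diff[OF H1_space_D(2)[OF D(1) H1 b] phiL(2)])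
  have wL: "weak_pderiv D b (\<lambda>x. f x - \<phi> m x) \<in> L2_space D"
    "L2_sq D (weak_pderiv D b (\<lambda>x. f x - \<phi> m x)) = L2_sq D (\<lambda>x. weak_pderiv D b f x - ddir b (\<phi> m) x)"
    if b: "b \<in> Basis" for m b
  proof -
    have "AE x in lebesgue. x \<in> D \<longrightarrow> weak_pderiv D b f x - ddir b (\<phi> m) x = weak_pderiv D b (\<lambda>x. f x - \<phi> m x) x"
      using ae[OF b, of m] by eventually_elim simp
    from L2_space_cong_AE[OF dL[OF b] this D(1)]
    show "weak_pderiv D b (\<lambda>x. f x - \<phi> m x) \<in> L2_space D"
      "L2_sq D (weak_pderiv D b (\<lambda>x. f x - \<phi> m x)) = L2_sq D (\<lambda>x. weak_pderiv D b f x - ddir b (\<phi> m) x)" by auto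
  qed
  have Neq: "N m = L2_sq D (\<lambda>x. f x - \<phi> m x) + (\<Sum>b\<in>Basis. L2_sq D (\<lambda>x. weak_pderiv D b f x - ddir b (\<phi> m) x))" for m
  proof -
    have "(Lp_norm D 2 (gradient_norm D (\<lambda>x. f x - \<phi> m x)))\<^sup>2 =
       (LINT x|lebesgue_on D. (\<Sum>b\<in>Basis. (cmod (weak_pderiv D b (\<lambda>x. f x - \<phi> m x) x))\<^sup>2))"
      by (simp add: Lp_norm_2 gradient_norm_def sum_nonneg)
    also have "\<dots> = (\<Sum>b\<in>Basis. L2_sq D (weak_pderiv D b (\<lambda>x. f x - \<phi> m x)))"
      by (rule Bochner_Integration.integral_sum) (rule L2_space_D(2)[OF wL(1)])
    finally show ?thesis
      unfolding N_def H1_norm_def by (simp add: Lp_norm_2 wL(2) sum_nonneg L2_sq_nonneg)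
  qed
  show ?thesis
  proof (rule that[OF phi])
    show "(\<lambda>m. L2_sq D (\<lambda>x. f x - \<phi> m x)) \<longlonglongrightarrow> 0"
    proof (rule Lim_null_comparison[OF _ N])
      show "\<forall>\<^sub>F m in sequentially. norm (L2_sq D (\<lambda>x. f x - \<phi> m x)) \<le> N m"
        by (simp add: Neq L2_sq_nonneg sum_nonneg)
    qed
    fix b :: 'a assume b: "b \<in> Basis"
    show "(\<lambda>m. L2_sq D (\<lambda>x. weak_pderiv D b f x - ddir b (\<phi> m) x)) \<longlonglongrightarrow> 0"
    proof (rule Lim_null_comparison[OF _ N], rule always_eventually, rule allI)
      fix m
      have "L2_sq D (\<lambda>x. weak_pderiv D b f x - ddir b (\<phi> m) x) \<le> (\<Sum>b\<in>Basis. L2_sq D (\<lambda>x. weak_pderiv D b f x - ddir b (\<phi> m) x))"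
        by (rule member_le_sum[OF b]) (auto simp: L2_sq_nonneg)
      moreover have "0 \<le> L2_sq D (\<lambda>x. f x - \<phi> m x)" "0 \<le> L2_sq D (\<lambda>x. weak_pderiv D b f x - ddir b (\<phi> m) x)"
        by (rule L2_sq_nonneg)+
      ultimately show "norm (L2_sq D (\<lambda>x. weak_pderiv D b f x - ddir b (\<phi> m) x)) \<le> N m"
        unfolding Neq real_norm_def by linarith
    qed
  qed
qed

lemma L2_sq_cnj: "L2_sq D (\<lambda>x. cnj (f x) - cnj (g x)) = L2_sq D (\<lambda>x. f x - g x)"
  by (simp flip: complex_cnj_diff)

text \<open>For a test function in place of \<open>G\<close> this is the definition of the weak derivative \<open>F'\<close>; both
  sides are continuous in \<open>G\<close> with respect to the \<open>H\<^sup>1\<close> norm.\<close>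

lemma Dirichlet_integration_by_parts:
  fixes D :: "'a::euclidean_space set"
  assumes D: "open D" "bounded D" and F: "F \<in> L2_space D" "F' \<in> L2_space D" "has_weak_pderiv D b F F'"
    and G: "G \<in> H10_space D" and b: "b \<in> Basis"
  shows "(LINT x|lebesgue_on D. F' x * cnj (G x)) = - (LINT x|lebesgue_on D. F x * cnj (weak_pderiv D b G x))"
proof -
  have H1: "G \<in> H1_space D" using G by (auto simp: H10_space_def)
  note G1 = H1_space_D[OF D(1) H1 b]
  obtain \<phi> where phi: "\<And>m::nat. \<phi> m \<in> test_functions D" and l0: "(\<lambda>m. L2_sq D (\<lambda>x. G x - \<phi> m x)) \<longlonglongrightarrow> 0"
    and l1: "\<And>b. b \<in> Basis \<Longrightarrow> (\<lambda>m. L2_sq D (\<lambda>x. weak_pderiv D b G x - ddir b (\<phi> m) x)) \<longlonglongrightarrow> 0"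
    using H10_approximation[OF D G] by blast
  have Ds: "D \<in> sets lebesgue" using D by simp
  have phiL: "\<phi> m \<in> L2_space D" "ddir b (\<phi> m) \<in> L2_space D" for m
    using test_functions_D(5,6)[OF phi[of m]] Ds D(2) by (auto intro!: L2_space_continuous)
  have "(\<lambda>m. LINT x|lebesgue_on D. F' x * cnj (\<phi> m x)) \<longlonglongrightarrow> (LINT x|lebesgue_on D. F' x * cnj (G x))"
    by (rule L2_limit[OF F(2)]) (use G1 phiL l0 in \<open>auto intro: L2_space_cnj simp: L2_sq_cnj\<close>)
  moreover have "(\<lambda>m. - (LINT x|lebesgue_on D. F x * cnj (ddir b (\<phi> m) x))) \<longlonglongrightarrow> - (LINT x|lebesgue_on D. F x * cnj (weak_pderiv D b G x))"
    by (intro tendsto_minus L2_limit[OF F(1)]) (use G1 phiL l1[OF b] in \<open>auto intro: L2_space_cnj simp: L2_sq_cnj\<close>)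
  moreover have "(LINT x|lebesgue_on D. F' x * cnj (\<phi> m x)) = - (LINT x|lebesgue_on D. F x * cnj (ddir b (\<phi> m) x))" for m
  proof -
    have "(LINT x|lebesgue_on D. F x * ddir b (\<lambda>x. cnj (\<phi> m x)) x) = - (LINT x|lebesgue_on D. F' x * cnj (\<phi> m x))"
      using F(3) test_functions_cnj(1)[OF phi[of m]] by (auto simp: has_weak_pderiv_def)
    moreover have "ddir b (\<lambda>x. cnj (\<phi> m x)) x = cnj (ddir b (\<phi> m) x)" for x
      by (rule fun_cong[OF test_functions_cnj(2)[OF phi[of m]]])
    ultimately show ?thesis by simp
  qed
  ultimately show ?thesis by (simp add: LIMSEQ_unique)
qed

text \<open>Borel representatives turn \<open>H1_imp_L4\<close> into a statement about Lebesgue measurable functions.\<close>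

lemma H1_imp_L4_lebesgue:
  fixes f :: "'a::euclidean_space \<Rightarrow> complex"
  assumes dim: "DIM('a) \<le> 3" and f: "f \<in> L2_space UNIV"
    and G: "\<And>b. b \<in> Basis \<Longrightarrow> G b \<in> L2_space UNIV" "\<And>b. b \<in> Basis \<Longrightarrow> has_weak_pderiv UNIV b f (G b)"
  shows "integrable lebesgue (\<lambda>x. (cmod (f x)) ^ 4)"
proof -
  have rep: "\<exists>h'. h' \<in> borel_measurable borel \<and> (AE x in lebesgue. h x = h' x) \<and> (\<integral>\<^sup>+x. ennreal ((norm (h' x))\<^sup>2) \<partial>lborel) < \<infinity>"
    if "h \<in> L2_space UNIV" for h :: "'a \<Rightarrow> complex"
  proof -
    have h: "h \<in> borel_measurable lebesgue" "integrable lebesgue (\<lambda>x. (cmod (h x))\<^sup>2)"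
      using L2_space_D[OF that] by (auto simp: lebesgue_on_UNIV_eq)
    obtain h' where h': "h' \<in> borel_measurable borel" "AE x in lebesgue. h x = h' x"
      by (rule complex_borel_representative[OF h(1)])
    have "(\<integral>\<^sup>+x. ennreal ((norm (h' x))\<^sup>2) \<partial>lborel) = (\<integral>\<^sup>+x. ennreal ((norm (h' x))\<^sup>2) \<partial>lebesgue)"
      by (simp add: nn_integral_completion)
    also have "\<dots> = (\<integral>\<^sup>+x. ennreal (norm ((cmod (h x))\<^sup>2)) \<partial>lebesgue)"
      by (intro nn_integral_cong_AE) (use h'(2) in \<open>auto elim: eventually_mono\<close>)
    also have "\<dots> < \<infinity>" using h(2) by (simp add: integrable_iff_bounded)
    finally show ?thesis using h' by blast
  qed
  obtain f' where f': "f' \<in> borel_measurable borel" "AE x in lebesgue. f x = f' x" "(\<integral>\<^sup>+x. ennreal ((norm (f' x))\<^sup>2) \<partial>lborel) < \<infinity>"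
    using rep[OF f] by blast
  have "\<forall>b\<in>Basis. \<exists>h'. h' \<in> borel_measurable borel \<and> (AE x in lebesgue. G b x = h' x) \<and> (\<integral>\<^sup>+x. ennreal ((norm (h' x))\<^sup>2) \<partial>lborel) < \<infinity>"
    using rep G(1) by blast
  from bchoice[OF this] obtain G' where G': "\<And>b. b \<in> Basis \<Longrightarrow> G' b \<in> borel_measurable borel \<and>
      (AE x in lebesgue. G b x = G' b x) \<and> (\<integral>\<^sup>+x. ennreal ((norm (G' b x))\<^sup>2) \<partial>lborel) < \<infinity>"
    by blast
  have "(\<integral>\<^sup>+x. ennreal ((norm (f' x)) ^ 4) \<partial>lborel) < \<infinity>"
  proof (rule H1_imp_L4[OF f'(1) _ _ dim f'(3)])
    fix b :: 'a assume b: "b \<in> Basis"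
    show "has_weak_pderiv UNIV b f' (G' b)"
      by (rule has_weak_pderiv_cong_AE[OF open_UNIV G(2)[OF b]]) (use f' G'[OF b] in auto)
  qed (use G' in auto)
  then have "integrable lborel (\<lambda>x. (cmod (f' x)) ^ 4)"
    using f'(1) by (intro integrableI_bounded) auto
  then have i: "integrable lebesgue (\<lambda>x. (cmod (f' x)) ^ 4)"
    using f'(1) by (subst integrable_completion) auto
  have ae: "AE x in lebesgue. (cmod (f' x)) ^ 4 = (cmod (f x)) ^ 4"
    using f'(2) by eventually_elim simp
  have m: "(\<lambda>x. (cmod (f x)) ^ 4) \<in> borel_measurable lebesgue"
    using L2_space_D(1)[OF f] by (simp add: lebesgue_on_UNIV_eq)
  show ?thesis using integrable_cong_AE[OF borel_measurable_integrable[OF i] m ae] i by simp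
qed

text \<open>The extension by zero has the extension of the weak derivative as its weak derivative on the whole
  space. For the approximating test functions this is the classical integration by parts.\<close>

lemma H10_imp_L4:
  fixes D :: "'a::euclidean_space set"
  assumes dim: "DIM('a) \<le> 3" and D: "open D" "bounded D" and f: "f \<in> H10_space D"
  shows "integrable (lebesgue_on D) (\<lambda>x. (cmod (f x)) ^ 4)"
proof -
  have H1: "f \<in> H1_space D" using f by (auto simp: H10_space_def)
  have Ds: "D \<in> sets lebesgue" using D by simp
  obtain \<phi> where phi: "\<And>m::nat. \<phi> m \<in> test_functions D" and l0: "(\<lambda>m. L2_sq D (\<lambda>x. f x - \<phi> m x)) \<longlonglongrightarrow> 0"
    and l1: "\<And>b. b \<in> Basis \<Longrightarrow> (\<lambda>m. L2_sq D (\<lambda>x. weak_pderiv D b f x - ddir b (\<phi> m) x)) \<longlonglongrightarrow> 0"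
    using H10_approximation[OF D f] by blast
  have fL: "f \<in> L2_space D" using H1 by (auto simp: H1_space_def)
  let ?f = "\<lambda>x. indicator D x * f x" and ?G = "\<lambda>b x. indicator D x * weak_pderiv D b f x"
  have ext: "(LINT x|lebesgue. indicator D x * u x * h x) = (LINT x|lebesgue_on D. h x * u x)" for u h :: "'a \<Rightarrow> complex"
    by (subst integral_restrict_space) (use Ds in \<open>auto simp: scaleR_conv_of_real of_real_indicator mult_ac\<close>)
  have "integrable lebesgue (\<lambda>x. (cmod (?f x)) ^ 4)"
  proof (rule H1_imp_L4_lebesgue[OF dim L2_space_extend[OF fL Ds]])
    fix b :: 'a assume b: "b \<in> Basis"
    note f1 = H1_space_D[OF D(1) H1 b]
    show GL: "?G b \<in> L2_space UNIV" by (rule L2_space_extend[OF f1(2) Ds])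
    show "has_weak_pderiv UNIV b ?f (?G b)"
      unfolding has_weak_pderiv_iff[OF open_UNIV]
    proof (intro conjI ballI L2_imp_locally_integrable open_UNIV GL L2_space_extend[OF fL Ds])
      fix \<psi> :: "'a \<Rightarrow> complex" assume psi: "\<psi> \<in> test_functions UNIV"
      have psiL: "\<psi> \<in> L2_space D" "ddir b \<psi> \<in> L2_space D"
        using test_functions_D(5,6)[OF psi] Ds D(2) by (auto intro!: L2_space_continuous)
      have phiL: "\<phi> m \<in> L2_space D" "ddir b (\<phi> m) \<in> L2_space D" for m
        using test_functions_D(5,6)[OF phi[of m]] Ds D(2) by (auto intro!: L2_space_continuous)
      have "(\<lambda>m. LINT x|lebesgue_on D. ddir b \<psi> x * \<phi> m x) \<longlonglongrightarrow> (LINT x|lebesgue_on D. ddir b \<psi> x * f x)"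
        by (rule L2_limit[OF psiL(2) fL phiL(1) l0])
      moreover have "(\<lambda>m. - (LINT x|lebesgue_on D. \<psi> x * ddir b (\<phi> m) x)) \<longlonglongrightarrow> - (LINT x|lebesgue_on D. \<psi> x * weak_pderiv D b f x)"
        by (intro tendsto_minus L2_limit[OF psiL(1) f1(2) phiL(2) l1[OF b]])
      moreover have "(LINT x|lebesgue_on D. ddir b \<psi> x * \<phi> m x) = - (LINT x|lebesgue_on D. \<psi> x * ddir b (\<phi> m) x)" for m
      proof -
        obtain K where K: "compact K" "K \<subseteq> D" "\<And>x. x \<notin> K \<Longrightarrow> \<phi> m x = 0" "\<And>b x. x \<notin> K \<Longrightarrow> ddir b (\<phi> m) x = 0"
          using test_functions_supp[OF phi[of m]] by blast
        have "(LINT x|lebesgue_on D. ddir b \<psi> x * \<phi> m x) = (LINT x|lebesgue. ddir b \<psi> x * \<phi> m x)"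
          by (rule integral_lebesgue_on_supported[OF Ds]) (use K in auto)
        also have "\<dots> = (LINT x|lebesgue. \<phi> m x * ddir b \<psi> x)" by (simp add: mult.commute)
        also have "\<dots> = - (LINT x|lebesgue. ddir b (\<phi> m) x * \<psi> x)"
          by (rule has_weak_pderivD[OF open_UNIV has_weak_pderiv_smooth[OF open_UNIV test_functions_D(1)[OF phi[of m]]] psi])
        also have "(LINT x|lebesgue. ddir b (\<phi> m) x * \<psi> x) = (LINT x|lebesgue_on D. \<psi> x * ddir b (\<phi> m) x)"
          by (subst integral_lebesgue_on_supported[OF Ds]) (use K in \<open>auto simp: mult.commute\<close>)
        finally show ?thesis .
      qed
      ultimately have "(LINT x|lebesgue_on D. ddir b \<psi> x * f x) = - (LINT x|lebesgue_on D. \<psi> x * weak_pderiv D b f x)"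
        by (simp add: LIMSEQ_unique)
      then show "(LINT x|lebesgue. indicator D x * f x * ddir b \<psi> x) = - (LINT x|lebesgue. indicator D x * weak_pderiv D b f x * \<psi> x)"
        by (simp add: ext)
    qed
  qed
  moreover have "(\<lambda>x. (cmod (?f x)) ^ 4) = (\<lambda>x. indicator D x *\<^sub>R (cmod (f x)) ^ 4)"
    by (auto simp: indicator_def)
  ultimately show ?thesis
    using Ds by (subst integrable_restrict_space) auto
qed

section \<open>Weak derivatives of periodic functions\<close>

text \<open>Every compact set, in particular the support of a test function, lies in one of the balls.\<close>

lemma has_weak_pderiv_UNIV_if_balls:
  fixes f g :: "'a::euclidean_space \<Rightarrow> complex"
  assumes "\<And>n::nat. has_weak_pderiv (ball 0 (real n)) b f g"
  shows "has_weak_pderiv UNIV b f g"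
proof -
  have ball: "\<exists>n::nat. K \<subseteq> ball 0 (real n)" if K: "compact K" for K :: "'a set"
  proof -
    obtain r where "K \<subseteq> ball 0 r" using compact_imp_bounded[OF K] bounded_subset_ballD by blast
    moreover obtain n :: nat where "r \<le> real n" using real_arch_simple by blast
    ultimately show ?thesis using subset_ball[of r "real n" 0] by blast
  qed
  show ?thesis unfolding has_weak_pderiv_iff[OF open_UNIV]
  proof (intro conjI ballI)
    have "locally_integrable UNIV u" if u: "\<And>n::nat. locally_integrable (ball 0 (real n)) u" for u :: "'a \<Rightarrow> complex"
      unfolding locally_integrable_def
    proof (intro allI impI)
      fix K :: "'a set" assume K: "compact K \<and> K \<subseteq> UNIV"
      then obtain n :: nat where "K \<subseteq> ball 0 (real n)" using ball by blast
      then show "u absolutely_integrable_on K" using u[of n] K by (simp add: locally_integrable_def)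
    qed
    then show "locally_integrable UNIV f" "locally_integrable UNIV g"
      using assms by (simp_all add: has_weak_pderiv_def)
    fix \<phi> :: "'a \<Rightarrow> complex" assume phi: "\<phi> \<in> test_functions UNIV"
    obtain n :: nat where "closure {x. \<phi> x \<noteq> 0} \<subseteq> ball 0 (real n)"
      using ball test_functions_D(2)[OF phi] by blast
    then have "\<phi> \<in> test_functions (ball 0 (real n))" using phi by (auto simp: test_functions_def)
    then show "(LINT x|lebesgue. f x * ddir b \<phi> x) = - (LINT x|lebesgue. g x * \<phi> x)"
      by (rule has_weak_pderivD[OF open_ball assms])
  qed
qed

text \<open>Weak derivatives on growing balls agree almost everywhere where both are defined, so their
  Borel representatives, extended by zero, stabilise at almost every point and have a limit.\<close>

lemma global_weak_pderiv:
  fixes f :: "'a::euclidean_space \<Rightarrow> complex"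
  assumes "\<And>n::nat. \<exists>g\<in>L2_space (ball 0 (real n)). has_weak_pderiv (ball 0 (real n)) b f g"
  obtains g where "g \<in> borel_measurable borel" "has_weak_pderiv UNIV b f g" "\<And>n::nat. g \<in> L2_space (ball 0 (real n))"
proof -
  define B where "B n = ball (0::'a) (real n)" for n :: nat
  have B: "open (B n)" "B n \<in> sets lebesgue" for n by (auto simp: B_def)
  have "\<forall>n. \<exists>g. g \<in> L2_space (B n) \<and> has_weak_pderiv (B n) b f g"
    using assms unfolding B_def by blast
  from choice[OF this] obtain G where G: "\<And>n. G n \<in> L2_space (B n)" "\<And>n. has_weak_pderiv (B n) b f (G n)"
    by blast
  have "\<exists>h. h \<in> borel_measurable borel \<and> (AE x in lebesgue. indicator (B n) x * G n x = h x)" for n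
  proof -
    have "(\<lambda>x. indicator (B n) x * G n x) \<in> borel_measurable lebesgue"
      using L2_space_D(1)[OF L2_space_extend[OF G(1) B(2)]] by (simp add: lebesgue_on_UNIV_eq)
    then show ?thesis using complex_borel_representative by blast
  qed
  then have "\<forall>n. \<exists>h. h \<in> borel_measurable borel \<and> (AE x in lebesgue. indicator (B n) x * G n x = h x)" by blast
  from choice[OF this] obtain H where H: "\<And>n. H n \<in> borel_measurable borel" "\<And>n. AE x in lebesgue. indicator (B n) x * G n x = H n x"
    by blast
  have sub: "B n \<subseteq> B m" if "n \<le> m" for n m using that by (auto simp: B_def)
  have GG: "AE x in lebesgue. n \<le> m \<longrightarrow> x \<in> B n \<longrightarrow> G m x = G n x" for n m
  proof (cases "n \<le> m")
    case True
    have "has_weak_pderiv (B n) b f (G m)" by (rule has_weak_pderiv_subset[OF B(1) B(1) sub[OF True] G(2)])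
    from weak_pderiv_unique[OF B(1) this G(2)] show ?thesis by eventually_elim simp
  qed simp
  define g where "g x = lim (\<lambda>n. H n x)" for x
  have gm: "g \<in> borel_measurable borel"
    unfolding g_def[abs_def] using H(1) by (rule borel_measurable_lim_metric)
  have a1: "AE x in lebesgue. \<forall>n. indicator (B n) x * G n x = H n x"
    using H(2) by (intro AE_all_countable[THEN iffD2] allI)
  have a2: "AE x in lebesgue. \<forall>n. \<forall>m. n \<le> m \<longrightarrow> x \<in> B n \<longrightarrow> G m x = G n x"
    using GG by (intro AE_all_countable[THEN iffD2] allI)
  have gG: "AE x in lebesgue. x \<in> B n \<longrightarrow> G n x = g x" for n
    using a1 a2
  proof eventually_elim
    case (elim x)
    show ?case
    proof
      assume x: "x \<in> B n"
      have "H m x = G n x" if "n \<le> m" for m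
        using elim x sub[OF that] that by (metis indicator_simps(1) mult_1 subsetD)
      then have "\<forall>\<^sub>F m in sequentially. H m x = G n x" by (auto simp: eventually_sequentially)
      then have "(\<lambda>m. H m x) \<longlonglongrightarrow> G n x" by (rule tendsto_eventually)
      then show "G n x = g x" unfolding g_def by (rule limI[symmetric])
    qed
  qed
  have w: "has_weak_pderiv (B n) b f g" for n
    by (rule has_weak_pderiv_cong_AE[OF B(1) G(2) _ gG]) simp
  have "has_weak_pderiv UNIV b f g"
    using w unfolding B_def by (rule has_weak_pderiv_UNIV_if_balls)
  moreover have "g \<in> L2_space (ball 0 (real n))" for n
    using L2_space_cong_AE(1)[OF G(1) gG B(1)] by (simp add: B_def)
  ultimately show ?thesis using gm that by blast
qed

lemma has_weak_pderiv_shift: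
  fixes f g :: "'a::euclidean_space \<Rightarrow> complex"
  assumes f: "f \<in> borel_measurable borel" and g: "g \<in> borel_measurable borel"
    and w: "has_weak_pderiv UNIV b f g"
  shows "has_weak_pderiv UNIV b (\<lambda>x. f (x + c)) (\<lambda>x. g (x + c))"
  unfolding has_weak_pderiv_iff[OF open_UNIV]
proof (intro conjI ballI locally_integrable_shift f g)
  fix \<phi> :: "'a \<Rightarrow> complex" assume phi: "\<phi> \<in> test_functions UNIV"
  note phi' = test_functions_shift[OF phi, of "- c"]
  note [measurable] = f g
  have [measurable]: "\<phi> \<in> borel_measurable borel" "ddir b \<phi> \<in> borel_measurable borel"
    using test_functions_D[OF phi] by (auto intro: borel_measurable_continuous_onI)
  have d: "ddir b (\<lambda>x. \<phi> (x + - c)) x = ddir b \<phi> (x + - c)" for x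
    by (rule fun_cong[OF ddir_shift]) (rule test_functions_D(4)[OF phi])
  have "(LINT x|lebesgue. f (x + c) * ddir b \<phi> x) = (LINT x|lborel. f (x + c) * ddir b \<phi> x)"
    by (rule integral_completion) measurable
  also have "\<dots> = (LINT x|lborel. f x * ddir b (\<lambda>x. \<phi> (x + - c)) x)"
    using lborel_shift(1)[where f="\<lambda>x. f x * ddir b \<phi> (x + - c)" and v=c] unfolding d by simp
  also have "\<dots> = - (LINT x|lborel. g x * \<phi> (x + - c))"
    by (rule has_weak_pderiv_lborelD[OF f g w phi'])
  also have "(LINT x|lborel. g x * \<phi> (x + - c)) = (LINT x|lborel. g (x + c) * \<phi> x)"
    using lborel_shift(1)[where f="\<lambda>x. g x * \<phi> (x + - c)" and v=c] by simp
  also have "\<dots> = (LINT x|lebesgue. g (x + c) * \<phi> x)"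
    by (rule integral_completion[symmetric]) measurable
  finally show "(LINT x|lebesgue. f (x + c) * ddir b \<phi> x) = - (LINT x|lebesgue. g (x + c) * \<phi> x)" .
qed (use w in \<open>auto simp: has_weak_pderiv_def\<close>)

text \<open>A shift of \<open>f\<close> has the shift of \<open>g\<close> as weak derivative; weak derivatives are unique.\<close>

lemma weak_pderiv_periodic:
  fixes f g :: "'a::euclidean_space \<Rightarrow> complex"
  assumes f: "f \<in> borel_measurable borel" and g: "g \<in> borel_measurable borel"
    and w: "has_weak_pderiv UNIV b f g" and per: "AE x in lborel. f (x + c) = f x"
  shows "AE x in lborel. g (x + c) = g x"
proof -
  note [measurable] = f g
  have "AE x in lebesgue. f (x + c) = f x" using per by (rule AE_completion)
  then have "has_weak_pderiv UNIV b f (\<lambda>x. g (x + c))"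
    by (intro has_weak_pderiv_cong_AE[OF open_UNIV has_weak_pderiv_shift[OF f g w, of c]]) auto
  from weak_pderiv_unique[OF open_UNIV this w]
  have "AE x in lebesgue. g (x + c) = g x" by simp
  then show ?thesis by (subst (asm) AE_lborel_iff_lebesgue) auto
qed

section \<open>Integration by parts for periodic functions\<close>

lemma lebesgue_on_lborel:
  fixes u :: "'a::euclidean_space \<Rightarrow> 'b::{banach, second_countable_topology}"
  assumes [measurable]: "u \<in> borel_measurable borel" "B \<in> sets borel"
  shows "integral\<^sup>L (lebesgue_on B) u = (LINT x|lborel. indicator B x *\<^sub>R u x)"
    "integrable (lebesgue_on B) u \<longleftrightarrow> integrable lborel (\<lambda>x. indicator B x *\<^sub>R u x)"
proof -
  have B: "B \<inter> space lebesgue \<in> sets lebesgue" by simp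
  have "integral\<^sup>L (lebesgue_on B) u = (LINT x|lebesgue. indicator B x *\<^sub>R u x)"
    by (rule integral_restrict_space[OF B])
  also have "\<dots> = (LINT x|lborel. indicator B x *\<^sub>R u x)" by (rule integral_completion) measurable
  finally show "integral\<^sup>L (lebesgue_on B) u = (LINT x|lborel. indicator B x *\<^sub>R u x)" .
  have "integrable (lebesgue_on B) u \<longleftrightarrow> integrable lebesgue (\<lambda>x. indicator B x *\<^sub>R u x)"
    by (rule integrable_restrict_space[OF B])
  also have "\<dots> \<longleftrightarrow> integrable lborel (\<lambda>x. indicator B x *\<^sub>R u x)" by (rule integrable_completion) measurable
  finally show "integrable (lebesgue_on B) u \<longleftrightarrow> integrable lborel (\<lambda>x. indicator B x *\<^sub>R u x)" .
qed

lemma AE_hyperplane: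
  fixes b :: "'a::euclidean_space"
  assumes "b \<in> Basis" shows "AE x in lborel. x \<bullet> b \<noteq> c"
proof -
  have "{x. x \<bullet> b = c} \<in> null_sets lebesgue"
    using negligible_standard_hyperplane[OF assms, of c] by (simp add: negligible_iff_null_sets)
  moreover have "{x. x \<bullet> b = c} \<in> sets lborel"
    using closed_hyperplane[of b c] by (simp add: borel_closed inner_commute)
  ultimately have "{x. x \<bullet> b = c} \<in> null_sets lborel" by (simp add: null_sets_def)
  then show ?thesis by (auto dest: AE_not_in)
qed

abbreviation box_periodic :: "'a::euclidean_space \<Rightarrow> 'a \<Rightarrow> 'a \<Rightarrow> ('a \<Rightarrow> 'b) \<Rightarrow> bool" where
  "box_periodic p q b f \<equiv> (AE x in lborel. f (x + ((q - p) \<bullet> b) *\<^sub>R b) = f x)"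

text \<open>The shifted box is cut at the hyperplane \<open>x \<bullet> b = q \<bullet> b\<close>. One part, \<open>B1\<close>, lies in the original
  box; the other is moved back by one period onto \<open>B2\<close>. Hyperplanes are null sets, so \<open>B1\<close> and
  \<open>B2\<close> together make up the box.\<close>

lemma box_shift_periodic:
  fixes w :: "'a::euclidean_space \<Rightarrow> 'b::{banach, second_countable_topology}"
  assumes w [measurable]: "w \<in> borel_measurable borel" and b: "b \<in> Basis"
    and per: "box_periodic p q b w"
    and s: "0 \<le> s" "s \<le> (q - p) \<bullet> b" and i: "integrable (lebesgue_on (box p q)) w"
  shows "integrable (lebesgue_on (box p q)) (\<lambda>x. w (x + s *\<^sub>R b))"
    "(LINT x|lebesgue_on (box p q). w (x + s *\<^sub>R b)) = (LINT x|lebesgue_on (box p q). w x)"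
proof -
  define L where "L = (q - p) \<bullet> b"
  define B1 where "B1 = {x \<in> box p q. p \<bullet> b + s < x \<bullet> b}"
  define B2 where "B2 = {x \<in> box p q. x \<bullet> b < p \<bullet> b + s}"
  have [measurable]: "B1 \<in> sets borel" "B2 \<in> sets borel" unfolding B1_def B2_def by measurable
  have i': "integrable lborel (\<lambda>x. indicator (box p q) x *\<^sub>R w x)"
    using i by (subst (asm) lebesgue_on_lborel) auto
  have i1: "integrable lborel (\<lambda>x. indicator B1 x *\<^sub>R w x)" and i2: "integrable lborel (\<lambda>x. indicator B2 x *\<^sub>R w x)"
  proof -
    have "(\<lambda>x. indicator B1 x *\<^sub>R w x) = (\<lambda>x. indicator B1 x *\<^sub>R (indicator (box p q) x *\<^sub>R w x))"
      by (auto simp: B1_def indicator_def fun_eq_iff)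
    then show "integrable lborel (\<lambda>x. indicator B1 x *\<^sub>R w x)"
      using integrable_mult_indicator[OF _ i', of B1] by simp
    have "(\<lambda>x. indicator B2 x *\<^sub>R w x) = (\<lambda>x. indicator B2 x *\<^sub>R (indicator (box p q) x *\<^sub>R w x))"
      by (auto simp: B2_def indicator_def fun_eq_iff)
    then show "integrable lborel (\<lambda>x. indicator B2 x *\<^sub>R w x)"
      using integrable_mult_indicator[OF _ i', of B2] by simp
  qed
  have ind: "indicator (box p q) (x - s *\<^sub>R b) = (indicator B1 x + indicator B2 (x - L *\<^sub>R b) :: real)" if "x \<bullet> b \<noteq> q \<bullet> b" for x
  proof -
    define P where "P \<longleftrightarrow> (\<forall>i\<in>Basis - {b}. p \<bullet> i < x \<bullet> i \<and> x \<bullet> i < q \<bullet> i)"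
    have box: "x - r *\<^sub>R b \<in> box p q \<longleftrightarrow> P \<and> p \<bullet> b < x \<bullet> b - r \<and> x \<bullet> b - r < q \<bullet> b" for r
    proof -
      have "(x - r *\<^sub>R b) \<bullet> i = x \<bullet> i" if "i \<in> Basis - {b}" for i
        using that b by (auto simp: inner_diff_left inner_Basis)
      moreover have "(x - r *\<^sub>R b) \<bullet> b = x \<bullet> b - r" using b by (simp add: inner_diff_left)
      ultimately show ?thesis using b unfolding P_def mem_box by (metis DiffD1 DiffI singletonD)
    qed
    have Lb: "(x - L *\<^sub>R b) \<bullet> b = x \<bullet> b - L" using b by (simp add: inner_diff_left)
    have 1: "x \<in> B1 \<longleftrightarrow> P \<and> p \<bullet> b < x \<bullet> b \<and> x \<bullet> b < q \<bullet> b \<and> p \<bullet> b + s < x \<bullet> b"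
      using box[of 0] by (auto simp: B1_def)
    have 2: "x - L *\<^sub>R b \<in> B2 \<longleftrightarrow> P \<and> p \<bullet> b < x \<bullet> b - L \<and> x \<bullet> b - L < q \<bullet> b \<and> x \<bullet> b - L < p \<bullet> b + s"
      using box[of L] by (auto simp: B2_def Lb)
    have L: "L = q \<bullet> b - p \<bullet> b" by (simp add: L_def inner_diff_left)
    have sL: "0 \<le> s" "s \<le> L" using s by (auto simp: L_def)
    show ?thesis
    proof (cases "x \<bullet> b < q \<bullet> b")
      case True
      then have "x - L *\<^sub>R b \<notin> B2" unfolding 2 using L by linarith
      moreover have "x - s *\<^sub>R b \<in> box p q \<longleftrightarrow> x \<in> B1" unfolding 1 box using sL True by auto
      ultimately show ?thesis by (simp add: indicator_def)
    next
      case False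
      then have "q \<bullet> b < x \<bullet> b" using that by linarith
      then have "x - s *\<^sub>R b \<in> box p q \<longleftrightarrow> x - L *\<^sub>R b \<in> B2" unfolding 2 box using sL L by auto
      moreover have "x \<notin> B1" unfolding 1 using False by auto
      ultimately show ?thesis by (simp add: indicator_def)
    qed
  qed
  have i2': "integrable lborel (\<lambda>x. indicator B2 (x - L *\<^sub>R b) *\<^sub>R w x)"
    and e2: "(LINT x|lborel. indicator B2 (x - L *\<^sub>R b) *\<^sub>R w x) = (LINT x|lborel. indicator B2 x *\<^sub>R w x)"
  proof -
    have "AE x in lborel. indicator B2 x *\<^sub>R w (x + L *\<^sub>R b) = indicator B2 x *\<^sub>R w x"
      using per by eventually_elim (simp add: L_def)
    note ae = this
    have "integrable lborel (\<lambda>x. indicator B2 x *\<^sub>R w (x + L *\<^sub>R b))"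
      by (rule integrable_cong_AE_imp[OF i2]) (use ae in \<open>auto elim: eventually_mono\<close>)
    moreover have e: "(LINT x|lborel. indicator B2 x *\<^sub>R w (x + L *\<^sub>R b)) = (LINT x|lborel. indicator B2 x *\<^sub>R w x)"
      by (rule integral_cong_AE[OF _ _ ae]) measurable
    ultimately show "integrable lborel (\<lambda>x. indicator B2 (x - L *\<^sub>R b) *\<^sub>R w x)"
      using lborel_shift(2)[where f="\<lambda>x. indicator B2 (x - L *\<^sub>R b) *\<^sub>R w x" and v="L *\<^sub>R b"] by simp
    show "(LINT x|lborel. indicator B2 (x - L *\<^sub>R b) *\<^sub>R w x) = (LINT x|lborel. indicator B2 x *\<^sub>R w x)"
      using lborel_shift(1)[where f="\<lambda>x. indicator B2 (x - L *\<^sub>R b) *\<^sub>R w x" and v="L *\<^sub>R b"] e by simp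
  qed
  have ae: "AE x in lborel. indicator B1 x *\<^sub>R w x + indicator B2 (x - L *\<^sub>R b) *\<^sub>R w x = indicator (box p q) (x - s *\<^sub>R b) *\<^sub>R w x"
    using AE_hyperplane[OF b, of "q \<bullet> b"] by eventually_elim (simp add: ind scaleR_add_left)
  have "integrable lborel (\<lambda>x. indicator (box p q) (x - s *\<^sub>R b) *\<^sub>R w x)"
    by (rule integrable_cong_AE_imp[OF Bochner_Integration.integrable_add[OF i1 i2'] _ ae]) measurable
  then have "integrable lborel (\<lambda>x. indicator (box p q) x *\<^sub>R w (x + s *\<^sub>R b))"
    using lborel_shift(2)[where f="\<lambda>x. indicator (box p q) (x - s *\<^sub>R b) *\<^sub>R w x" and v="s *\<^sub>R b"] by simp
  then show "integrable (lebesgue_on (box p q)) (\<lambda>x. w (x + s *\<^sub>R b))"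
    by (subst lebesgue_on_lborel) auto
  have "(LINT x|lebesgue_on (box p q). w (x + s *\<^sub>R b)) = (LINT x|lborel. indicator (box p q) x *\<^sub>R w (x + s *\<^sub>R b))"
    by (rule lebesgue_on_lborel) auto
  also have "\<dots> = (LINT x|lborel. indicator (box p q) (x - s *\<^sub>R b) *\<^sub>R w x)"
    using lborel_shift(1)[where f="\<lambda>x. indicator (box p q) (x - s *\<^sub>R b) *\<^sub>R w x" and v="s *\<^sub>R b"] by simp
  also have "\<dots> = (LINT x|lborel. indicator B1 x *\<^sub>R w x + indicator B2 (x - L *\<^sub>R b) *\<^sub>R w x)"
    by (rule integral_cong_AE) (use ae in \<open>auto elim: eventually_mono\<close>)
  also have "\<dots> = (LINT x|lborel. indicator B1 x *\<^sub>R w x) + (LINT x|lborel. indicator B2 x *\<^sub>R w x)"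
    using i1 i2' e2 by simp
  also have "\<dots> = (LINT x|lborel. indicator B1 x *\<^sub>R w x + indicator B2 x *\<^sub>R w x)"
    using i1 i2 by simp
  also have "\<dots> = (LINT x|lborel. indicator (box p q) x *\<^sub>R w x)"
  proof (rule integral_cong_AE)
    show "AE x in lborel. indicator B1 x *\<^sub>R w x + indicator B2 x *\<^sub>R w x = indicator (box p q) x *\<^sub>R w x"
      using AE_hyperplane[OF b, of "p \<bullet> b + s"] by eventually_elim (auto simp: B1_def B2_def indicator_def)
  qed measurable
  also have "\<dots> = (LINT x|lebesgue_on (box p q). w x)"
    by (rule lebesgue_on_lborel[symmetric]) auto
  finally show "(LINT x|lebesgue_on (box p q). w (x + s *\<^sub>R b)) = (LINT x|lebesgue_on (box p q). w x)" .
qed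

definition periodic_L2 :: "'a::euclidean_space \<Rightarrow> 'a \<Rightarrow> 'a \<Rightarrow> ('a \<Rightarrow> complex) \<Rightarrow> bool" where
  "periodic_L2 p q b f \<longleftrightarrow> f \<in> borel_measurable borel \<and> box_periodic p q b f \<and> f \<in> L2_space (box p q)"

definition periodic_pderiv :: "'a::euclidean_space \<Rightarrow> 'a \<Rightarrow> 'a \<Rightarrow> ('a \<Rightarrow> complex) \<Rightarrow> ('a \<Rightarrow> complex) \<Rightarrow> bool" where
  "periodic_pderiv p q b f f' \<longleftrightarrow> periodic_L2 p q b f \<and> periodic_L2 p q b f' \<and> has_weak_pderiv UNIV b f f'"

lemma L2_space_box_shift:
  fixes f :: "'a::euclidean_space \<Rightarrow> complex"
  assumes f: "periodic_L2 p q b f" and b: "b \<in> Basis" and s: "0 \<le> s" "s \<le> (q - p) \<bullet> b"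
  shows "(\<lambda>x. f (x + s *\<^sub>R b)) \<in> L2_space (box p q)" "L2_sq (box p q) (\<lambda>x. f (x + s *\<^sub>R b)) = L2_sq (box p q) f"
proof -
  have fm [measurable]: "f \<in> borel_measurable borel" and fL: "f \<in> L2_space (box p q)" and per: "box_periodic p q b f"
    using f by (auto simp: periodic_L2_def)
  have "box_periodic p q b (\<lambda>x. (cmod (f x))\<^sup>2)" using per by eventually_elim simp
  note sh = box_shift_periodic[OF _ b this s L2_space_D(2)[OF fL]]
  show "L2_sq (box p q) (\<lambda>x. f (x + s *\<^sub>R b)) = L2_sq (box p q) f" by (rule sh(2)) measurable
  have "(\<lambda>x. f (x + s *\<^sub>R b)) \<in> borel_measurable lebesgue" by (rule measurable_completion) measurable
  then have "(\<lambda>x. f (x + s *\<^sub>R b)) \<in> borel_measurable (lebesgue_on (box p q))" by (rule measurable_restrict_space1)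
  then show "(\<lambda>x. f (x + s *\<^sub>R b)) \<in> L2_space (box p q)"
    unfolding L2_space_def using sh(1) by auto
qed

lemma integral_mult_box_shift:
  fixes u w :: "'a::euclidean_space \<Rightarrow> complex"
  assumes u: "periodic_L2 p q b u" and w: "periodic_L2 p q b w" and b: "b \<in> Basis" and s: "0 \<le> s" "s \<le> (q - p) \<bullet> b"
  shows "(LINT x|lebesgue_on (box p q). u (x + s *\<^sub>R b) * w (x + s *\<^sub>R b)) = (LINT x|lebesgue_on (box p q). u x * w x)"
proof (rule box_shift_periodic(2)[where w="\<lambda>x. u x * w x", OF _ b _ s])
  have "box_periodic p q b u" "box_periodic p q b w" using u w by (auto simp: periodic_L2_def)
  then show "box_periodic p q b (\<lambda>x. u x * w x)" by eventually_elim simp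
qed (use u w in \<open>auto simp: periodic_L2_def intro: L2_space_integrable_mult\<close>)

lemma has_weak_pderiv_scale:
  assumes w: "has_weak_pderiv UNIV b f g"
  shows "has_weak_pderiv UNIV (s *\<^sub>R b) f (\<lambda>x. of_real s * g x)"
  unfolding has_weak_pderiv_iff[OF open_UNIV]
proof (intro conjI ballI)
  have l: "locally_integrable UNIV f" "locally_integrable UNIV g" using w by (auto simp: has_weak_pderiv_def)
  show "locally_integrable UNIV f" by fact
  show "locally_integrable UNIV (\<lambda>x. of_real s * g x)"
    using locally_integrable_lincomb[OF l(2) l(2), of "of_real s" 0] by simp
  fix \<phi> :: "'a \<Rightarrow> complex" assume phi: "\<phi> \<in> test_functions UNIV"
  have "ddir (s *\<^sub>R b) \<phi> x = of_real s * ddir b \<phi> x" for x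
    using linear_scale[OF linear_frechet_derivative[OF test_functions_D(4)[OF phi, of x]], of s b]
    by (simp add: scaleR_conv_of_real)
  then have "(LINT x|lebesgue. f x * ddir (s *\<^sub>R b) \<phi> x) = of_real s * (LINT x|lebesgue. f x * ddir b \<phi> x)"
    by (simp add: mult.left_commute)
  also have "\<dots> = - (LINT x|lebesgue. of_real s * g x * \<phi> x)"
    using has_weak_pderivD[OF open_UNIV w phi] by (simp add: mult.assoc)
  finally show "(LINT x|lebesgue. f x * ddir (s *\<^sub>R b) \<phi> x) = - (LINT x|lebesgue. of_real s * g x * \<phi> x)" .
qed

text \<open>The average along the segment commutes with the integral over the box, and by periodicity every
  shift of \<open>g'\<close> has the same norm on the box.\<close>

lemma periodic_shift_difference:
  fixes g g' :: "'a::euclidean_space \<Rightarrow> complex"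
  assumes gg': "periodic_pderiv p q b g g'" and b: "b \<in> Basis" and s: "0 \<le> s" "s \<le> (q - p) \<bullet> b"
  shows "L2_sq (box p q) (\<lambda>x. g (x + s *\<^sub>R b) - g x) \<le> s\<^sup>2 * L2_sq (box p q) g'"
proof -
  let ?B = "box p q"
  have g [measurable]: "g \<in> borel_measurable borel" and g' [measurable]: "g' \<in> borel_measurable borel"
    and w: "has_weak_pderiv UNIV b g g'" and L: "g \<in> L2_space ?B"
    using gg' by (auto simp: periodic_pderiv_def periodic_L2_def)
  have pg: "periodic_L2 p q b g" "periodic_L2 p q b g'" using gg' by (auto simp: periodic_pderiv_def)
  have nn: "(\<integral>\<^sup>+x. indicator ?B x * ennreal ((cmod (h x))\<^sup>2) \<partial>lborel) = ennreal (L2_sq ?B h)"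
    if h [measurable]: "h \<in> borel_measurable borel" and hL: "h \<in> L2_space ?B" for h
  proof -
    have i: "integrable lborel (\<lambda>x. indicator ?B x *\<^sub>R (cmod (h x))\<^sup>2)"
      using L2_space_D(2)[OF hL] by (subst (asm) lebesgue_on_lborel) auto
    have "(\<integral>\<^sup>+x. indicator ?B x * ennreal ((cmod (h x))\<^sup>2) \<partial>lborel) = (\<integral>\<^sup>+x. ennreal (indicator ?B x *\<^sub>R (cmod (h x))\<^sup>2) \<partial>lborel)"
      by (intro nn_integral_cong) (auto simp: indicator_def)
    also have "\<dots> = ennreal (LINT x|lborel. indicator ?B x *\<^sub>R (cmod (h x))\<^sup>2)"
      by (rule nn_integral_eq_integral[OF i]) auto
    also have "(LINT x|lborel. indicator ?B x *\<^sub>R (cmod (h x))\<^sup>2) = L2_sq ?B h"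
      by (rule lebesgue_on_lborel(1)[symmetric]) auto
    finally show ?thesis .
  qed
  have "ennreal (L2_sq ?B (\<lambda>x. g (x + s *\<^sub>R b) - g x)) = (\<integral>\<^sup>+x. indicator ?B x * ennreal ((cmod (g (x + s *\<^sub>R b) - g x))\<^sup>2) \<partial>lborel)"
    by (rule nn[symmetric]) (use L2_space_diff[OF L2_space_box_shift(1)[OF pg(1) b s] L] in auto)
  also have "\<dots> \<le> (\<integral>\<^sup>+x. indicator ?B x * (\<integral>\<^sup>+t. indicator {0..1::real} t * ennreal ((cmod (of_real s * g' (x + t *\<^sub>R (s *\<^sub>R b))))\<^sup>2) \<partial>lborel) \<partial>lborel)"
  proof (rule nn_integral_mono_AE)
    have "AE x in lborel. ennreal ((cmod (g (x + s *\<^sub>R b) - g x))\<^sup>2) \<le> (\<integral>\<^sup>+t. indicator {0..1::real} t * ennreal ((cmod (of_real s * g' (x + t *\<^sub>R (s *\<^sub>R b))))\<^sup>2) \<partial>lborel)"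
      by (rule weak_pderiv_difference_square[OF g _ has_weak_pderiv_scale[OF w]]) measurable
    then show "AE x in lborel. indicator ?B x * ennreal ((cmod (g (x + s *\<^sub>R b) - g x))\<^sup>2) \<le> indicator ?B x * (\<integral>\<^sup>+t. indicator {0..1::real} t * ennreal ((cmod (of_real s * g' (x + t *\<^sub>R (s *\<^sub>R b))))\<^sup>2) \<partial>lborel)"
      by eventually_elim (intro mult_left_mono; simp)
  qed
  also have "\<dots> = (\<integral>\<^sup>+x. (\<integral>\<^sup>+t. indicator ?B x * (indicator {0..1::real} t * ennreal ((cmod (of_real s * g' (x + t *\<^sub>R (s *\<^sub>R b))))\<^sup>2)) \<partial>lborel) \<partial>lborel)"
    by (intro nn_integral_cong nn_integral_cmult[symmetric]) measurable
  also have "\<dots> = (\<integral>\<^sup>+t. (\<integral>\<^sup>+x. indicator ?B x * (indicator {0..1::real} t * ennreal ((cmod (of_real s * g' (x + t *\<^sub>R (s *\<^sub>R b))))\<^sup>2)) \<partial>lborel) \<partial>lborel)"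
    by (rule lborel_pair.Fubini') measurable
  also have "\<dots> = (\<integral>\<^sup>+t. ennreal (s\<^sup>2 * L2_sq ?B g') * indicator {0..1::real} t \<partial>lborel)"
  proof (rule nn_integral_cong)
    fix t :: real
    show "(\<integral>\<^sup>+x. indicator ?B x * (indicator {0..1::real} t * ennreal ((cmod (of_real s * g' (x + t *\<^sub>R (s *\<^sub>R b))))\<^sup>2)) \<partial>lborel) =
      ennreal (s\<^sup>2 * L2_sq ?B g') * indicator {0..1::real} t"
    proof (cases "t \<in> {0..1}")
      case True
      have ts: "0 \<le> t * s" "t * s \<le> (q - p) \<bullet> b"
        using True s mult_left_le_one_le[of s t] by auto
      note sh = L2_space_box_shift[OF pg(2) b ts]
      have "(\<integral>\<^sup>+x. indicator ?B x * (indicator {0..1::real} t * ennreal ((cmod (of_real s * g' (x + t *\<^sub>R (s *\<^sub>R b))))\<^sup>2)) \<partial>lborel) =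
         (\<integral>\<^sup>+x. ennreal (s\<^sup>2) * (indicator ?B x * ennreal ((cmod (g' (x + (t * s) *\<^sub>R b)))\<^sup>2)) \<partial>lborel)"
        using True by (intro nn_integral_cong) (auto simp: norm_mult power_mult_distrib ennreal_mult mult_ac)
      also have "\<dots> = ennreal (s\<^sup>2) * (\<integral>\<^sup>+x. indicator ?B x * ennreal ((cmod (g' (x + (t * s) *\<^sub>R b)))\<^sup>2) \<partial>lborel)"
        by (rule nn_integral_cmult) measurable
      also have "\<dots> = ennreal (s\<^sup>2) * ennreal (L2_sq ?B g')"
        by (subst nn[where h="\<lambda>x. g' (x + (t * s) *\<^sub>R b)"]) (use sh in auto)
      finally show ?thesis using True by (simp add: ennreal_mult L2_sq_nonneg)
    qed simp
  qed
  also have "\<dots> = ennreal (s\<^sup>2 * L2_sq ?B g')"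
    by (simp add: nn_integral_cmult_indicator)
  finally show ?thesis by (simp add: L2_sq_nonneg)
qed

lemma Fubini_periodic_segment:
  fixes h f' :: "'a::euclidean_space \<Rightarrow> complex"
  assumes h [measurable]: "h \<in> borel_measurable borel" and hL: "h \<in> L2_space (box p q)"
    and f: "periodic_L2 p q b f'" and b: "b \<in> Basis" and s: "0 \<le> s" "s \<le> (q - p) \<bullet> b"
  shows "integrable lborel (\<lambda>t. indicator {0..1::real} t *\<^sub>R (LINT x|lebesgue_on (box p q). h x * f' (x + t *\<^sub>R (s *\<^sub>R b))))"
    "integrable (lebesgue_on (box p q)) (\<lambda>x. h x * unit_integral (\<lambda>t. f' (x + t *\<^sub>R (s *\<^sub>R b))))"
    "(LINT x|lebesgue_on (box p q). h x * unit_integral (\<lambda>t. f' (x + t *\<^sub>R (s *\<^sub>R b)))) =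
     unit_integral (\<lambda>t. LINT x|lebesgue_on (box p q). h x * f' (x + t *\<^sub>R (s *\<^sub>R b)))"
proof -
  let ?B = "box p q"
  have f' [measurable]: "f' \<in> borel_measurable borel" using f by (simp add: periodic_L2_def)
  let ?u = "\<lambda>x. indicator ?B x *\<^sub>R h x"
  have on_box: "(LINT x|lebesgue_on ?B. h x * w x) = (LINT x|lborel. ?u x * w x)"
    "integrable (lebesgue_on ?B) (\<lambda>x. h x * w x) \<longleftrightarrow> integrable lborel (\<lambda>x. ?u x * w x)"
    if [measurable]: "w \<in> borel_measurable borel" for w
    by (simp_all add: lebesgue_on_lborel)
  have int: "integrable (lborel \<Otimes>\<^sub>M lborel) (\<lambda>(x, t). indicator {0..1::real} t *\<^sub>R (?u x * f' (x + t *\<^sub>R (s *\<^sub>R b))))"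
  proof (rule integrable_pair_segment)
    fix t :: real assume t: "t \<in> {0..1}"
    have ts: "0 \<le> t * s" "t * s \<le> (q - p) \<bullet> b"
      using t s mult_left_le_one_le[of s t] by auto
    note sh = L2_space_box_shift[OF f b ts]
    have i: "integrable (lebesgue_on ?B) (\<lambda>x. (cmod (h x))\<^sup>2 + (cmod (f' (x + t *\<^sub>R (s *\<^sub>R b))))\<^sup>2)"
      using L2_space_D(2)[OF hL] L2_space_D(2)[OF sh(1)] by simp
    have "(\<integral>\<^sup>+x. ennreal (norm (?u x * f' (x + t *\<^sub>R (s *\<^sub>R b)))) \<partial>lborel) \<le>
        (\<integral>\<^sup>+x. ennreal (indicator ?B x *\<^sub>R ((cmod (h x))\<^sup>2 + (cmod (f' (x + t *\<^sub>R (s *\<^sub>R b))))\<^sup>2)) \<partial>lborel)"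
    proof (intro nn_integral_mono ennreal_leI)
      fix x
      show "norm (?u x * f' (x + t *\<^sub>R (s *\<^sub>R b))) \<le> indicator ?B x *\<^sub>R ((cmod (h x))\<^sup>2 + (cmod (f' (x + t *\<^sub>R (s *\<^sub>R b))))\<^sup>2)"
        using cmod_mult_le_squares[of "h x"] by (auto simp: indicator_def norm_mult)
    qed
    also have "\<dots> = ennreal (LINT x|lborel. indicator ?B x *\<^sub>R ((cmod (h x))\<^sup>2 + (cmod (f' (x + t *\<^sub>R (s *\<^sub>R b))))\<^sup>2))"
      using i by (intro nn_integral_eq_integral) (auto simp: lebesgue_on_lborel)
    also have "(LINT x|lborel. indicator ?B x *\<^sub>R ((cmod (h x))\<^sup>2 + (cmod (f' (x + t *\<^sub>R (s *\<^sub>R b))))\<^sup>2)) =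
        (LINT x|lebesgue_on ?B. (cmod (h x))\<^sup>2 + (cmod (f' (x + t *\<^sub>R (s *\<^sub>R b))))\<^sup>2)"
      by (rule lebesgue_on_lborel(1)[symmetric]) measurable
    also have "\<dots> = L2_sq ?B h + L2_sq ?B f'"
      using L2_space_D(2)[OF hL] L2_space_D(2)[OF sh(1)] sh(2) by simp
    finally show "(\<integral>\<^sup>+x. ennreal (norm (?u x * f' (x + t *\<^sub>R (s *\<^sub>R b)))) \<partial>lborel) \<le> ennreal (L2_sq ?B h + L2_sq ?B f')" .
  qed auto
  have m: "(\<lambda>x. f' (x + t *\<^sub>R (s *\<^sub>R b))) \<in> borel_measurable borel" for t by measurable
  have mi: "(\<lambda>x. unit_integral (\<lambda>t. f' (x + t *\<^sub>R (s *\<^sub>R b)))) \<in> borel_measurable borel" by measurable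
  show "integrable lborel (\<lambda>t. indicator {0..1::real} t *\<^sub>R (LINT x|lebesgue_on ?B. h x * f' (x + t *\<^sub>R (s *\<^sub>R b))))"
    unfolding on_box(1)[OF m] by (rule Fubini_segment(1)[OF int])
  show "integrable (lebesgue_on ?B) (\<lambda>x. h x * unit_integral (\<lambda>t. f' (x + t *\<^sub>R (s *\<^sub>R b))))"
    unfolding on_box(2)[OF mi] by (rule Fubini_segment(2)[OF int])
  show "(LINT x|lebesgue_on ?B. h x * unit_integral (\<lambda>t. f' (x + t *\<^sub>R (s *\<^sub>R b)))) =
     unit_integral (\<lambda>t. LINT x|lebesgue_on ?B. h x * f' (x + t *\<^sub>R (s *\<^sub>R b)))"
    unfolding on_box(1)[OF m] on_box(1)[OF mi] by (rule Fubini_segment(3)[OF int])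
qed

lemma cmod_integral_mult_le:
  assumes "u \<in> L2_space D" "w \<in> L2_space D"
  shows "cmod (LINT x|lebesgue_on D. u x * w x) \<le> sqrt (L2_sq D u) * sqrt (L2_sq D w)"
  using L2_Cauchy_Schwarz[OF assms] by (simp add: real_le_rsqrt flip: real_sqrt_mult)

text \<open>The difference formula writes the increment of \<open>w\<close> as \<open>s\<close> times the average of \<open>w'\<close> along the
  segment. Undoing the shift of \<open>w'\<close> by \<open>t s b\<close> moves it onto \<open>u\<close> by periodicity, and shifts of \<open>u\<close> are
  Lipschitz continuous in \<open>L\<^sup>2\<close>.\<close>

lemma periodic_increment_first_order:
  fixes u u' w w' :: "'a::euclidean_space \<Rightarrow> complex"
  assumes uu: "periodic_pderiv p q b u u'" and ww: "periodic_pderiv p q b w w'" and b: "b \<in> Basis"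
    and s: "0 < s" "s \<le> (q - p) \<bullet> b"
  shows "cmod ((LINT x|lebesgue_on (box p q). u x * (w (x + s *\<^sub>R b) - w x)) - of_real s * (LINT x|lebesgue_on (box p q). u x * w' x))
    \<le> s\<^sup>2 * (sqrt (L2_sq (box p q) u') * sqrt (L2_sq (box p q) w'))"
proof -
  let ?B = "box p q" and ?v = "s *\<^sub>R b"
  define M where "M = sqrt (L2_sq ?B u') * sqrt (L2_sq ?B w')"
  define K where "K = (LINT x|lebesgue_on ?B. u x * w' x)"
  define c where "c t = (LINT x|lebesgue_on ?B. u x * w' (x + t *\<^sub>R ?v))" for t
  have pu: "periodic_L2 p q b u" and pw: "periodic_L2 p q b w" and pw': "periodic_L2 p q b w'"
    and wd: "has_weak_pderiv UNIV b w w'" using uu ww by (auto simp: periodic_pderiv_def)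
  have m [measurable]: "u \<in> borel_measurable borel" "w \<in> borel_measurable borel" "w' \<in> borel_measurable borel"
    and L: "u \<in> L2_space ?B" "w \<in> L2_space ?B" "w' \<in> L2_space ?B" using pu pw pw' by (auto simp: periodic_L2_def)
  have s': "0 \<le> s" using s by simp
  note F = Fubini_periodic_segment[OF m(1) L(1) pw' b s' s(2), folded c_def]
  have wv: "(\<lambda>x. w (x + ?v)) \<in> L2_space ?B" by (rule L2_space_box_shift(1)[OF pw b s' s(2)])
  have "AE x in lborel. w (x + ?v) - w x = unit_integral (\<lambda>t. of_real s * w' (x + t *\<^sub>R ?v))"
    by (rule weak_pderiv_difference[OF _ _ has_weak_pderiv_scale[OF wd]]) measurable
  then have "AE x in lborel. w (x + ?v) - w x = of_real s * unit_integral (\<lambda>t. w' (x + t *\<^sub>R ?v))"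
    by (simp flip: mult_scaleR_right)
  then have "AE x in lebesgue. w (x + ?v) - w x = of_real s * unit_integral (\<lambda>t. w' (x + t *\<^sub>R ?v))"
    by (rule AE_completion)
  then have ae: "AE x in lebesgue_on ?B. w (x + ?v) - w x = of_real s * unit_integral (\<lambda>t. w' (x + t *\<^sub>R ?v))"
    by (subst AE_lebesgue_on_iff) (auto elim: eventually_mono)
  have "(LINT x|lebesgue_on ?B. u x * (w (x + ?v) - w x)) =
      (LINT x|lebesgue_on ?B. of_real s * (u x * unit_integral (\<lambda>t. w' (x + t *\<^sub>R ?v))))"
  proof (rule integral_cong_AE)
    show "AE x in lebesgue_on ?B. u x * (w (x + ?v) - w x) = of_real s * (u x * unit_integral (\<lambda>t. w' (x + t *\<^sub>R ?v)))"
      using ae by eventually_elim (simp only: mult.left_commute)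
  qed (intro borel_measurable_integrable integrable_mult_right F(2) L2_space_integrable_mult wv L2_space_diff L)+
  also have "\<dots> = of_real s * (LINT x|lebesgue_on ?B. u x * unit_integral (\<lambda>t. w' (x + t *\<^sub>R ?v)))" by simp
  also have "\<dots> = of_real s * unit_integral c" unfolding F(3) ..
  finally have inc: "(LINT x|lebesgue_on ?B. u x * (w (x + ?v) - w x)) = of_real s * unit_integral c" .
  have bound: "cmod (c t - K) \<le> s * M" if t: "t \<in> {0..1}" for t
  proof -
    have r: "0 \<le> t * s" "t * s \<le> s" using t s by (auto simp: mult_left_le_one_le)
    have ts: "t * s \<le> (q - p) \<bullet> b" using r s by linarith
    have tv: "t *\<^sub>R ?v = (t * s) *\<^sub>R b" by simp
    note w't = L2_space_box_shift[OF pw' b r(1) ts, folded tv] and ut = L2_space_box_shift(1)[OF pu b r(1) ts, folded tv]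
    have "L2_sq ?B (\<lambda>x. u x - u (x + t *\<^sub>R ?v)) = L2_sq ?B (\<lambda>x. u (x + (t * s) *\<^sub>R b) - u x)"
      by (simp add: norm_minus_commute)
    also have "\<dots> \<le> (t * s)\<^sup>2 * L2_sq ?B u'" by (rule periodic_shift_difference[OF uu b r(1) ts])
    also have "\<dots> \<le> s\<^sup>2 * L2_sq ?B u'" using r by (intro mult_right_mono power_mono L2_sq_nonneg) auto
    finally have du: "sqrt (L2_sq ?B (\<lambda>x. u x - u (x + t *\<^sub>R ?v))) \<le> s * sqrt (L2_sq ?B u')"
      using s by (intro real_le_lsqrt) (auto simp: power_mult_distrib L2_sq_nonneg)
    have "K = (LINT x|lebesgue_on ?B. u (x + t *\<^sub>R ?v) * w' (x + t *\<^sub>R ?v))"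
      unfolding K_def tv by (rule integral_mult_box_shift[OF pu pw' b r(1) ts, symmetric])
    then have "c t - K = (LINT x|lebesgue_on ?B. u x * w' (x + t *\<^sub>R ?v) - u (x + t *\<^sub>R ?v) * w' (x + t *\<^sub>R ?v))"
      unfolding c_def by (simp only: Bochner_Integration.integral_diff[OF L2_space_integrable_mult[OF L(1) w't(1)] L2_space_integrable_mult[OF ut w't(1)]])
    also have "\<dots> = (LINT x|lebesgue_on ?B. (u x - u (x + t *\<^sub>R ?v)) * w' (x + t *\<^sub>R ?v))"
      by (simp add: algebra_simps)
    finally have "cmod (c t - K) \<le> sqrt (L2_sq ?B (\<lambda>x. u x - u (x + t *\<^sub>R ?v))) * sqrt (L2_sq ?B w')"
      using cmod_integral_mult_le[OF L2_space_diff[OF L(1) ut] w't(1)] by (simp only: w't(2))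
    also have "\<dots> \<le> (s * sqrt (L2_sq ?B u')) * sqrt (L2_sq ?B w')"
      by (intro mult_right_mono du) (simp add: L2_sq_nonneg)
    finally show ?thesis by (simp add: M_def mult_ac)
  qed
  have iK: "integrable lborel (\<lambda>t. indicator {0..1::real} t *\<^sub>R K)" by auto
  have "unit_integral c - K = unit_integral c - unit_integral (\<lambda>t. K)" by simp
  also have "\<dots> = (LINT t|lborel. indicator {0..1::real} t *\<^sub>R c t - indicator {0..1::real} t *\<^sub>R K)"
    by (rule Bochner_Integration.integral_diff[OF F(1) iK, symmetric])
  finally have "cmod (unit_integral c - K) \<le> (LINT t|lborel. cmod (indicator {0..1::real} t *\<^sub>R c t - indicator {0..1::real} t *\<^sub>R K))"
    by (simp only: Bochner_Integration.integral_norm_bound)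
  also have "\<dots> \<le> unit_integral (\<lambda>t. s * M)"
  proof (rule Bochner_Integration.integral_mono)
    show "integrable lborel (\<lambda>t. cmod (indicator {0..1::real} t *\<^sub>R c t - indicator {0..1::real} t *\<^sub>R K))"
      by (intro integrable_norm Bochner_Integration.integrable_diff iK F(1))
    fix t :: real
    show "cmod (indicator {0..1::real} t *\<^sub>R c t - indicator {0..1::real} t *\<^sub>R K) \<le> indicator {0..1::real} t *\<^sub>R (s * M)"
      using bound[of t] by (cases "t \<in> {0..1}") simp_all
  qed auto
  also have "\<dots> = s * M" by simp
  finally have avg: "cmod (unit_integral c - K) \<le> s * M" .
  have "cmod (of_real s * unit_integral c - of_real s * K) = s * cmod (unit_integral c - K)"
    using s by (simp add: norm_mult flip: right_diff_distrib)
  also have "\<dots> \<le> s * (s * M)" using avg s by (intro mult_left_mono) auto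
  finally show ?thesis unfolding inc K_def[symmetric] M_def[symmetric] by (simp add: power2_eq_square mult.assoc)
qed

text \<open>The integral of \<open>f g\<close> over the box does not change under a shift by \<open>s b\<close>. Its increment \<open>X + Y + Z\<close>
  is therefore zero; it also equals \<open>s I\<close> up to terms of second order in \<open>s\<close>, where \<open>I = 0\<close> is the
  claim.\<close>

lemma periodic_integration_by_parts:
  fixes f f' g g' :: "'a::euclidean_space \<Rightarrow> complex"
  assumes f: "periodic_pderiv p q b f f'" and g: "periodic_pderiv p q b g g'"
    and b: "b \<in> Basis" and pos: "0 < (q - p) \<bullet> b"
  shows "(LINT x|lebesgue_on (box p q). f' x * g x) = - (LINT x|lebesgue_on (box p q). f x * g' x)"
proof -
  let ?B = "box p q" and ?J = "\<lambda>h. integral\<^sup>L (lebesgue_on (box p q)) h"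
  have pf: "periodic_L2 p q b f" and pg: "periodic_L2 p q b g" using f g by (auto simp: periodic_pderiv_def)
  then have L: "f \<in> L2_space ?B" "g \<in> L2_space ?B" by (auto simp: periodic_L2_def)
  define I where "I = ?J (\<lambda>x. f' x * g x) + ?J (\<lambda>x. f x * g' x)"
  define M where "M = sqrt (L2_sq ?B f') * sqrt (L2_sq ?B g')"
  have main: "cmod I \<le> s * (3 * M)" if s: "0 < s" "s \<le> (q - p) \<bullet> b" for s
  proof -
    let ?v = "s *\<^sub>R b"
    have s': "0 \<le> s" using s by simp
    note fv = L2_space_box_shift(1)[OF pf b s' s(2)] and gv = L2_space_box_shift(1)[OF pg b s' s(2)]
    note df = L2_space_diff[OF fv L(1)] and dg = L2_space_diff[OF gv L(2)]
    define X where "X = ?J (\<lambda>x. (f (x + ?v) - f x) * (g (x + ?v) - g x))"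
    define Y where "Y = ?J (\<lambda>x. g x * (f (x + ?v) - f x))"
    define Z where "Z = ?J (\<lambda>x. f x * (g (x + ?v) - g x))"
    have "X + Y + Z = ?J (\<lambda>x. (f (x + ?v) - f x) * (g (x + ?v) - g x) + g x * (f (x + ?v) - f x) + f x * (g (x + ?v) - g x))"
      unfolding X_def Y_def Z_def
      using L2_space_integrable_mult[OF df dg] L2_space_integrable_mult[OF L(2) df] L2_space_integrable_mult[OF L(1) dg]
      by (simp only: Bochner_Integration.integral_add Bochner_Integration.integrable_add)
    also have "\<dots> = ?J (\<lambda>x. f (x + ?v) * g (x + ?v) - f x * g x)" by (simp add: algebra_simps)
    also have "\<dots> = 0"
      using integral_mult_box_shift[OF pf pg b s' s(2)] L2_space_integrable_mult[OF fv gv] L2_space_integrable_mult[OF L]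
      by simp
    finally have sum0: "X + Y + Z = 0" .
    have sq: "sqrt (L2_sq ?B (\<lambda>x. u (x + ?v) - u x)) \<le> s * sqrt (L2_sq ?B u')" if "periodic_pderiv p q b u u'" for u u'
      using periodic_shift_difference[OF that b s' s(2)] s
      by (intro real_le_lsqrt) (auto simp: power_mult_distrib L2_sq_nonneg)
    have "cmod X \<le> sqrt (L2_sq ?B (\<lambda>x. f (x + ?v) - f x)) * sqrt (L2_sq ?B (\<lambda>x. g (x + ?v) - g x))"
      unfolding X_def by (rule cmod_integral_mult_le[OF df dg])
    also have "\<dots> \<le> (s * sqrt (L2_sq ?B f')) * (s * sqrt (L2_sq ?B g'))"
      using s by (intro mult_mono sq f g) (auto simp: L2_sq_nonneg)
    finally have bX: "cmod X \<le> s\<^sup>2 * M" by (simp add: M_def power2_eq_square mult_ac)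
    have bY: "cmod (Y - of_real s * ?J (\<lambda>x. g x * f' x)) \<le> s\<^sup>2 * M"
      using periodic_increment_first_order[OF g f b s] unfolding Y_def M_def by (simp add: mult.commute)
    have bZ: "cmod (Z - of_real s * ?J (\<lambda>x. f x * g' x)) \<le> s\<^sup>2 * M"
      using periodic_increment_first_order[OF f g b s] unfolding Z_def M_def .
    have "of_real s * I = of_real s * ?J (\<lambda>x. g x * f' x) + of_real s * ?J (\<lambda>x. f x * g' x)"
      by (simp add: I_def distrib_left mult.commute[of "g _"])
    also have "\<dots> = - (X + (Y - of_real s * ?J (\<lambda>x. g x * f' x)) + (Z - of_real s * ?J (\<lambda>x. f x * g' x)))"
      using sum0 by (simp add: algebra_simps)
    finally have "cmod (of_real s * I) = cmod (X + (Y - of_real s * ?J (\<lambda>x. g x * f' x)) + (Z - of_real s * ?J (\<lambda>x. f x * g' x)))"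
      by (simp only: norm_minus_cancel)
    also have "\<dots> \<le> s\<^sup>2 * M + s\<^sup>2 * M + s\<^sup>2 * M"
      by (intro norm_triangle_le add_mono order_trans[OF norm_triangle_ineq] bX bY bZ)
    finally have "cmod (of_real s * I) \<le> s\<^sup>2 * M + s\<^sup>2 * M + s\<^sup>2 * M" .
    then have "s * cmod I \<le> s * (s * (3 * M))" using s by (simp add: norm_mult power2_eq_square mult_ac)
    then show ?thesis using s by (simp only: mult_le_cancel_left_pos)
  qed
  have "I = 0"
  proof (rule ccontr)
    assume "I \<noteq> 0"
    then have pI: "cmod I > 0" by simp
    define s where "s = min ((q - p) \<bullet> b) (cmod I / (2 * (3 * M + 1)))"
    have M: "M \<ge> 0" by (auto simp: M_def L2_sq_nonneg)
    then have "0 < s" "s \<le> (q - p) \<bullet> b" using pos pI by (auto simp: s_def)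
    then have "cmod I \<le> s * (3 * M)" by (rule main)
    also have "\<dots> \<le> cmod I / (2 * (3 * M + 1)) * (3 * M)" using M by (intro mult_right_mono) (auto simp: s_def)
    also have "\<dots> = cmod I * (3 * M / (2 * (3 * M + 1)))" by simp
    also have "\<dots> < cmod I * 1" using M by (intro mult_strict_left_mono[OF _ pI]) (simp add: divide_less_eq)
    finally show False by simp
  qed
  then show ?thesis by (simp add: I_def eq_neg_iff_add_eq_0)
qed

section \<open>Periodic functions of class H2\<close>

lemma bounded_subset_nat_ball:
  fixes D :: "'a::euclidean_space set"
  assumes "bounded D" obtains n :: nat where "D \<subseteq> ball 0 (real n)"
proof -
  obtain r where "D \<subseteq> ball 0 r" using bounded_subset_ballD[OF assms] by blast
  moreover obtain n :: nat where "r \<le> real n" using real_arch_simple by blast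
  ultimately show ?thesis using subset_ball[of r "real n" 0] that by blast
qed

lemma L2_space_mult_supported:
  fixes h f :: "'a::euclidean_space \<Rightarrow> complex"
  assumes h: "continuous_on UNIV h" "compact K" "\<And>x. x \<notin> K \<Longrightarrow> h x = 0"
    and f: "\<And>n::nat. f \<in> L2_space (ball 0 (real n))"
  shows "(\<lambda>x. h x * f x) \<in> L2_space UNIV"
proof -
  obtain n :: nat where n: "K \<subseteq> ball 0 (real n)" using bounded_subset_nat_ball compact_imp_bounded[OF h(2)] by blast
  obtain M where M: "\<And>x. cmod (h x) \<le> M * indicator K x"
    using bounded_by_indicator[OF h] by blast
  let ?f = "\<lambda>x. indicator (ball 0 (real n)) x * f x"
  have fL: "?f \<in> L2_space UNIV" by (rule L2_space_extend[OF f]) simp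
  have hm: "h \<in> borel_measurable lebesgue"
    using h(1) by (simp add: borel_measurable_continuous_onI measurable_completion)
  have fm: "?f \<in> borel_measurable lebesgue" using L2_space_D(1)[OF fL] by (simp add: lebesgue_on_UNIV_eq)
  have eq: "(\<lambda>x. h x * f x) = (\<lambda>x. h x * ?f x)"
  proof
    fix x
    show "h x * f x = h x * ?f x"
    proof (cases "x \<in> K")
      case True
      then have "x \<in> ball 0 (real n)" using n by blast
      then show ?thesis by simp
    qed (simp add: h(3))
  qed
  have m: "(\<lambda>x. h x * ?f x) \<in> borel_measurable lebesgue" using hm fm by (rule borel_measurable_times)
  have "integrable lebesgue (\<lambda>x. (cmod (h x * ?f x))\<^sup>2)"
  proof (rule Bochner_Integration.integrable_bound)
    show "integrable lebesgue (\<lambda>x. M\<^sup>2 * (cmod (?f x))\<^sup>2)"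
      using L2_space_D(2)[OF fL] by (simp add: lebesgue_on_UNIV_eq)
    show "(\<lambda>x. (cmod (h x * ?f x))\<^sup>2) \<in> borel_measurable lebesgue" using m by measurable
    have "cmod (h x) \<le> \<bar>M\<bar>" for x
      using M[of x] by (cases "x \<in> K") auto
    then have "(cmod (h x))\<^sup>2 \<le> M\<^sup>2" for x by (metis abs_le_square_iff abs_norm_cancel)
    then show "AE x in lebesgue. norm ((cmod (h x * ?f x))\<^sup>2) \<le> norm (M\<^sup>2 * (cmod (?f x))\<^sup>2)"
      by (intro AE_I2) (simp add: norm_mult power_mult_distrib mult_right_mono)
  qed
  then show ?thesis unfolding eq L2_space_def using m by (simp add: lebesgue_on_UNIV_eq)
qed

text \<open>Measurability on each ball is enough, since \<open>f\<close> is the limit of its truncations.\<close>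

lemma L2_local_imp_measurable:
  fixes f :: "'a::euclidean_space \<Rightarrow> complex"
  assumes f: "\<And>n::nat. f \<in> L2_space (ball 0 (real n))"
  shows "f \<in> borel_measurable lebesgue"
proof (rule borel_measurable_LIMSEQ_metric)
  show "(\<lambda>x. indicator (ball 0 (real n)) x * f x) \<in> borel_measurable lebesgue" for n
    using L2_space_D(1)[OF L2_space_extend[OF f, of n]] by (simp add: lebesgue_on_UNIV_eq)
  fix x :: 'a
  obtain n :: nat where "norm x < real n" using reals_Archimedean2 by blast
  then have "\<forall>\<^sub>F m in sequentially. indicator (ball 0 (real m)) x * f x = f x"
    by (auto simp: eventually_sequentially indicator_def intro!: exI[of _ n])
  then show "(\<lambda>m. indicator (ball 0 (real m)) x * f x) \<longlonglongrightarrow> f x" by (rule tendsto_eventually)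
qed

text \<open>Membership in \<open>H\<^sup>2\<close> of all balls yields global weak derivatives of first and second order in the
  direction \<open>b\<close>; Borel representatives are chosen, so that periodicity survives only almost
  everywhere.\<close>

lemma periodic_H2_global_pderivs:
  fixes f :: "'a::euclidean_space \<Rightarrow> complex"
  assumes f: "f \<in> periodic_H2_space p q" and b: "b \<in> Basis"
  obtains f0 f1 f2 where "AE x in lebesgue. f x = f0 x" "periodic_pderiv p q b f0 f1" "periodic_pderiv p q b f1 f2"
proof -
  let ?B = "\<lambda>n. ball (0::'a) (real n)"
  have H2: "f \<in> H2_space (?B n)" for n using f by (auto simp: periodic_H2_space_def)
  have perf: "f (x + ((q - p) \<bullet> b) *\<^sub>R b) = f x" for x using f b by (auto simp: periodic_H2_space_def)
  note d = H2_space_D[OF open_ball H2 b]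
  have fL: "f \<in> L2_space (?B n)" for n by (rule d(1))
  obtain f0 where f0: "f0 \<in> borel_measurable borel" "AE x in lebesgue. f x = f0 x"
    by (rule complex_borel_representative[OF L2_local_imp_measurable[OF fL]])
  have f0L: "f0 \<in> L2_space (?B n)" for n
    by (rule L2_space_cong_AE(1)[OF fL _ open_ball]) (use f0(2) in \<open>auto elim: eventually_mono\<close>)
  have ex1: "\<exists>g\<in>L2_space (?B n). has_weak_pderiv (?B n) b f g" for n
    using d(2)[of n] d(3)[of n] by blast
  obtain f1 where f1: "f1 \<in> borel_measurable borel" "has_weak_pderiv UNIV b f f1" "\<And>n::nat. f1 \<in> L2_space (?B n)"
    using global_weak_pderiv[OF ex1] by blast
  have w01: "has_weak_pderiv UNIV b f0 f1"
    by (rule has_weak_pderiv_cong_AE[OF open_UNIV f1(2)]) (use f0(2) in auto)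
  have ex: "\<exists>g\<in>L2_space (?B n). has_weak_pderiv (?B n) b f1 g" for n
  proof -
    have "has_weak_pderiv (?B n) b f f1" by (rule has_weak_pderiv_subset[OF open_UNIV open_ball _ f1(2)]) simp
    from weak_pderiv_AE_eq[OF open_ball this]
    have "has_weak_pderiv (?B n) b f1 (weak_pderiv (?B n) b (weak_pderiv (?B n) b f))"
      by (intro has_weak_pderiv_cong_AE[OF open_ball d(5)[of n]]) auto
    then show ?thesis using d(4)[of n] by blast
  qed
  obtain f2 where f2: "f2 \<in> borel_measurable borel" "has_weak_pderiv UNIV b f1 f2" "\<And>n::nat. f2 \<in> L2_space (?B n)"
    using global_weak_pderiv[OF ex] by blast
  \<comment> \<open>The null set on which \<open>f\<close> and \<open>f0\<close> differ is shifted
      as well.\<close>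
  have p0: "box_periodic p q b f0"
  proof -
    obtain N where N: "N \<in> null_sets lborel" "{x. f x \<noteq> f0 x} \<subseteq> N"
      using f0(2) by (auto simp: eventually_ae_filter null_sets_completion_iff2)
    have 1: "AE x in lborel. x \<notin> N" by (rule AE_not_in[OF N(1)])
    from 1 AE_lborel_shift[OF 1, of "((q - p) \<bullet> b) *\<^sub>R b"]
    show ?thesis
    proof eventually_elim
      case (elim x)
      then have "f x = f0 x" "f (x + ((q - p) \<bullet> b) *\<^sub>R b) = f0 (x + ((q - p) \<bullet> b) *\<^sub>R b)" using N(2) by auto
      then show ?case using perf by metis
    qed
  qed
  have p1: "box_periodic p q b f1"
    by (rule weak_pderiv_periodic[OF f0(1) f1(1) w01 p0])
  have p2: "box_periodic p q b f2"
    by (rule weak_pderiv_periodic[OF f1(1) f2(1,2) p1])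
  obtain n :: nat where n: "box p q \<subseteq> ball 0 (real n)" using bounded_subset_nat_ball bounded_box by blast
  have sub: "u \<in> L2_space (box p q)" if "\<And>n::nat. u \<in> L2_space (?B n)" for u
    by (rule L2_space_subset[OF that _ _ n]) auto
  have "periodic_L2 p q b f0" "periodic_L2 p q b f1" "periodic_L2 p q b f2"
    using f0(1) f1(1) f2(1) sub[OF f0L] sub[OF f1(3)] sub[OF f2(3)] p0 p1 p2 by (auto simp: periodic_L2_def)
  then show ?thesis using w01 f2(2) by (intro that[OF f0(2), of f1 f2]) (auto simp: periodic_pderiv_def)
qed

lemma periodic_pderiv_cnj:
  assumes "periodic_pderiv p q b g g'"
  shows "periodic_pderiv p q b (\<lambda>x. cnj (g x)) (\<lambda>x. cnj (g' x))"
proof -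
  have "periodic_L2 p q b (\<lambda>x. cnj (u x))" if "periodic_L2 p q b u" for u
    using that by (auto simp: periodic_L2_def borel_measurable_complex_iff L2_space_cnj elim: eventually_mono)
  then show ?thesis using assms has_weak_pderiv_cnj[OF open_UNIV] by (auto simp: periodic_pderiv_def)
qed

lemma periodic_H2_integration_by_parts:
  fixes F G :: "'a::euclidean_space \<Rightarrow> complex"
  assumes F: "F \<in> periodic_H2_space p q" and G: "G \<in> periodic_H2_space p q" and b: "b \<in> Basis"
    and ne: "box p q \<noteq> {}"
  shows "(LINT x|lebesgue_on (box p q). weak_pderiv (box p q) b (weak_pderiv (box p q) b F) x * cnj (G x)) =
    - (LINT x|lebesgue_on (box p q). weak_pderiv (box p q) b F x * cnj (weak_pderiv (box p q) b G x))"
proof -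
  let ?B = "box p q"
  obtain F0 F1 F2 where F012: "AE x in lebesgue. F x = F0 x" "periodic_pderiv p q b F0 F1" "periodic_pderiv p q b F1 F2"
    by (rule periodic_H2_global_pderivs[OF F b])
  obtain G0 G1 G2 where G012: "AE x in lebesgue. G x = G0 x" "periodic_pderiv p q b G0 G1" "periodic_pderiv p q b G1 G2"
    by (rule periodic_H2_global_pderivs[OF G b])
  have pos: "0 < (q - p) \<bullet> b" using ne b by (auto simp: box_ne_empty inner_diff_left)
  have ibp: "(LINT x|lebesgue_on ?B. F2 x * cnj (G0 x)) = - (LINT x|lebesgue_on ?B. F1 x * cnj (G1 x))"
    by (rule periodic_integration_by_parts[OF F012(3) periodic_pderiv_cnj[OF G012(2)] b pos])
  have L: "F1 \<in> L2_space ?B" "F2 \<in> L2_space ?B" "G0 \<in> L2_space ?B" "G1 \<in> L2_space ?B"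
    using F012 G012 by (auto simp: periodic_pderiv_def periodic_L2_def)
  have w1: "AE x in lebesgue. x \<in> ?B \<longrightarrow> weak_pderiv ?B b H x = H1 x"
    if H: "AE x in lebesgue. x \<in> ?B \<longrightarrow> H x = H0 x" "periodic_pderiv p q b H0 H1" for H H0 H1
  proof -
    have "has_weak_pderiv ?B b H0 H1"
      using H(2) by (intro has_weak_pderiv_subset[OF open_UNIV open_box]) (auto simp: periodic_pderiv_def)
    then have "has_weak_pderiv ?B b H H1"
      by (rule has_weak_pderiv_cong_AE[OF open_box]) (use H(1) in \<open>auto elim: eventually_mono\<close>)
    then show ?thesis by (rule weak_pderiv_AE_eq[OF open_box])
  qed
  have aF1: "AE x in lebesgue. x \<in> ?B \<longrightarrow> weak_pderiv ?B b F x = F1 x"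
    by (rule w1[OF _ F012(2)]) (use F012(1) in \<open>auto elim: eventually_mono\<close>)
  have aG1: "AE x in lebesgue. x \<in> ?B \<longrightarrow> weak_pderiv ?B b G x = G1 x"
    by (rule w1[OF _ G012(2)]) (use G012(1) in \<open>auto elim: eventually_mono\<close>)
  note aF2 = w1[OF aF1 F012(3)]
  have HF: "F \<in> H2_space ?B" and HG: "G \<in> H2_space ?B" using F G by (auto simp: periodic_H2_space_def)
  note dF = H2_space_D[OF open_box HF b] and dG = H2_space_D[OF open_box HG b]
  have "(LINT x|lebesgue_on ?B. weak_pderiv ?B b (weak_pderiv ?B b F) x * cnj (G x)) = (LINT x|lebesgue_on ?B. F2 x * cnj (G0 x))"
  proof (rule integral_cong_AE)
    show "AE x in lebesgue_on ?B. weak_pderiv ?B b (weak_pderiv ?B b F) x * cnj (G x) = F2 x * cnj (G0 x)"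
      unfolding AE_lebesgue_on_iff[OF open_box] using aF2 G012(1) by eventually_elim auto
  qed (intro borel_measurable_integrable L2_space_integrable_mult L2_space_cnj dF dG L)+
  moreover have "(LINT x|lebesgue_on ?B. weak_pderiv ?B b F x * cnj (weak_pderiv ?B b G x)) = (LINT x|lebesgue_on ?B. F1 x * cnj (G1 x))"
  proof (rule integral_cong_AE)
    show "AE x in lebesgue_on ?B. weak_pderiv ?B b F x * cnj (weak_pderiv ?B b G x) = F1 x * cnj (G1 x)"
      unfolding AE_lebesgue_on_iff[OF open_box] using aF1 aG1 by eventually_elim auto
  qed (intro borel_measurable_integrable L2_space_integrable_mult L2_space_cnj dF dG L)+
  ultimately show ?thesis using ibp by simp
qed

text \<open>A bump function \<open>\<eta>\<close> that is bounded away from zero on the box makes \<open>\<eta> f\<close> an \<open>H\<^sup>1\<close> function of the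
  whole space.\<close>

lemma periodic_H2_imp_L4:
  fixes f :: "'a::euclidean_space \<Rightarrow> complex"
  assumes dim: "DIM('a) \<le> 3" and f: "f \<in> periodic_H2_space p q"
  shows "integrable (lebesgue_on (box p q)) (\<lambda>x. (cmod (f x)) ^ 4)"
proof -
  define \<eta> where "\<eta> = bump 1 (p - One) (q + One)"
  let ?K = "cbox (p - One) (q + One)"
  have eta: "\<And>m. times_continuously_differentiable m \<eta>" "\<And>x. x \<notin> ?K \<Longrightarrow> \<eta> x = 0"
    unfolding \<eta>_def using box_subset_cbox by (auto intro: tcd_bump bump_outside)
  have test: "\<eta> \<in> test_functions UNIV" unfolding \<eta>_def by (rule bump_test) auto
  obtain K where K: "compact K" "K \<subseteq> UNIV" "\<And>x. x \<notin> K \<Longrightarrow> \<eta> x = 0" "\<And>b x. x \<notin> K \<Longrightarrow> ddir b \<eta> x = 0"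
    using test_functions_supp[OF test] by blast
  have H2: "f \<in> H2_space (ball 0 (real n))" for n using f by (auto simp: periodic_H2_space_def)
  have fL: "f \<in> L2_space (ball 0 (real n))" for n using H2 by (auto simp: H2_space_def)
  have "\<forall>b\<in>Basis. \<exists>g. has_weak_pderiv UNIV b f g \<and> (\<forall>n. g \<in> L2_space (ball 0 (real n)))"
  proof
    fix b :: 'a assume b: "b \<in> Basis"
    note d = H2_space_D[OF open_ball H2 b]
    have ex: "\<exists>g\<in>L2_space (ball 0 (real n)). has_weak_pderiv (ball 0 (real n)) b f g" for n
      using d(2)[of n] d(3)[of n] by blast
    show "\<exists>g. has_weak_pderiv UNIV b f g \<and> (\<forall>n. g \<in> L2_space (ball 0 (real n)))"
      using global_weak_pderiv[OF ex] by blast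
  qed
  from bchoice[OF this] obtain G where G: "\<And>b. b \<in> Basis \<Longrightarrow> has_weak_pderiv UNIV b f (G b)"
     "\<And>b n. b \<in> Basis \<Longrightarrow> G b \<in> L2_space (ball 0 (real n))" by blast
  have int: "integrable lebesgue (\<lambda>x. (cmod (\<eta> x * f x)) ^ 4)"
  proof (rule H1_imp_L4_lebesgue[OF dim])
    show "(\<lambda>x. \<eta> x * f x) \<in> L2_space UNIV"
      by (rule L2_space_mult_supported[OF test_functions_D(5)[OF test] K(1) K(3) fL])
    fix b :: 'a assume b: "b \<in> Basis"
    have 1: "(\<lambda>x. \<eta> x * G b x) \<in> L2_space UNIV"
      by (rule L2_space_mult_supported[OF test_functions_D(5)[OF test] K(1) K(3) G(2)[OF b]])
    have 2: "(\<lambda>x. ddir b \<eta> x * f x) \<in> L2_space UNIV"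
      by (rule L2_space_mult_supported[OF test_functions_D(6)[OF test] K(1) K(4) fL])
    show "(\<lambda>x. \<eta> x * G b x + ddir b \<eta> x * f x) \<in> L2_space UNIV"
      using L2_space_lincomb[OF 1 2, of 1 1] by simp
    show "has_weak_pderiv UNIV b (\<lambda>x. \<eta> x * f x) (\<lambda>x. \<eta> x * G b x + ddir b \<eta> x * f x)"
      by (rule has_weak_pderiv_mult_smooth[OF open_UNIV G(1)[OF b] eta(1)])
  qed
  show ?thesis
  proof (cases "box p q = {}")
    case True then show ?thesis by (subst integrable_restrict_space) auto
  next
    case False
    then have ne: "cbox p q \<noteq> {}" using box_subset_cbox by blast
    have "continuous_on (cbox p q) (\<lambda>x. cmod (\<eta> x))"
      using test_functions_D(5)[OF test] by (intro continuous_on_norm) (auto intro: continuous_on_subset)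
    then obtain x0 where x0: "x0 \<in> cbox p q" "\<And>x. x \<in> cbox p q \<Longrightarrow> cmod (\<eta> x0) \<le> cmod (\<eta> x)"
      using continuous_attains_inf[OF compact_cbox ne] by blast
    have "x0 \<in> box (p - One) (q + One)" unfolding mem_box
    proof
      fix i :: 'a assume "i \<in> Basis"
      moreover from this have "p \<bullet> i \<le> x0 \<bullet> i" "x0 \<bullet> i \<le> q \<bullet> i" using x0(1) by (auto simp: mem_box)
      ultimately show "(p - One) \<bullet> i < x0 \<bullet> i \<and> x0 \<bullet> i < (q + One) \<bullet> i"
        by (simp add: inner_diff_left inner_add_left)
    qed
    then have c: "cmod (\<eta> x0) > 0" using bump_pos unfolding \<eta>_def by auto
    have fm: "f \<in> borel_measurable lebesgue" by (rule L2_local_imp_measurable[OF fL])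
    have "integrable lebesgue (\<lambda>x. indicator (box p q) x *\<^sub>R (cmod (f x)) ^ 4)"
    proof (rule Bochner_Integration.integrable_bound)
      show "integrable lebesgue (\<lambda>x. (cmod (\<eta> x * f x)) ^ 4 / (cmod (\<eta> x0)) ^ 4)" using int by simp
      show "(\<lambda>x. indicator (box p q) x *\<^sub>R (cmod (f x)) ^ 4) \<in> borel_measurable lebesgue"
        using fm by (intro borel_measurable_scaleR borel_measurable_indicator borel_measurable_power borel_measurable_norm) auto
      have "(cmod (f x)) ^ 4 \<le> (cmod (\<eta> x * f x)) ^ 4 / (cmod (\<eta> x0)) ^ 4" if "x \<in> box p q" for x
      proof -
        have "cmod (\<eta> x0) \<le> cmod (\<eta> x)" using that box_subset_cbox by (intro x0(2)) blast
        then have "(cmod (\<eta> x0)) ^ 4 * (cmod (f x)) ^ 4 \<le> (cmod (\<eta> x)) ^ 4 * (cmod (f x)) ^ 4"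
          by (intro mult_right_mono power_mono) auto
        then show ?thesis using c by (simp add: norm_mult power_mult_distrib field_simps)
      qed
      then show "AE x in lebesgue. norm (indicator (box p q) x *\<^sub>R (cmod (f x)) ^ 4) \<le> norm ((cmod (\<eta> x * f x)) ^ 4 / (cmod (\<eta> x0)) ^ 4)"
        by (intro AE_I2) (auto simp: indicator_def)
    qed
    then show ?thesis by (subst integrable_restrict_space) auto
  qed
qed

section \<open>Conservation of mass and energy\<close>

lemma mass_eq: "mass D f = L2_sq D f"
  by (simp add: mass_def Lp_norm_2)

lemma hamiltonian_eq:
  assumes D: "open D" and f: "f \<in> H2_space D"
  shows "hamiltonian D lam f = 1/2 * (\<Sum>b\<in>Basis. L2_sq D (weak_pderiv D b f)) + lam/4 * (LINT x|lebesgue_on D. (cmod (f x)) ^ 4)"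
proof -
  have "(Lp_norm D 2 (gradient_norm D f))\<^sup>2 = (LINT x|lebesgue_on D. (\<Sum>b\<in>Basis. (cmod (weak_pderiv D b f x))\<^sup>2))"
    by (simp add: Lp_norm_2 gradient_norm_def sum_nonneg)
  also have "\<dots> = (\<Sum>b\<in>Basis. L2_sq D (weak_pderiv D b f))"
    by (rule Bochner_Integration.integral_sum) (rule L2_space_D(2)[OF H2_space_D(2)[OF D f]])
  finally show ?thesis by (simp add: hamiltonian_def Lp_norm_4)
qed

lemma Re_mult_sum_diff:
  fixes z w :: complex
  shows "Re ((z - w) * cnj (z + w)) = (cmod z)\<^sup>2 - (cmod w)\<^sup>2" "Re ((z + w) * cnj (z - w)) = (cmod z)\<^sup>2 - (cmod w)\<^sup>2"
  unfolding cmod_power2 by (simp_all add: power2_eq_square algebra_simps)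

lemma Re_of_real_mult: "Re (of_real r * z) = r * Re z" by simp

lemma Re_integral_sum_diff:
  assumes X: "X \<in> L2_space D" and Y: "Y \<in> L2_space D"
  shows "Re (LINT x|lebesgue_on D. (X x - Y x) * cnj (X x + Y x)) = L2_sq D X - L2_sq D Y"
    "Re (LINT x|lebesgue_on D. (X x + Y x) * cnj (X x - Y x)) = L2_sq D X - L2_sq D Y"
proof -
  have s: "(\<lambda>x. X x + Y x) \<in> L2_space D" using L2_space_lincomb[OF X Y, of 1 1] by simp
  note d = L2_space_diff[OF X Y]
  have "Re (LINT x|lebesgue_on D. (X x - Y x) * cnj (X x + Y x)) = (LINT x|lebesgue_on D. Re ((X x - Y x) * cnj (X x + Y x)))"
    by (rule integral_Re[symmetric]) (rule L2_space_integrable_mult[OF d L2_space_cnj[OF s]])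
  then show "Re (LINT x|lebesgue_on D. (X x - Y x) * cnj (X x + Y x)) = L2_sq D X - L2_sq D Y"
    unfolding Re_mult_sum_diff using L2_space_D[OF X] L2_space_D[OF Y] by simp
  have "Re (LINT x|lebesgue_on D. (X x + Y x) * cnj (X x - Y x)) = (LINT x|lebesgue_on D. Re ((X x + Y x) * cnj (X x - Y x)))"
    by (rule integral_Re[symmetric]) (rule L2_space_integrable_mult[OF s L2_space_cnj[OF d]])
  then show "Re (LINT x|lebesgue_on D. (X x + Y x) * cnj (X x - Y x)) = L2_sq D X - L2_sq D Y"
    unfolding Re_mult_sum_diff using L2_space_D[OF X] L2_space_D[OF Y] by simp
qed

lemma integral_mult_cnj_self: "(LINT x|lebesgue_on D. X x * cnj (X x)) = of_real (L2_sq D X)"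
  unfolding complex_norm_square[symmetric] by (rule integral_complex_of_real)

text \<open>\<open>tested\<close> is the equation tested with the conjugate of \<open>R' + c R\<close>, after integration by parts. The
  value \<open>c = 1\<close> gives the mass and \<open>c = - 1\<close> the Hamiltonian.\<close>

lemma one_step_conservation:
  fixes D :: "'a::euclidean_space set"
  assumes D: "open D" and \<tau>: "\<tau> \<noteq> 0"
    and R: "R \<in> H2_space D" and R': "R' \<in> H2_space D"
    and R4: "integrable (lebesgue_on D) (\<lambda>x. (cmod (R x)) ^ 4)" "integrable (lebesgue_on D) (\<lambda>x. (cmod (R' x)) ^ 4)"
    and step: "R_step D lam \<tau> R R'"
    and ibp: "\<And>G b. G \<in> {R, R'} \<Longrightarrow> b \<in> Basis \<Longrightarrow>
      (LINT x|lebesgue_on D. weak_pderiv D b (weak_pderiv D b (\<lambda>x. (R' x + R x) / 2)) x * cnj (G x)) =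
      - (LINT x|lebesgue_on D. weak_pderiv D b (\<lambda>x. (R' x + R x) / 2) x * cnj (weak_pderiv D b G x))"
  shows "mass D R' = mass D R \<and> hamiltonian D lam R' = hamiltonian D lam R"
proof -
  define Rm where "Rm = (\<lambda>x. (R' x + R x) / 2)"
  define W where "W x = of_real (lam / 2 * ((cmod (R x))\<^sup>2 + (cmod (R' x))\<^sup>2)) * Rm x" for x
  define G where "G b = weak_pderiv D b R" for b
  define G' where "G' b = weak_pderiv D b R'" for b
  define M where "M b = weak_pderiv D b Rm" for b
  define N where "N b = weak_pderiv D b (M b)" for b
  have Rm: "Rm \<in> H2_space D"
    using H2_space_lincomb[OF D R' R, of "1/2" "1/2"] by (simp add: Rm_def add_divide_distrib)
  have L: "R \<in> L2_space D" "R' \<in> L2_space D" using R R' by (auto simp: H2_space_def)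
  have GL: "G b \<in> L2_space D" "G' b \<in> L2_space D" "M b \<in> L2_space D" "N b \<in> L2_space D" if "b \<in> Basis" for b
    unfolding G_def G'_def M_def N_def using H2_space_D(2,4)[OF D _ that] R R' Rm by auto
  have Mae: "AE x in lebesgue_on D. M b x = (G' b x + G b x) / 2" if b: "b \<in> Basis" for b
  proof -
    have "has_weak_pderiv D b (\<lambda>x. 1/2 * R' x + 1/2 * R x) (\<lambda>x. 1/2 * G' b x + 1/2 * G b x)"
      unfolding G_def G'_def by (rule has_weak_pderiv_lincomb[OF D H2_space_D(3)[OF D R' b] H2_space_D(3)[OF D R b]])
    moreover have "(\<lambda>x. 1/2 * R' x + 1/2 * R x) = Rm" by (auto simp: Rm_def)
    ultimately have "has_weak_pderiv D b Rm (\<lambda>x. 1/2 * G' b x + 1/2 * G b x)" by simp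
    from weak_pderiv_AE_eq[OF D this] show ?thesis
      unfolding AE_lebesgue_on_iff[OF D] M_def by eventually_elim (auto simp: add_divide_distrib)
  qed
  have lap: "laplacian D Rm = (\<lambda>x. \<Sum>b\<in>Basis. N b x)"
    by (simp add: laplacian_def[abs_def] N_def M_def)
  have sumL: "(\<lambda>x. \<Sum>b\<in>B. N b x) \<in> L2_space D" if "finite B" "B \<subseteq> Basis" for B
    using that
  proof (induction B rule: finite_induct)
    case empty
    then show ?case by (simp add: L2_space_def)
  next
    case (insert b B)
    have "(\<lambda>x. 1 * N b x + 1 * (\<Sum>b\<in>B. N b x)) \<in> L2_space D"
      by (rule L2_space_lincomb) (use insert GL(4)[of b] in auto)
    then show ?case using insert by simp
  qed
  have lapL: "laplacian D Rm \<in> L2_space D" unfolding lap by (rule sumL) auto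
  have eq: "AE x in lebesgue_on D. \<i> * ((R' x - R x) / of_real \<tau>) = - laplacian D Rm x + W x"
    using step unfolding R_step_def Let_def Rm_def[symmetric] W_def .
  \<comment> \<open>The equation expresses \<open>W\<close> through functions in
      \<open>L\<^sup>2\<close>.\<close>
  have WL: "W \<in> L2_space D"
  proof (rule L2_space_cong_AE(1)[OF _ _ D])
    have "(\<lambda>x. 1 * ((\<i> / of_real \<tau>) * R' x + (- \<i> / of_real \<tau>) * R x) + 1 * laplacian D Rm x) \<in> L2_space D"
      by (intro L2_space_lincomb L lapL)
    then show "(\<lambda>x. (\<i> / of_real \<tau>) * R' x + (- \<i> / of_real \<tau>) * R x + laplacian D Rm x) \<in> L2_space D" by simp
    show "AE x in lebesgue. x \<in> D \<longrightarrow> (\<i> / of_real \<tau>) * R' x + (- \<i> / of_real \<tau>) * R x + laplacian D Rm x = W x"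
      using eq unfolding AE_lebesgue_on_iff[OF D]
    proof eventually_elim
      case (elim x)
      show ?case
      proof
        assume "x \<in> D"
        then have "\<i> * ((R' x - R x) / of_real \<tau>) = - laplacian D Rm x + W x" using elim by blast
        then show "(\<i> / of_real \<tau>) * R' x + (- \<i> / of_real \<tau>) * R x + laplacian D Rm x = W x"
          by (simp add: algebra_simps diff_divide_distrib)
      qed
    qed
  qed
  have tested: "\<i> / of_real \<tau> * (LINT x|lebesgue_on D. (R' x - R x) * cnj (R' x + c * R x)) =
     (\<Sum>b\<in>Basis. 1/2 * (LINT x|lebesgue_on D. (G' b x + G b x) * cnj (G' b x + c * G b x))) + (LINT x|lebesgue_on D. W x * cnj (R' x + c * R x))"
    for c :: complex
  proof -
    define S where "S = (\<lambda>x. R' x + c * R x)"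
    have SL: "(\<lambda>x. cnj (S x)) \<in> L2_space D"
      unfolding S_def using L2_space_lincomb[OF L(2,1), of 1 c] by (intro L2_space_cnj) simp
    have "\<i> / of_real \<tau> * (LINT x|lebesgue_on D. (R' x - R x) * cnj (S x)) = (LINT x|lebesgue_on D. \<i> * ((R' x - R x) / of_real \<tau>) * cnj (S x))"
      by (simp flip: integral_mult_right_zero add: mult_ac)
    also have "\<dots> = (LINT x|lebesgue_on D. W x * cnj (S x) - laplacian D Rm x * cnj (S x))"
    proof (rule integral_cong_AE)
      show "AE x in lebesgue_on D. \<i> * ((R' x - R x) / of_real \<tau>) * cnj (S x) = W x * cnj (S x) - laplacian D Rm x * cnj (S x)"
        using eq
      proof eventually_elim
        case (elim x)
        show ?case unfolding elim by (simp add: algebra_simps)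
      qed
      have "integrable (lebesgue_on D) (\<lambda>x. (R' x - R x) * cnj (S x))"
        by (rule L2_space_integrable_mult[OF L2_space_diff[OF L(2,1)] SL])
      then have "integrable (lebesgue_on D) (\<lambda>x. (\<i> / of_real \<tau>) * ((R' x - R x) * cnj (S x)))" by simp
      then show "(\<lambda>x. \<i> * ((R' x - R x) / of_real \<tau>) * cnj (S x)) \<in> borel_measurable (lebesgue_on D)"
        by (rule borel_measurable_integrable[THEN measurable_cong[THEN iffD1, rotated]]) simp
      show "(\<lambda>x. W x * cnj (S x) - laplacian D Rm x * cnj (S x)) \<in> borel_measurable (lebesgue_on D)"
        by (intro borel_measurable_integrable Bochner_Integration.integrable_diff L2_space_integrable_mult WL lapL SL)
    qed
    also have "\<dots> = (LINT x|lebesgue_on D. W x * cnj (S x)) - (LINT x|lebesgue_on D. laplacian D Rm x * cnj (S x))"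
      by (intro Bochner_Integration.integral_diff L2_space_integrable_mult WL lapL SL)
    also have "(LINT x|lebesgue_on D. laplacian D Rm x * cnj (S x)) = (\<Sum>b\<in>Basis. (LINT x|lebesgue_on D. N b x * cnj (S x)))"
      unfolding lap sum_distrib_right
      by (rule Bochner_Integration.integral_sum) (intro L2_space_integrable_mult GL SL)
    also have "\<dots> = (\<Sum>b\<in>Basis. - (1/2 * (LINT x|lebesgue_on D. (G' b x + G b x) * cnj (G' b x + c * G b x))))"
    proof (rule sum.cong[OF refl])
      fix b :: 'a assume b: "b \<in> Basis"
      note cL = L2_space_cnj[OF L(2)] L2_space_cnj[OF L(1)] L2_space_cnj[OF GL(2)[OF b]] L2_space_cnj[OF GL(1)[OF b]]
      have T: "(\<lambda>x. cnj (G' b x + c * G b x)) \<in> L2_space D"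
        using L2_space_cnj[OF L2_space_lincomb[OF GL(2)[OF b] GL(1)[OF b], of 1 c]] by simp
      have "(LINT x|lebesgue_on D. N b x * cnj (S x)) = (LINT x|lebesgue_on D. N b x * cnj (R' x) + cnj c * (N b x * cnj (R x)))"
        by (simp add: S_def algebra_simps)
      also have "\<dots> = (LINT x|lebesgue_on D. N b x * cnj (R' x)) + cnj c * (LINT x|lebesgue_on D. N b x * cnj (R x))"
        using L2_space_integrable_mult[OF GL(4)[OF b] cL(1)] L2_space_integrable_mult[OF GL(4)[OF b] cL(2)] by simp
      also have "\<dots> = - ((LINT x|lebesgue_on D. M b x * cnj (G' b x)) + cnj c * (LINT x|lebesgue_on D. M b x * cnj (G b x)))"
        using ibp[of R' b] ibp[of R b] b by (simp add: N_def M_def Rm_def G_def G'_def)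
      also have "(LINT x|lebesgue_on D. M b x * cnj (G' b x)) + cnj c * (LINT x|lebesgue_on D. M b x * cnj (G b x)) =
          (LINT x|lebesgue_on D. M b x * cnj (G' b x) + cnj c * (M b x * cnj (G b x)))"
        using L2_space_integrable_mult[OF GL(3)[OF b] cL(3)] L2_space_integrable_mult[OF GL(3)[OF b] cL(4)] by simp
      also have "\<dots> = (LINT x|lebesgue_on D. M b x * cnj (G' b x + c * G b x))"
        by (simp add: algebra_simps)
      also have "\<dots> = (LINT x|lebesgue_on D. 1/2 * ((G' b x + G b x) * cnj (G' b x + c * G b x)))"
      proof (rule integral_cong_AE)
        show "AE x in lebesgue_on D. M b x * cnj (G' b x + c * G b x) = 1/2 * ((G' b x + G b x) * cnj (G' b x + c * G b x))"
          using Mae[OF b] by eventually_elim simp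
        show "(\<lambda>x. M b x * cnj (G' b x + c * G b x)) \<in> borel_measurable (lebesgue_on D)"
          by (intro borel_measurable_integrable L2_space_integrable_mult GL b T)
        have "(\<lambda>x. G' b x + G b x) \<in> L2_space D"
          using L2_space_lincomb[OF GL(2)[OF b] GL(1)[OF b], of 1 1] by simp
        then show "(\<lambda>x. 1/2 * ((G' b x + G b x) * cnj (G' b x + c * G b x))) \<in> borel_measurable (lebesgue_on D)"
          by (intro borel_measurable_integrable integrable_mult_right L2_space_integrable_mult T)
      qed
      finally show "(LINT x|lebesgue_on D. N b x * cnj (S x)) = - (1/2 * (LINT x|lebesgue_on D. (G' b x + G b x) * cnj (G' b x + c * G b x)))"
        by simp
    qed
    finally show ?thesis by (simp add: S_def sum_negf)
  qed
  have sumL2: "(\<lambda>x. R' x + R x) \<in> L2_space D" using L2_space_lincomb[OF L(2,1), of 1 1] by simp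
  have "Im (LINT x|lebesgue_on D. W x * cnj (R' x + R x)) = (LINT x|lebesgue_on D. Im (W x * cnj (R' x + R x)))"
    by (rule integral_Im[symmetric]) (rule L2_space_integrable_mult[OF WL L2_space_cnj[OF sumL2]])
  also have "\<dots> = 0"
  proof -
    have "Im (W x * cnj (R' x + R x)) = 0" for x
    proof -
      have "W x * cnj (R' x + R x) = of_real (lam / 4 * ((cmod (R x))\<^sup>2 + (cmod (R' x))\<^sup>2)) * ((R' x + R x) * cnj (R' x + R x))"
        by (simp add: W_def Rm_def)
      also have "\<dots> = of_real (lam / 4 * ((cmod (R x))\<^sup>2 + (cmod (R' x))\<^sup>2) * (cmod (R' x + R x))\<^sup>2)"
        by (simp only: complex_norm_square[symmetric] of_real_mult of_real_power)
      finally show ?thesis by (simp only: Im_complex_of_real)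
    qed
    then show ?thesis by simp
  qed
  finally have ImW: "Im (LINT x|lebesgue_on D. W x * cnj (R' x + R x)) = 0" .
  \<comment> \<open>For \<open>c = 1\<close> the gradient term is the integral of a squared
      modulus, hence real.\<close>
  have "Im (\<i> / of_real \<tau> * (LINT x|lebesgue_on D. (R' x - R x) * cnj (R' x + R x))) = 0"
  proof -
    have "(LINT x|lebesgue_on D. (G' b x + G b x) * cnj (G' b x + 1 * G b x)) = of_real (L2_sq D (\<lambda>x. G' b x + G b x))" for b
      unfolding mult_1 by (rule integral_mult_cnj_self)
    then show ?thesis using tested[of 1] ImW unfolding mult_1 by simp
  qed
  then have "Re (LINT x|lebesgue_on D. (R' x - R x) * cnj (R' x + R x)) = 0"
    using \<tau> by simp
  then have mass: "L2_sq D R' = L2_sq D R"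
    using Re_integral_sum_diff(1)[OF L(2,1)] by simp
  have "Re (LINT x|lebesgue_on D. W x * cnj (R' x - R x)) = (LINT x|lebesgue_on D. Re (W x * cnj (R' x - R x)))"
    by (rule integral_Re[symmetric]) (rule L2_space_integrable_mult[OF WL L2_space_cnj[OF L2_space_diff[OF L(2,1)]]])
  also have "\<dots> = (LINT x|lebesgue_on D. lam / 4 * ((cmod (R' x)) ^ 4 - (cmod (R x)) ^ 4))"
  proof -
    have pw: "Re (W x * cnj (R' x - R x)) = lam / 4 * ((cmod (R' x)) ^ 4 - (cmod (R x)) ^ 4)" for x
    proof -
      have "W x * cnj (R' x - R x) = of_real (lam / 4 * ((cmod (R x))\<^sup>2 + (cmod (R' x))\<^sup>2)) * ((R' x + R x) * cnj (R' x - R x))"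
        by (simp add: W_def Rm_def)
      then have "Re (W x * cnj (R' x - R x)) = lam / 4 * ((cmod (R x))\<^sup>2 + (cmod (R' x))\<^sup>2) * Re ((R' x + R x) * cnj (R' x - R x))"
        by (simp only: Re_of_real_mult)
      also have "\<dots> = lam / 4 * (((cmod (R x))\<^sup>2 + (cmod (R' x))\<^sup>2) * ((cmod (R' x))\<^sup>2 - (cmod (R x))\<^sup>2))"
        by (simp only: Re_mult_sum_diff mult.assoc)
      also have "((cmod (R x))\<^sup>2 + (cmod (R' x))\<^sup>2) * ((cmod (R' x))\<^sup>2 - (cmod (R x))\<^sup>2) = (cmod (R' x)) ^ 4 - (cmod (R x)) ^ 4"
        by (simp add: algebra_simps power_add[symmetric])
      finally show ?thesis .
    qed
    show ?thesis unfolding pw ..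
  qed
  also have "\<dots> = lam / 4 * ((LINT x|lebesgue_on D. (cmod (R' x)) ^ 4) - (LINT x|lebesgue_on D. (cmod (R x)) ^ 4))"
    using R4 by simp
  finally have ReW: "Re (LINT x|lebesgue_on D. W x * cnj (R' x - R x)) =
      lam / 4 * ((LINT x|lebesgue_on D. (cmod (R' x)) ^ 4) - (LINT x|lebesgue_on D. (cmod (R x)) ^ 4))" .
  have t: "\<i> / of_real \<tau> * (LINT x|lebesgue_on D. (R' x - R x) * cnj (R' x - R x)) =
     (\<Sum>b\<in>Basis. 1/2 * (LINT x|lebesgue_on D. (G' b x + G b x) * cnj (G' b x - G b x))) + (LINT x|lebesgue_on D. W x * cnj (R' x - R x))"
    using tested[of "-1"] by simp
  \<comment> \<open>For \<open>c = - 1\<close> the left-hand side is \<open>\<i>\<close> times a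
      real number.\<close>
  have "Re (\<i> / of_real \<tau> * (LINT x|lebesgue_on D. (R' x - R x) * cnj (R' x - R x))) = 0"
    unfolding integral_mult_cnj_self[where X="\<lambda>x. R' x - R x"] by simp
  then have "0 = (\<Sum>b\<in>Basis. 1/2 * Re (LINT x|lebesgue_on D. (G' b x + G b x) * cnj (G' b x - G b x))) +
      lam / 4 * ((LINT x|lebesgue_on D. (cmod (R' x)) ^ 4) - (LINT x|lebesgue_on D. (cmod (R x)) ^ 4))"
    unfolding t by (simp add: ReW del: complex_cnj_diff)
  also have "(\<Sum>b\<in>Basis. 1/2 * Re (LINT x|lebesgue_on D. (G' b x + G b x) * cnj (G' b x - G b x))) =
      (\<Sum>b\<in>Basis. 1/2 * (L2_sq D (G' b) - L2_sq D (G b)))"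
    by (intro sum.cong refl) (simp only: Re_integral_sum_diff(2)[OF GL(2) GL(1)])
  also have "\<dots> = 1/2 * ((\<Sum>b\<in>Basis. L2_sq D (G' b)) - (\<Sum>b\<in>Basis. L2_sq D (G b)))"
    by (simp only: sum_distrib_left[symmetric] sum_subtractf)
  finally have "hamiltonian D lam R' = hamiltonian D lam R"
    unfolding hamiltonian_eq[OF D R] hamiltonian_eq[OF D R'] G_def G'_def by (simp add: algebra_simps)
  with mass show ?thesis by (simp add: mass_eq)
qed

lemma periodic_H2_space_lincomb:
  assumes "F \<in> periodic_H2_space p q" "G \<in> periodic_H2_space p q"
  shows "(\<lambda>x. c * F x + d * G x) \<in> periodic_H2_space p q"
  using assms unfolding periodic_H2_space_def by (auto intro: H2_space_lincomb)

theorem theorem2p1: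
  fixes D :: "'a::euclidean_space set"
    and k :: nat and \<beta> :: "nat \<Rightarrow> real" and lam \<tau> :: real
    and N :: enat
    and R :: "nat \<Rightarrow> 'a \<Rightarrow> complex" and u :: "int \<Rightarrow> 'a \<Rightarrow> complex"
  assumes dim: "DIM('a) \<in> {1, 2, 3}"
    and domain: "open D" "connected D" "bounded D" "D \<noteq> {}"
    and k: "k \<ge> 1" and \<beta>: "\<beta> 0 \<noteq> 0"
    and lam: "lam \<in> {1, -1}" and \<tau>: "\<tau> > 0"
    and boundary:
      "(\<forall>n. enat n \<le> N \<longrightarrow> R n \<in> H2_space D \<inter> H10_space D) \<or>
       (\<exists>p q. D = box p q \<and> (\<forall>n. enat n \<le> N \<longrightarrow> R n \<in> periodic_H2_space p q))"
    and start: "AE x in lebesgue_on D. R 0 x = (\<Sum>j<k. of_real (\<beta> j) * u (- int j) x)"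
    and scheme_R: "\<And>n. enat n < N \<Longrightarrow> R_step D lam \<tau> (R n) (R (Suc n))"
    and scheme_u: "\<And>n. enat n < N \<Longrightarrow>
      AE x in lebesgue_on D.
        u (int n + 1) x =
          inverse (of_real (\<beta> 0)) *
            (R (Suc n) x - (\<Sum>j=1..k-1. of_real (\<beta> j) * u (int n + 1 - int j) x))"
  shows "\<forall>n\<ge>1. enat n \<le> N \<longrightarrow>
           mass D (R n) = mass D (R 0) \<and> hamiltonian D lam (R n) = hamiltonian D lam (R 0)"
proof -
  have d3: "DIM('a) \<le> 3" using dim by auto
  have step: "mass D (R (Suc n)) = mass D (R n) \<and> hamiltonian D lam (R (Suc n)) = hamiltonian D lam (R n)"
    if n: "enat (Suc n) \<le> N" for n
  proof -
    have n': "enat n \<le> N" "enat n < N" using n by (auto simp: Suc_ile_eq)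
    have t0: "\<tau> \<noteq> 0" using \<tau> by simp
    have mid: "(\<lambda>x. (R (Suc n) x + R n x) / 2) = (\<lambda>x. 1/2 * R (Suc n) x + 1/2 * R n x)"
      by (auto simp: add_divide_distrib)
    from boundary show ?thesis
    proof
      assume *: "\<forall>n. enat n \<le> N \<longrightarrow> R n \<in> H2_space D \<inter> H10_space D"
      then have H2: "R n \<in> H2_space D" "R (Suc n) \<in> H2_space D" and H10: "R n \<in> H10_space D" "R (Suc n) \<in> H10_space D"
        using n n' by blast+
      have Hm: "(\<lambda>x. (R (Suc n) x + R n x) / 2) \<in> H2_space D"
        unfolding mid by (rule H2_space_lincomb[OF domain(1) H2(2,1)])
      show ?thesis
      proof (rule one_step_conservation[OF domain(1) t0 H2 _ _ scheme_R[OF n'(2)]])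
        show "integrable (lebesgue_on D) (\<lambda>x. (cmod (R n x)) ^ 4)" "integrable (lebesgue_on D) (\<lambda>x. (cmod (R (Suc n) x)) ^ 4)"
          using H10 by (auto intro: H10_imp_L4[OF d3 domain(1,3)])
        fix G and b :: 'a assume "G \<in> {R n, R (Suc n)}" and b: "b \<in> Basis"
        then have G: "G \<in> H10_space D" using H10 by auto
        note d = H2_space_D[OF domain(1) Hm b]
        show "(LINT x|lebesgue_on D. weak_pderiv D b (weak_pderiv D b (\<lambda>x. (R (Suc n) x + R n x) / 2)) x * cnj (G x)) =
          - (LINT x|lebesgue_on D. weak_pderiv D b (\<lambda>x. (R (Suc n) x + R n x) / 2) x * cnj (weak_pderiv D b G x))"
          by (rule Dirichlet_integration_by_parts[OF domain(1,3) d(2,4,5) G b])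
      qed
    next
      assume "\<exists>p q. D = box p q \<and> (\<forall>n. enat n \<le> N \<longrightarrow> R n \<in> periodic_H2_space p q)"
      then obtain p q where pq: "D = box p q" and *: "\<forall>n. enat n \<le> N \<longrightarrow> R n \<in> periodic_H2_space p q" by blast
      have P: "R n \<in> periodic_H2_space p q" "R (Suc n) \<in> periodic_H2_space p q" using * n n' by blast+
      have H2: "R n \<in> H2_space D" "R (Suc n) \<in> H2_space D"
        using P domain unfolding periodic_H2_space_def by auto
      have Pm: "(\<lambda>x. (R (Suc n) x + R n x) / 2) \<in> periodic_H2_space p q"
        unfolding mid by (rule periodic_H2_space_lincomb[OF P(2,1)])
      show ?thesis
      proof (rule one_step_conservation[OF domain(1) t0 H2 _ _ scheme_R[OF n'(2)]])
        show "integrable (lebesgue_on D) (\<lambda>x. (cmod (R n x)) ^ 4)" "integrable (lebesgue_on D) (\<lambda>x. (cmod (R (Suc n) x)) ^ 4)"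
          unfolding pq using P by (auto intro: periodic_H2_imp_L4[OF d3])
        fix G and b :: 'a assume "G \<in> {R n, R (Suc n)}" and b: "b \<in> Basis"
        then have G: "G \<in> periodic_H2_space p q" using P by auto
        show "(LINT x|lebesgue_on D. weak_pderiv D b (weak_pderiv D b (\<lambda>x. (R (Suc n) x + R n x) / 2)) x * cnj (G x)) =
          - (LINT x|lebesgue_on D. weak_pderiv D b (\<lambda>x. (R (Suc n) x + R n x) / 2) x * cnj (weak_pderiv D b G x))"
          unfolding pq by (rule periodic_H2_integration_by_parts[OF Pm G b]) (use domain(4) pq in simp)
      qed
    qed
  qed
  have "enat n \<le> N \<longrightarrow> mass D (R n) = mass D (R 0) \<and> hamiltonian D lam (R n) = hamiltonian D lam (R 0)" for n
  proof (induction n)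
    case (Suc n)
    show ?case
    proof
      assume n: "enat (Suc n) \<le> N"
      then have "enat n \<le> N" by (auto simp: Suc_ile_eq)
      with Suc step[OF n] show "mass D (R (Suc n)) = mass D (R 0) \<and> hamiltonian D lam (R (Suc n)) = hamiltonian D lam (R 0)"
        by simp
    qed
  qed simp
  then show ?thesis by blast
qed

end
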